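(* Let $f:X\to X$ be a conservative, exact, measure-preserving transformation of an infinite $\sigma$-finite measure space $(X,\mu)$, with a set $Y$ and decompositions $X_n=\bigcup_p X_{n,p}$, $Y_n=\bigcup_p\bigcup_{\psi(r)=p}Y_{n,r}$ ($n\ge n_0$) as in the context. Suppose that: (i) there are constants $\alpha\in(0,1]$ and $\gamma_p>0$ ($1\le p\le q$) such that $\sum_{\psi(r)=p}\sum_{j\ge n}\mu(Y_{j,r})\sim\gamma_p n^{-\alpha}$ as $n\to\infty$ for all $1\le p\le q$; (ii) there is a constant $K\ge0$ such that $\lim_{n\to\infty}a_n\big|1_Y(L^n1_Y-Ka_n^{-1})\big|_\infty=0$; (iii) there are constants $c_{j,i,p}>0$ such that $\lim_{j\to\infty}\sum_{\epsilon j<i<\epsilon^{-1}j}\sup_{X_{i,p}}|J_{j,i,p}-c_{j,i,p}|=0$ for each $p=1,\dots,q$ and all $\epsilon>0$. Then $f$ is (fully) global-local mixing, i.e. $\lim_{n\to\infty}\int_X v\;g\circ f^n\,d\mu=\bar g\int_X v\,d\mu$ for all $v\in L^1(X,\mu)$ and all global observables $g\in L^\infty$.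
   Context: Fix $Y\subset X$ measurable with $0<\mu(Y)<\infty$. Let $\tau(x)=\inf\{n\ge1:f^nx\in Y\}$ (finite a.e.), $Y_n=\{y\in Y:\tau(y)=n\}$, $X_n=\{x\in X\setminus Y:\tau(x)=n\}$. Decompositions: there are integers $n_0,q\ge1$, a finite or countably infinite indexing set $\mathbb A$, a surjection $\psi:\mathbb A\to\{1,\dots,q\}$, and for all $n\ge n_0$ decompositions into disjoint (measurable) sets $X_n=\bigcup_{p=1}^qX_{n,p}$, $Y_n=\bigcup_{p=1}^q\bigcup_{\psi(r)=p}Y_{n,r}$, such that for all $j\ge1$, $n\ge n_0$, $r\in\mathbb A$, $f^j$ maps $Y_{j+n,r}$ bijectively onto $X_{n,\psi(r)}$. $a_n=n^{1-\alpha}$ if $\alpha\in(0,1)$ and $a_n=\log n$ if $\alpha=1$; whenever $a_n^{-1}$ is undefined, set $a_n=1$. $L:L^1(X,\mu)\to L^1(X,\mu)$ is the transfer operator: $\int_X Lv\,w\,d\mu=\int_X v\,w\circ f\,d\mu$ for $v\in L^1$, $w\in L^\infty$. $|\cdot|_\infty$ is the $L^\infty$ norm. For $j\ge1$, $i\ge n_0$, $1\le p\le q$, $J_{j,i,p}:X_{i,p}\to(0,\infty)$ is $J_{j,i,p}=\sum_{\psi(r)=p}\frac{d(f^j|_{Y_{j+i,r}})_*\mu}{d\mu|_{X_{i,p}}}$ (Radon–Nikodym derivatives of the pushforwards of $\mu|_{Y_{j+i,r}}$). $g\in L^\infty$ is a global observable if there is $\bar g\in\mathbb R$ such that $\lim_{n\to\infty}\frac{\int_{\bigcup_{i=1}^nX_i}g\,d\mu}{\mu(\bigcup_{i=1}^nX_i)}=\bar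 g$. $u_n\sim v_n$ means $u_n/v_n\to1$. *)

theory Defs
  imports
    "HOL-Analysis.Analysis"
    "HOL-Probability.Essential_Supremum"
    "HOL-Library.Landau_Symbols"
begin

definition measure_preserving_map :: "'a measure \<Rightarrow> ('a \<Rightarrow> 'a) \<Rightarrow> bool" where
  "measure_preserving_map M f \<longleftrightarrow>
     f \<in> measurable M M \<and>
     (\<forall>B\<in>sets M. emeasure M (f -` B \<inter> space M) = emeasure M B)"

(* Every measurable wandering set is null. *)
definition conservative_map :: "'a measure \<Rightarrow> ('a \<Rightarrow> 'a) \<Rightarrow> bool" where
  "conservative_map M f \<longleftrightarrow>
     (\<forall>W\<in>sets M. disjoint_family (\<lambda>n. (f ^^ n) -` W \<inter> space M) \<longrightarrow> emeasure M W = 0)"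

(* The tail sigma-algebra, i.e. the intersection over n of the preimages of sets M under f^n,
   contains only null and conull sets. *)
definition exact_map :: "'a measure \<Rightarrow> ('a \<Rightarrow> 'a) \<Rightarrow> bool" where
  "exact_map M f \<longleftrightarrow>
     (\<forall>B. (\<forall>n. \<exists>C\<in>sets M. B = (f ^^ n) -` C \<inter> space M) \<longrightarrow>
        emeasure M B = 0 \<or> emeasure M (space M - B) = 0)"

(* tau; the value is infinity if the orbit never enters Y. *)
definition return_time :: "('a \<Rightarrow> 'a) \<Rightarrow> 'a set \<Rightarrow> 'a \<Rightarrow> enat" where
  "return_time f Y x = (INF n\<in>{n. 1 \<le> n \<and> (f ^^ n) x \<in> Y}. enat n)"

definition Y_level :: "('a \<Rightarrow> 'a) \<Rightarrow> 'a set \<Rightarrow> nat \<Rightarrow> 'a set" where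
  "Y_level f Y n = {y\<in>Y. return_time f Y y = enat n}"

definition X_level :: "'a measure \<Rightarrow> ('a \<Rightarrow> 'a) \<Rightarrow> 'a set \<Rightarrow> nat \<Rightarrow> 'a set" where
  "X_level M f Y n = {x\<in>space M - Y. return_time f Y x = enat n}"

(* The sets X_{n,p} are given by XX n p and the sets Y_{n,r} by YY n r; only their values for
   n \<ge> n0, p in {1..q} and r in A are meaningful. *)
definition level_decomposition ::
    "'a measure \<Rightarrow> ('a \<Rightarrow> 'a) \<Rightarrow> 'a set \<Rightarrow> nat \<Rightarrow> nat \<Rightarrow> 'r set \<Rightarrow> ('r \<Rightarrow> nat) \<Rightarrow>
     (nat \<Rightarrow> nat \<Rightarrow> 'a set) \<Rightarrow> (nat \<Rightarrow> 'r \<Rightarrow> 'a set) \<Rightarrow> bool" where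
  "level_decomposition M f Y n0 q A \<psi> XX YY \<longleftrightarrow>
     1 \<le> n0 \<and> 1 \<le> q \<and> countable A \<and> \<psi> ` A = {1..q} \<and>
     (\<forall>n\<ge>n0.
        (\<forall>p\<in>{1..q}. XX n p \<in> sets M) \<and>
        disjoint_family_on (XX n) {1..q} \<and>
        X_level M f Y n = (\<Union>p\<in>{1..q}. XX n p) \<and>
        (\<forall>r\<in>A. YY n r \<in> sets M) \<and>
        disjoint_family_on (YY n) A \<and>
        Y_level f Y n = (\<Union>p\<in>{1..q}. \<Union>r\<in>{r\<in>A. \<psi> r = p}. YY n r)) \<and>
     (\<forall>j\<ge>1. \<forall>n\<ge>n0. \<forall>r\<in>A. bij_betw (f ^^ j) (YY (j + n) r) (XX n (\<psi> r)))"

(* a_n; since ln 0 = 0 and 0 powr s = 0 in HOL, the test for 0 catches exactly the indices for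
   which 1 / a_n is undefined. *)
definition norming_seq :: "real \<Rightarrow> nat \<Rightarrow> real" where
  "norming_seq \<alpha> n =
     (let b = (if \<alpha> = 1 then ln (real n) else real n powr (1 - \<alpha>))
      in if b = 0 then 1 else b)"

definition Linf_norm :: "'a measure \<Rightarrow> ('a \<Rightarrow> real) \<Rightarrow> ereal" where
  "Linf_norm M h = esssup M (\<lambda>x. ereal \<bar>h x\<bar>)"

definition Linf_space :: "'a measure \<Rightarrow> ('a \<Rightarrow> real) set" where
  "Linf_space M = {h \<in> borel_measurable M. Linf_norm M h < \<infinity>}"

(* L acts on representatives of classes in L^1; the duality relation determines L v up to
   a null set, and L v up to a null set depends only on the class of v. *)
definition transfer_operator ::
    "'a measure \<Rightarrow> ('a \<Rightarrow> 'a) \<Rightarrow> (('a \<Rightarrow> real) \<Rightarrow> ('a \<Rightarrow> real)) \<Rightarrow> bool" where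
  "transfer_operator M f L \<longleftrightarrow>
     (\<forall>v. integrable M v \<longrightarrow>
        integrable M (L v) \<and>
        (\<forall>w\<in>Linf_space M. (\<integral>x. L v x * w x \<partial>M) = (\<integral>x. v x * w (f x) \<partial>M)))"

(* Density with respect to mu restricted to V of the push-forward under h : U \<rightarrow> V of
   mu restricted to U. *)
definition pushforward_density ::
    "'a measure \<Rightarrow> ('a \<Rightarrow> 'a) \<Rightarrow> 'a set \<Rightarrow> 'a set \<Rightarrow> 'a \<Rightarrow> ennreal" where
  "pushforward_density M h U V =
     RN_deriv (restrict_space M V) (distr (restrict_space M U) (restrict_space M V) h)"

(* J j i p is a positive, finite version on X_{i,p} of the sum of Radon-Nikodym derivatives, which
   are themselves only determined up to null sets. *)
definition jacobian_sums ::
    "'a measure \<Rightarrow> ('a \<Rightarrow> 'a) \<Rightarrow> nat \<Rightarrow> nat \<Rightarrow> 'r set \<Rightarrow> ('r \<Rightarrow> nat) \<Rightarrow>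
     (nat \<Rightarrow> nat \<Rightarrow> 'a set) \<Rightarrow> (nat \<Rightarrow> 'r \<Rightarrow> 'a set) \<Rightarrow>
     (nat \<Rightarrow> nat \<Rightarrow> nat \<Rightarrow> 'a \<Rightarrow> real) \<Rightarrow> bool" where
  "jacobian_sums M f n0 q A \<psi> XX YY J \<longleftrightarrow>
     (\<forall>j\<ge>1. \<forall>i\<ge>n0. \<forall>p\<in>{1..q}.
        J j i p \<in> borel_measurable (restrict_space M (XX i p)) \<and>
        (\<forall>x\<in>XX i p. 0 < J j i p x) \<and>
        (AE x in restrict_space M (XX i p).
           ennreal (J j i p x) =
             (\<Sum>\<^sub>\<infinity>r\<in>{r\<in>A. \<psi> r = p}. pushforward_density M (f ^^ j) (YY (j + i) r) (XX i p) x)))"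

(* g is a global observable with average gbar. *)
definition global_observable ::
    "'a measure \<Rightarrow> ('a \<Rightarrow> 'a) \<Rightarrow> 'a set \<Rightarrow> ('a \<Rightarrow> real) \<Rightarrow> real \<Rightarrow> bool" where
  "global_observable M f Y g gbar \<longleftrightarrow>
     g \<in> Linf_space M \<and>
     (\<lambda>n. (LINT x:(\<Union>i\<in>{1..n}. X_level M f Y i)|M. g x)
            / measure M (\<Union>i\<in>{1..n}. X_level M f Y i)) \<longlonglongrightarrow> gbar"

definition fully_global_local_mixing :: "'a measure \<Rightarrow> ('a \<Rightarrow> 'a) \<Rightarrow> 'a set \<Rightarrow> bool" where
  "fully_global_local_mixing M f Y \<longleftrightarrow>
     (\<forall>v g gbar. integrable M v \<longrightarrow> global_observable M f Y g gbar \<longrightarrow>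
        (\<lambda>n. \<integral>x. v x * g ((f ^^ n) x) \<partial>M) \<longlonglongrightarrow> gbar * (\<integral>x. v x \<partial>M))"

end

(* Exactness makes correlations of mean-zero densities decay (Lin's theorem), so only v = 1_Y has to
   be treated, and one may assume that g has global average 0. Splitting the orbit of y in Y up to
   time n at its last visit k to Y, the integral of 1_Y (g o f^n) becomes the sum over k of
   int (L^k 1_Y) 1_{U_j} (g o f^j) with j = n - k, where U_j consists of the points of Y that do not
   return during the times 1..j. By (ii) this is K times the convolution of 1/a_k with
   G_j = int_{U_j} g o f^j, up to o(1). Since G_j = O(j^(-alpha)), an Abel summation reduces the claim
   to the partial sums G_1 + ... + G_N being small compared with the sum of j^(-alpha) over j <= N.
   By (iii), G_j is up to o(j^(-alpha)) the sum over i and p of mu(f^(-j) X_{i,p} in Y_{j+i}) times the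
   mean of g over X_{i,p}. Summing over j telescopes the measures, (i) turns them into
   mu(X_{i,p}) (1 - (i/(i+N))^alpha), and a second Abel summation in i brings in the partial integrals
   of g over the union of X_1, ..., X_m, which are small because the global average vanishes. *)

theory Submission
  imports Defs "HOL-Probability.Conditional_Expectation"
begin


section \<open>Power sums and convolution with the renewal weights\<close>

text \<open>Hypothesis (i) controls the measures only through tail sums, so the argument obtains no
  decay of a single G_j beyond O(j^(-alpha)); cancellation becomes available only after summation
  over j. Hence the estimates are stated for partial sums, in the form
  \<open>\<delta> * psum \<alpha> N + C\<close> with \<delta> arbitrary and \<open>C\<close>
  independent of \<open>N\<close>. The constants collect finitely many exceptional indices and are
  absorbed because \<open>psum\<close> tends to infinity. The yardstick
  \<open>psum \<alpha> n\<close> has order a_n for \<alpha> < 1 and \<alpha> = 1 alike, so that the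
  logarithmic case is separate only in the elementary bounds. Passing from partial sums to the
  convolution needs monotone weights and loses too much when k is far smaller than n, where 1/a_k
  may be far larger than 1/a_n. The range k < n/R is therefore treated without cancellation: its
  total contribution is O(R^(-alpha)). In the same way, extreme ranges of i are discarded by
  absolute bounds, because (iii) speaks only of i between epsilon j and j/epsilon. The constants
  c_{j,i,p} are eliminated by treating the constant function 1 alongside g.\<close>

definition psum :: "real \<Rightarrow> nat \<Rightarrow> real" where
  "psum \<alpha> n = (\<Sum>j<n. real (Suc j) powr (- \<alpha>))"

lemma psum_nonneg: "0 \<le> psum \<alpha> n"
  unfolding psum_def by (intro sum_nonneg) auto

lemma psum_Suc: "psum \<alpha> (Suc n) = psum \<alpha> n + real (Suc n) powr (- \<alpha>)"
  by (simp add: psum_def)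

lemma psum_mono: "m \<le> n \<Longrightarrow> psum \<alpha> m \<le> psum \<alpha> n"
  unfolding psum_def by (intro sum_mono2) auto

text \<open>The summands decrease, so a block of \<open>n\<close> consecutive ones is largest at the
  start.\<close>

lemma psum_subadditive:
  assumes "0 \<le> \<alpha>"
  shows "psum \<alpha> (m + n) \<le> psum \<alpha> m + psum \<alpha> n"
proof (induction n)
  case (Suc n)
  have "real (Suc (m + n)) powr (- \<alpha>) \<le> real (Suc n) powr (- \<alpha>)"
    by (rule powr_mono2') (use assms in auto)
  with Suc show ?case by (simp add: psum_Suc)
qed (simp add: psum_def)

lemma psum_mult:
  assumes "0 \<le> \<alpha>"
  shows "psum \<alpha> (R * n) \<le> real R * psum \<alpha> n"
proof (induction R)
  case (Suc R)
  show ?case using psum_subadditive[OF assms, of n "R * n"] Suc by (simp add: algebra_simps)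
qed (simp add: psum_def)

text \<open>Every summand is at least the last one. In this way \<open>N\<close> errors of uniform
  size \<open>real N powr (- \<alpha>)\<close> are later charged to a multiple of
  \<open>psum \<alpha> N\<close>.\<close>

lemma psum_ge_powr:
  assumes "0 \<le> \<alpha>"
  shows "real n * real n powr (- \<alpha>) \<le> psum \<alpha> n"
proof -
  have "(\<Sum>j<n. real n powr (- \<alpha>)) \<le> psum \<alpha> n"
    unfolding psum_def by (intro sum_mono powr_mono2') (use assms in auto)
  then show ?thesis by simp
qed

text \<open>For \<alpha> \<le> 1 the sum dominates the harmonic numbers, hence a logarithm.
  Divergence is what lets \<open>psum\<close> absorb additive constants.\<close>

lemma psum_at_top:
  assumes "\<alpha> \<le> 1"
  shows "filterlim (psum \<alpha>) at_top sequentially"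
proof (rule filterlim_at_top_mono[where f = "\<lambda>n. ln (real n + 1)"])
  show "filterlim (\<lambda>n. ln (real n + 1)) at_top sequentially"
    using filterlim_compose[OF ln_at_top filterlim_compose[OF filterlim_real_sequentially filterlim_Suc]]
    by (simp add: add.commute)
  have "ln (real n + 1) \<le> psum \<alpha> n" for n
  proof -
    have "harm n \<le> psum \<alpha> n"
    proof (induction n)
      case (Suc n)
      have "real (Suc n) powr (-1) \<le> real (Suc n) powr (- \<alpha>)"
        by (rule powr_mono) (use assms in auto)
      moreover have "real (Suc n) powr (-1) = inverse (real (Suc n))"
        by (simp add: powr_minus)
      ultimately show ?case using Suc unfolding psum_Suc harm_Suc by linarith
    qed (simp add: psum_def harm_def)
    with ln_le_harm[of n] show ?thesis by linarith
  qed
  then show "eventually (\<lambda>n. ln (real n + 1) \<le> psum \<alpha> n) sequentially" by simp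
qed

text \<open>Comparison with the integral of \<open>x powr (- \<alpha>)\<close>, one unit interval at
  a time by the mean value theorem. On the first interval the antiderivative is only continuous at
  0, which suffices there.\<close>

lemma psum_le_powr:
  assumes "0 \<le> \<alpha>" "\<alpha> < 1"
  shows "psum \<alpha> n \<le> real n powr (1 - \<alpha>) / (1 - \<alpha>)"
proof (induction n)
  case (Suc n)
  have der: "((\<lambda>x. x powr (1 - \<alpha>)) has_real_derivative (1 - \<alpha>) * x powr (- \<alpha>)) (at x)"
    if "real n < x" for x
    using that by (auto intro!: derivative_eq_intros)
  have "\<exists>l z. real n < z \<and> z < real (Suc n) \<and> ((\<lambda>x. x powr (1 - \<alpha>)) has_real_derivative l) (at z) \<and>
      real (Suc n) powr (1 - \<alpha>) - real n powr (1 - \<alpha>) = (real (Suc n) - real n) * l"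
  proof (rule MVT)
    show "continuous_on {real n..real (Suc n)} (\<lambda>x. x powr (1 - \<alpha>))"
      by (intro continuous_on_powr' continuous_intros) (use assms in auto)
    show "(\<lambda>x. x powr (1 - \<alpha>)) differentiable at x" if "real n < x" "x < real (Suc n)" for x
      using der[OF that(1)] by (auto simp: real_differentiable_def)
  qed auto
  then obtain l z where z: "real n < z" "z < real (Suc n)" "((\<lambda>x. x powr (1 - \<alpha>)) has_real_derivative l) (at z)"
    and dl: "real (Suc n) powr (1 - \<alpha>) - real n powr (1 - \<alpha>) = l" by auto
  have d: "real (Suc n) powr (1 - \<alpha>) - real n powr (1 - \<alpha>) = (1 - \<alpha>) * z powr (- \<alpha>)"
    using DERIV_unique[OF z(3) der[OF z(1)]] dl by simp
  have "real (Suc n) powr (- \<alpha>) \<le> z powr (- \<alpha>)"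
    by (rule powr_mono2') (use assms z in auto)
  then have "(1 - \<alpha>) * real (Suc n) powr (- \<alpha>) \<le> real (Suc n) powr (1 - \<alpha>) - real n powr (1 - \<alpha>)"
    unfolding d using assms by (intro mult_left_mono) auto
  then have "real (Suc n) powr (- \<alpha>) \<le> (real (Suc n) powr (1 - \<alpha>) - real n powr (1 - \<alpha>)) / (1 - \<alpha>)"
    using assms by (simp add: field_simps)
  with Suc show ?case by (simp add: psum_Suc diff_divide_distrib)
qed (simp add: psum_def)

text \<open>The bound \<open>ln x \<le> x - 1\<close> at x = (n+1)/(n+2) shows that the logarithm
  grows by at least the new summand.\<close>

lemma psum_one_le: "psum 1 (Suc n) \<le> 1 + ln (real (Suc n))"
proof (induction n)
  case (Suc n)
  have "ln (real (Suc n) / real (Suc (Suc n))) \<le> real (Suc n) / real (Suc (Suc n)) - 1"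
    by (rule ln_le_minus_one) simp
  also have "\<dots> = - (real (Suc (Suc n)) powr (- 1))"
    by (simp add: powr_minus field_simps)
  also have "ln (real (Suc n) / real (Suc (Suc n))) = ln (real (Suc n)) - ln (real (Suc (Suc n)))"
    by (simp add: ln_div del: of_nat_Suc)
  finally show ?case using Suc psum_Suc[of 1 "Suc n"] by linarith
qed (simp add: psum_def)

text \<open>Summation by parts: the cost of a weight is its last value plus its total variation. In
  both uses the weight is monotone, so that the variation telescopes.\<close>

lemma abel_summation_bound:
  fixes a \<phi> :: "nat \<Rightarrow> real"
  assumes E: "\<And>k. k \<le> Suc m \<Longrightarrow> \<bar>\<Sum>i<k. a i\<bar> \<le> E"
  shows "\<bar>\<Sum>i<Suc m. \<phi> i * a i\<bar> \<le> (\<bar>\<phi> m\<bar> + (\<Sum>i<m. \<bar>\<phi> (Suc i) - \<phi> i\<bar>)) * E"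
proof -
  have id: "(\<Sum>i<Suc m. \<phi> i * a i) = \<phi> m * (\<Sum>i<Suc m. a i) - (\<Sum>i<m. (\<phi> (Suc i) - \<phi> i) * (\<Sum>j<Suc i. a j))"
    by (induction m) (auto simp: algebra_simps)
  have "\<bar>\<Sum>i<Suc m. \<phi> i * a i\<bar> \<le> \<bar>\<phi> m * (\<Sum>i<Suc m. a i)\<bar> + \<bar>\<Sum>i<m. (\<phi> (Suc i) - \<phi> i) * (\<Sum>j<Suc i. a j)\<bar>"
    unfolding id by (rule abs_triangle_ineq4)
  also have "\<bar>\<phi> m * (\<Sum>i<Suc m. a i)\<bar> \<le> \<bar>\<phi> m\<bar> * E"
    unfolding abs_mult by (intro mult_left_mono E) auto
  also have "\<bar>\<Sum>i<m. (\<phi> (Suc i) - \<phi> i) * (\<Sum>j<Suc i. a j)\<bar> \<le> (\<Sum>i<m. \<bar>\<phi> (Suc i) - \<phi> i\<bar> * E)"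
    by (intro sum_abs[THEN order_trans] sum_mono) (auto simp: abs_mult simp del: sum.lessThan_Suc intro!: mult_left_mono E)
  finally show ?thesis by (simp add: algebra_simps sum_distrib_left)
qed

section \<open>Size and monotonicity of the renewal weights 1/a_k\<close>

lemma inverse_norming_pos: "0 < inverse (norming_seq \<alpha> k)"
proof -
  have "0 \<le> ln (real k)" by (cases k) auto
  then have "0 < norming_seq \<alpha> k"
    unfolding norming_seq_def Let_def by (cases "\<alpha> = 1") simp_all
  then show ?thesis by simp
qed

text \<open>The extreme case is \<alpha> = 1 and k = 2; the default weight 1 at the degenerate
  indices is smaller because ln 2 < 1.\<close>

lemma inverse_norming_bounded:
  assumes "\<alpha> \<le> 1"
  shows "inverse (norming_seq \<alpha> k) \<le> 1 / ln 2"
proof (cases "k \<le> 1")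
  case True
  then have "k = 0 \<or> k = 1" by auto
  then have "norming_seq \<alpha> k = 1" by (auto simp: norming_seq_def)
  moreover have "(1::real) \<le> 1 / ln 2" using ln_2_less_1 by simp
  ultimately show ?thesis by simp
next
  case False
  show ?thesis
  proof (cases "\<alpha> = 1")
    case True
    have "ln 2 \<le> ln (real k)" using False by simp
    then show ?thesis using False True by (simp add: norming_seq_def field_simps)
  next
    case F: False
    have "1 \<le> real k powr (1 - \<alpha>)" using False assms F by (intro ge_one_powr_ge_zero) auto
    then have "inverse (norming_seq \<alpha> k) \<le> 1" using F by (auto simp: norming_seq_def Let_def inverse_le_1_iff)
    moreover have "(1::real) \<le> 1 / ln 2" using ln_2_less_1 by simp
    ultimately show ?thesis by linarith
  qed
qed

text \<open>Monotonicity starts at 2 because of the default values: for \<alpha> = 1 the weight is 1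
  at k = 1 but 1 / ln 2 > 1 at k = 2.\<close>

lemma inverse_norming_antimono:
  assumes "\<alpha> \<le> 1" "2 \<le> k" "k \<le> l"
  shows "inverse (norming_seq \<alpha> l) \<le> inverse (norming_seq \<alpha> k)"
proof -
  have "norming_seq \<alpha> k \<le> norming_seq \<alpha> l"
    using assms by (auto simp: norming_seq_def Let_def intro!: powr_mono2)
  moreover have "0 < norming_seq \<alpha> k" using inverse_norming_pos[of \<alpha> k] by simp
  ultimately show ?thesis by (simp add: le_imp_inverse_le)
qed

text \<open>For \<alpha> < 1 the weights after the default value at k = 0 are the summands of
  \<open>psum (1 - \<alpha>)\<close>. For \<alpha> = 1 the right side is linear in \<open>m\<close>,
  and boundedness of the weights is enough.\<close>

lemma sum_inverse_norming_le:
  assumes "0 < \<alpha>" "\<alpha> \<le> 1"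
  obtains C where "0 < C" "\<And>m. (\<Sum>k<m. inverse (norming_seq \<alpha> k)) \<le> C * real m powr \<alpha>"
proof (cases "\<alpha> = 1")
  case True
  have "(\<Sum>k<m. inverse (norming_seq \<alpha> k)) \<le> 1 / ln 2 * real m powr \<alpha>" for m
    using sum_bounded_above[of "{..<m}" "\<lambda>k. inverse (norming_seq \<alpha> k)" "1 / ln 2"]
      inverse_norming_bounded[OF assms(2)] True by simp
  then show ?thesis by (intro that[of "1 / ln 2"]) auto
next
  case False
  have "(\<Sum>k<m. inverse (norming_seq \<alpha> k)) \<le> (1 + 1 / \<alpha>) * real m powr \<alpha>" for m
  proof (cases m)
    case (Suc l)
    have "(\<Sum>k<m. inverse (norming_seq \<alpha> k)) = 1 + (\<Sum>k<l. inverse (norming_seq \<alpha> (Suc k)))"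
      unfolding Suc sum.lessThan_Suc_shift by (simp add: norming_seq_def)
    also have "(\<Sum>k<l. inverse (norming_seq \<alpha> (Suc k))) = psum (1 - \<alpha>) l"
      unfolding psum_def using False by (intro sum.cong) (auto simp: norming_seq_def powr_minus powr_diff)
    also have "psum (1 - \<alpha>) l \<le> real l powr \<alpha> / \<alpha>"
      using psum_le_powr[of "1 - \<alpha>" l] assms by simp
    also have "\<dots> \<le> real m powr \<alpha> / \<alpha>"
      using assms Suc by (intro divide_right_mono powr_mono2) auto
    finally have "(\<Sum>k<m. inverse (norming_seq \<alpha> k)) \<le> 1 + real m powr \<alpha> / \<alpha>" by simp
    moreover have "1 \<le> real m powr \<alpha>" using Suc assms by (intro ge_one_powr_ge_zero) auto
    ultimately show ?thesis by (simp add: algebra_simps)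
  qed simp
  then show ?thesis using assms by (intro that[of "1 + 1 / \<alpha>"]) (auto intro: add_pos_pos)
qed

text \<open>\<open>psum \<alpha> n\<close> is at most of order a_n, and \<open>n \<le> R * k\<close>
  keeps a_n within a constant factor of a_k. For \<alpha> = 1 this uses
  \<open>ln n \<le> ln R + ln k\<close> together with an \<open>n\<close> so large that
  \<open>ln R\<close> is at most half of \<open>ln n\<close>.\<close>

lemma inverse_norming_psum_le:
  assumes "0 < \<alpha>" "\<alpha> \<le> 1" "1 \<le> R"
  obtains C n1 where "0 < C" "\<And>n k. n1 \<le> n \<Longrightarrow> n \<le> R * k \<Longrightarrow> inverse (norming_seq \<alpha> k) * psum \<alpha> n \<le> C"
proof (cases "\<alpha> = 1")
  case True
  \<comment> \<open>The threshold collects three demands: \<open>R^2\<close> gives 2 ln R \<le> ln n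
    and hence ln n \<le> 2 ln k; \<open>2 * R\<close> forces k \<ge> 2, past the default values; 3
    exceeds exp 1, so that 1 + ln n \<le> 2 ln n.\<close>
  have "inverse (norming_seq \<alpha> k) * psum \<alpha> n \<le> 4" if n: "R^2 + 2 * R + 3 \<le> n" and k: "n \<le> R * k" for n k
  proof -
    have "2 * R \<le> R * k" using n k by linarith
    then have k2: "2 \<le> k" using assms(3) by simp
    have n3: "3 \<le> n" using n by linarith
    have "real n \<le> real R * real k" using k by (metis of_nat_le_iff of_nat_mult)
    then have "ln (real n) \<le> ln (real R * real k)"
      using n3 by (subst ln_le_cancel_iff) auto
    then have 1: "ln (real n) \<le> ln (real R) + ln (real k)"
      using assms(3) k2 by (simp add: ln_mult)
    have "real R ^ 2 \<le> real n" using n by (metis add_leE of_nat_le_iff of_nat_power)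
    then have "ln (real R ^ 2) \<le> ln (real n)"
      using assms(3) n3 by (subst ln_le_cancel_iff) auto
    then have 2: "2 * ln (real R) \<le> ln (real n)"
      using assms(3) by (simp add: ln_realpow)
    have "exp 1 \<le> real n" using exp_le n3 by (intro order_trans[OF exp_le]) auto
    then have 3: "1 \<le> ln (real n)" using n3 by (simp add: ln_ge_iff)
    have "psum \<alpha> n \<le> 4 * ln (real k)"
      using psum_one_le[of "n - 1"] n3 1 2 3 True by simp
    moreover have "0 < ln (real k)" using k2 by simp
    ultimately show ?thesis using True k2 by (simp add: norming_seq_def field_simps)
  qed
  then show ?thesis by (intro that[of 4]) auto
next
  case False
  then have a1: "\<alpha> < 1" using assms by simp
  have "inverse (norming_seq \<alpha> k) * psum \<alpha> n \<le> real R powr (1 - \<alpha>) / (1 - \<alpha>)" if n: "2 * R \<le> n" and k: "n \<le> R * k" for n k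
  proof -
    have "2 * R \<le> R * k" using n k by linarith
    then have k2: "2 \<le> k" using assms(3) by simp
    have "real n \<le> real R * real k" using k by (metis of_nat_le_iff of_nat_mult)
    then have "real n powr (1 - \<alpha>) \<le> (real R * real k) powr (1 - \<alpha>)"
      using a1 by (intro powr_mono2) auto
    then have "real n powr (1 - \<alpha>) / (1 - \<alpha>) \<le> real R powr (1 - \<alpha>) * real k powr (1 - \<alpha>) / (1 - \<alpha>)"
      using a1 by (intro divide_right_mono) (auto simp: powr_mult)
    with psum_le_powr[of \<alpha> n] a1 assms have "psum \<alpha> n \<le> real R powr (1 - \<alpha>) * real k powr (1 - \<alpha>) / (1 - \<alpha>)"
      by simp
    then have "inverse (real k powr (1 - \<alpha>)) * psum \<alpha> n \<le> inverse (real k powr (1 - \<alpha>)) * (real R powr (1 - \<alpha>) * real k powr (1 - \<alpha>) / (1 - \<alpha>))"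
      by (intro mult_left_mono) auto
    moreover have "inverse (real k powr (1 - \<alpha>)) * (real R powr (1 - \<alpha>) * real k powr (1 - \<alpha>) / (1 - \<alpha>)) = real R powr (1 - \<alpha>) / (1 - \<alpha>)"
      using k2 by simp
    ultimately have "inverse (real k powr (1 - \<alpha>)) * psum \<alpha> n \<le> real R powr (1 - \<alpha>) / (1 - \<alpha>)" by linarith
    then show ?thesis using False k2 by (simp add: norming_seq_def)
  qed
  then show ?thesis using a1 assms by (intro that[of "real R powr (1 - \<alpha>) / (1 - \<alpha>)"]) auto
qed


section \<open>Convolutions of the renewal weights with sequences of order j^(-alpha)\<close>

lemma powr_mult_powr_minus: "x powr a * y powr (- a) = (x / y) powr (a::real)"
  by (simp add: powr_divide powr_minus_divide)

text \<open>For \<open>R * k < n\<close> and R \<ge> 2 the factor \<open>u (n - k)\<close> has order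
  n^(-alpha), since n - k \<ge> n/2, while the weights up to n/R add up to order (n/R)^alpha. The
  powers of n cancel and R^(-alpha) remains, uniformly in n.\<close>

lemma convolution_small_indices:
  assumes "0 < \<alpha>" "\<alpha> \<le> 1" and u: "\<And>j. 0 \<le> u j" "\<And>j. u j \<le> Cu * real (Suc j) powr (- \<alpha>)"
  obtains C where "0 < C" "\<And>R n. 2 \<le> R \<Longrightarrow> R \<le> n \<Longrightarrow>
    (\<Sum>k | k \<le> n \<and> R * k < n. inverse (norming_seq \<alpha> k) * u (n - k)) \<le> C * real R powr (- \<alpha>)"
proof -
  obtain C where C: "0 < C" "\<And>m. (\<Sum>k<m. inverse (norming_seq \<alpha> k)) \<le> C * real m powr \<alpha>"
    using sum_inverse_norming_le[OF assms(1,2)] by blast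
  have Cu: "0 \<le> Cu" using u[of 0] by simp
  have "(\<Sum>k | k \<le> n \<and> R * k < n. inverse (norming_seq \<alpha> k) * u (n - k)) \<le> (C * Cu * 4 powr \<alpha> + 1) * real R powr (- \<alpha>)"
    if R: "2 \<le> R" "R \<le> n" for R n
  proof -
    \<comment> \<open>\<open>{..<m}\<close> contains every \<open>k\<close> with
      \<open>R * k < n\<close>. The added 1 is harmless because \<open>R \<le> n\<close> gives m
      \<le> 2n/R.\<close>
    define m where "m = n div R + 1"
    have ub: "u (n - k) \<le> Cu * (real n / 2) powr (- \<alpha>)" if "R * k < n" for k
    proof -
      have "2 * k \<le> R * k" using R by simp
      then have "2 * k < n" using that by linarith
      then have "real (Suc (n - k)) powr (- \<alpha>) \<le> (real n / 2) powr (- \<alpha>)"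
        using assms by (intro powr_mono2') auto
      then have "Cu * real (Suc (n - k)) powr (- \<alpha>) \<le> Cu * (real n / 2) powr (- \<alpha>)"
        using Cu by (rule mult_left_mono)
      with u(2)[of "n - k"] show ?thesis by linarith
    qed
    have "(\<Sum>k | k \<le> n \<and> R * k < n. inverse (norming_seq \<alpha> k) * u (n - k))
        \<le> (\<Sum>k | k \<le> n \<and> R * k < n. inverse (norming_seq \<alpha> k) * (Cu * (real n / 2) powr (- \<alpha>)))"
      by (intro sum_mono mult_left_mono ub) (auto intro: order_less_imp_le inverse_norming_pos simp del: inverse_nonnegative_iff_nonnegative)
    also have "\<dots> \<le> (\<Sum>k<m. inverse (norming_seq \<alpha> k) * (Cu * (real n / 2) powr (- \<alpha>)))"
    proof (rule sum_mono2)
      show "{k. k \<le> n \<and> R * k < n} \<subseteq> {..<m}"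
      proof (clarsimp simp: m_def)
        fix k assume "R * k < n"
        then have "k \<le> n div R" using R by (simp add: less_eq_div_iff_mult_less_eq mult.commute)
        then show "k < Suc (n div R)" by simp
      qed
    qed (use Cu inverse_norming_pos[of \<alpha>] in \<open>auto intro!: mult_nonneg_nonneg simp: order_less_imp_le simp del: inverse_nonnegative_iff_nonnegative\<close>)
    also have "\<dots> = (\<Sum>k<m. inverse (norming_seq \<alpha> k)) * (Cu * (real n / 2) powr (- \<alpha>))"
      by (simp only: sum_distrib_right)
    also have "\<dots> \<le> (C * real m powr \<alpha>) * (Cu * (real n / 2) powr (- \<alpha>))"
      using Cu by (intro mult_right_mono C) auto
    also have "\<dots> \<le> (C * (2 * real n / real R) powr \<alpha>) * (Cu * (real n / 2) powr (- \<alpha>))"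
    proof (intro mult_right_mono mult_left_mono powr_mono2)
      have "real (n div R) \<le> real n / real R" using of_nat_div_le_of_nat[of n R] by simp
      moreover have "1 \<le> real n / real R" using R by simp
      ultimately show "real m \<le> 2 * real n / real R" by (simp add: m_def)
    qed (use assms Cu C in auto)
    also have "\<dots> = C * Cu * ((2 * real n / real R) powr \<alpha> * (real n / 2) powr (- \<alpha>))"
      by simp
    also have "(2 * real n / real R) powr \<alpha> * (real n / 2) powr (- \<alpha>) = ((2 * real n / real R) / (real n / 2)) powr \<alpha>"
      by (rule powr_mult_powr_minus)
    also have "(2 * real n / real R) / (real n / 2) = 4 / real R"
      using R by (simp add: field_simps)
    also have "(4 / real R) powr \<alpha> = 4 powr \<alpha> * real R powr (- \<alpha>)"
      by (rule powr_mult_powr_minus[symmetric])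
    also have "C * Cu * (4 powr \<alpha> * real R powr (- \<alpha>)) \<le> (C * Cu * 4 powr \<alpha> + 1) * real R powr (- \<alpha>)"
      by (simp add: algebra_simps)
    finally show ?thesis .
  qed
  then show ?thesis using C Cu by (intro that[of "C * Cu * 4 powr \<alpha> + 1"]) (auto intro: add_nonneg_pos)
qed

text \<open>The sum is split at n/2. Below, the previous estimate with R = 2 applies; above, each
  weight is at most a constant over \<open>psum \<alpha> n\<close>, while the values
  \<open>u (n - k)\<close> add up to at most a constant times
  \<open>psum \<alpha> n\<close>.\<close>

lemma convolution_bounded:
  assumes "0 < \<alpha>" "\<alpha> \<le> 1" and u: "\<And>j. 0 \<le> u j" "\<And>j. u j \<le> Cu * real (Suc j) powr (- \<alpha>)"
  obtains C n1 where "0 < C" "\<And>n. n1 \<le> n \<Longrightarrow> (\<Sum>k\<le>n. inverse (norming_seq \<alpha> k) * u (n - k)) \<le> C"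
proof -
  obtain C where C: "0 < C" "\<And>R n. 2 \<le> R \<Longrightarrow> R \<le> n \<Longrightarrow>
    (\<Sum>k | k \<le> n \<and> R * k < n. inverse (norming_seq \<alpha> k) * u (n - k)) \<le> C * real R powr (- \<alpha>)"
    using convolution_small_indices[OF assms(1,2) u] by blast
  obtain D n1 where D: "0 < D" "\<And>n k. n1 \<le> n \<Longrightarrow> n \<le> 2 * k \<Longrightarrow> inverse (norming_seq \<alpha> k) * psum \<alpha> n \<le> D"
    using inverse_norming_psum_le[OF assms(1,2), of 2] by auto
  have Cu: "0 \<le> Cu" using u[of 0] by simp
  have "(\<Sum>k\<le>n. inverse (norming_seq \<alpha> k) * u (n - k)) \<le> C * 2 powr (- \<alpha>) + Cu * (2 * D)"
    if n: "max n1 2 \<le> n" for n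
  proof -
    have split: "{..n} = {k. k \<le> n \<and> 2 * k < n} \<union> {k. k \<le> n \<and> n \<le> 2 * k}" by auto
    have "(\<Sum>k | k \<le> n \<and> n \<le> 2 * k. inverse (norming_seq \<alpha> k) * u (n - k)) * psum \<alpha> n
        = (\<Sum>k | k \<le> n \<and> n \<le> 2 * k. (inverse (norming_seq \<alpha> k) * psum \<alpha> n) * u (n - k))"
      unfolding sum_distrib_right by (intro sum.cong) (auto simp: mult_ac)
    also have "\<dots> \<le> (\<Sum>k | k \<le> n \<and> n \<le> 2 * k. D * (Cu * real (Suc (n - k)) powr (- \<alpha>)))"
      using n D Cu by (intro sum_mono mult_mono u D) auto
    also have "\<dots> \<le> (\<Sum>k\<le>n. D * (Cu * real (Suc (n - k)) powr (- \<alpha>)))"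
      using D Cu by (intro sum_mono2) auto
    also have "\<dots> = D * Cu * (\<Sum>k\<le>n. real (Suc (n - k)) powr (- \<alpha>))"
      by (simp add: sum_distrib_left mult_ac)
    also have "(\<Sum>k\<le>n. real (Suc (n - k)) powr (- \<alpha>)) = psum \<alpha> (Suc n)"
      unfolding psum_def lessThan_Suc_atMost
      by (rule sum.reindex_bij_witness[where i = "\<lambda>k. n - k" and j = "\<lambda>k. n - k"]) auto
    also have "D * Cu * psum \<alpha> (Suc n) \<le> D * Cu * (2 * psum \<alpha> n)"
      using psum_mult[of \<alpha> 2 n] psum_mono[of "Suc n" "2 * n" \<alpha>] n assms D Cu by (intro mult_left_mono) auto
    also have "\<dots> = (Cu * (2 * D)) * psum \<alpha> n" by simp
    finally have "(\<Sum>k | k \<le> n \<and> n \<le> 2 * k. inverse (norming_seq \<alpha> k) * u (n - k)) * psum \<alpha> n \<le> (Cu * (2 * D)) * psum \<alpha> n" .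
    moreover have "0 < psum \<alpha> n"
      using n psum_ge_powr[of \<alpha> n] assms by (smt (verit) mult_pos_pos of_nat_0_less_iff powr_gt_zero zero_less_numeral max.bounded_iff less_le_trans of_nat_le_iff of_nat_numeral)
    ultimately have "(\<Sum>k | k \<le> n \<and> n \<le> 2 * k. inverse (norming_seq \<alpha> k) * u (n - k)) \<le> Cu * (2 * D)"
      by (rule mult_right_le_imp_le)
    then show ?thesis unfolding split
      using C(2)[of 2 n] n by (subst sum.union_disjoint) auto
  qed
  then show ?thesis using C D Cu by (intro that[of "C * 2 powr (- \<alpha>) + Cu * (2 * D)" "max n1 2"]) (auto intro: add_pos_nonneg)
qed

text \<open>Toeplitz argument: from \<open>k0\<close> on, \<open>e k\<close> is small against the
  bounded convolution, and each of the finitely many earlier terms vanishes in the limit because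
  \<open>u (n - k)\<close> does.\<close>

lemma convolution_null_coefficients:
  assumes "0 < \<alpha>" "\<alpha> \<le> 1" and u: "\<And>j. 0 \<le> u j" "\<And>j. u j \<le> Cu * real (Suc j) powr (- \<alpha>)"
    and e: "e \<longlonglongrightarrow> 0"
  shows "(\<lambda>n. \<Sum>k\<le>n. e k * inverse (norming_seq \<alpha> k) * u (n - k)) \<longlonglongrightarrow> 0"
proof (rule LIMSEQ_I)
  fix r :: real assume r: "0 < r"
  obtain C n1 where C: "0 < C" "\<And>n. n1 \<le> n \<Longrightarrow> (\<Sum>k\<le>n. inverse (norming_seq \<alpha> k) * u (n - k)) \<le> C"
    using convolution_bounded[OF assms(1,2) u] by blast
  obtain k0 where k0: "\<And>k. k0 \<le> k \<Longrightarrow> \<bar>e k\<bar> \<le> r / (2 * C)"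
    using LIMSEQ_D[OF e, of "r / (2 * C)"] r C by (auto intro: less_imp_le)
  have u0: "u \<longlonglongrightarrow> 0"
  proof (rule tendsto_sandwich[OF _ _ tendsto_const])
    show "(\<lambda>j. Cu * real (Suc j) powr (- \<alpha>)) \<longlonglongrightarrow> 0"
      using assms by (intro tendsto_mult_right_zero tendsto_neg_powr filterlim_compose[OF filterlim_real_sequentially filterlim_Suc]) auto
  qed (use u in auto)
  have "(\<lambda>n. \<Sum>k<k0. \<bar>e k\<bar> * inverse (norming_seq \<alpha> k) * u (n - k)) \<longlonglongrightarrow> (\<Sum>k<k0. \<bar>e k\<bar> * inverse (norming_seq \<alpha> k) * 0)"
    by (intro tendsto_sum tendsto_mult tendsto_const filterlim_compose[OF u0] filterlim_minus_const_nat_at_top)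
  then obtain n2 where n2: "\<And>n. n2 \<le> n \<Longrightarrow> (\<Sum>k<k0. \<bar>e k\<bar> * inverse (norming_seq \<alpha> k) * u (n - k)) < r / 2"
    using LIMSEQ_D[of _ 0 "r / 2"] r by force
  have "norm ((\<Sum>k\<le>n. e k * inverse (norming_seq \<alpha> k) * u (n - k)) - 0) < r" if n: "max n1 (max n2 k0) \<le> n" for n
  proof -
    have w: "0 \<le> inverse (norming_seq \<alpha> k) * u (n - k)" for k
      using inverse_norming_pos[of \<alpha> k] u(1) by (intro mult_nonneg_nonneg) auto
    have "{..n} = {..<k0} \<union> {k0..n}" using n by auto
    then have "(\<Sum>k\<le>n. \<bar>e k\<bar> * (inverse (norming_seq \<alpha> k) * u (n - k)))
        = (\<Sum>k<k0. \<bar>e k\<bar> * (inverse (norming_seq \<alpha> k) * u (n - k))) + (\<Sum>k=k0..n. \<bar>e k\<bar> * (inverse (norming_seq \<alpha> k) * u (n - k)))"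
      by (simp only:) (rule sum.union_disjoint, auto)
    also have "(\<Sum>k=k0..n. \<bar>e k\<bar> * (inverse (norming_seq \<alpha> k) * u (n - k))) \<le> (\<Sum>k=k0..n. r / (2 * C) * (inverse (norming_seq \<alpha> k) * u (n - k)))"
      by (intro sum_mono mult_right_mono k0 w) auto
    also have "\<dots> \<le> (\<Sum>k\<le>n. r / (2 * C) * (inverse (norming_seq \<alpha> k) * u (n - k)))"
      by (intro sum_mono2 mult_nonneg_nonneg[OF _ w]) (use r C in auto)
    also have "\<dots> = r / (2 * C) * (\<Sum>k\<le>n. inverse (norming_seq \<alpha> k) * u (n - k))"
      by (simp only: sum_distrib_left)
    also have "\<dots> \<le> r / (2 * C) * C"
      using r C n by (intro mult_left_mono) auto
    also have "\<dots> = r / 2" using C by simp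
    also have "(\<Sum>k<k0. \<bar>e k\<bar> * (inverse (norming_seq \<alpha> k) * u (n - k))) < r / 2"
      using n2[of n] n by (simp add: mult.assoc)
    finally have "(\<Sum>k\<le>n. \<bar>e k\<bar> * (inverse (norming_seq \<alpha> k) * u (n - k))) < r" by simp
    moreover have "\<bar>\<Sum>k\<le>n. e k * inverse (norming_seq \<alpha> k) * u (n - k)\<bar> \<le> (\<Sum>k\<le>n. \<bar>e k * inverse (norming_seq \<alpha> k) * u (n - k)\<bar>)"
      by (rule sum_abs)
    moreover have "\<bar>e k * inverse (norming_seq \<alpha> k) * u (n - k)\<bar> = \<bar>e k\<bar> * (inverse (norming_seq \<alpha> k) * u (n - k))" for k
      by (simp only: mult.assoc abs_mult[of "e k"] abs_of_nonneg[OF w])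
    ultimately show ?thesis by simp
  qed
  then show "\<exists>no. \<forall>n\<ge>no. norm ((\<Sum>k\<le>n. e k * inverse (norming_seq \<alpha> k) * u (n - k)) - 0) < r" by blast
qed

text \<open>Here the cancellation in \<open>G\<close> is used. On k \<ge> n/R the weights
  \<open>?w (n - j)\<close> increase in \<open>j\<close>, so Abel summation costs at most twice the
  largest weight times the largest partial sum; that weight times \<open>psum \<alpha> n\<close> is
  bounded in terms of \<open>R\<close>. Below n/R absolute values suffice.\<close>

lemma convolution_small_partial_sums:
  fixes G :: "nat \<Rightarrow> real"
  assumes a: "0 < \<alpha>" "\<alpha> \<le> 1" and G: "\<And>j. \<bar>G j\<bar> \<le> Cu * real (Suc j) powr (- \<alpha>)"
    and small: "\<And>\<delta>. 0 < \<delta> \<Longrightarrow> \<exists>C. \<forall>N. \<bar>\<Sum>j<N. G j\<bar> \<le> \<delta> * psum \<alpha> N + C"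
  shows "(\<lambda>n. \<Sum>k\<le>n. inverse (norming_seq \<alpha> k) * G (n - k)) \<longlonglongrightarrow> 0"
proof (rule LIMSEQ_I)
  fix r :: real assume r: "0 < r"
  let ?w = "\<lambda>k. inverse (norming_seq \<alpha> k)"
  have w0: "0 \<le> ?w k" for k using inverse_norming_pos[of \<alpha> k] by simp
  obtain C where C: "0 < C" "\<And>R n. 2 \<le> R \<Longrightarrow> R \<le> n \<Longrightarrow>
    (\<Sum>k | k \<le> n \<and> R * k < n. ?w k * \<bar>G (n - k)\<bar>) \<le> C * real R powr (- \<alpha>)"
    using convolution_small_indices[OF a, of "\<lambda>j. \<bar>G j\<bar>" Cu] G by auto
  have "(\<lambda>R. C * real R powr (- \<alpha>)) \<longlonglongrightarrow> 0"
    using a by (intro tendsto_mult_right_zero tendsto_neg_powr filterlim_real_sequentially) auto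
  then have "eventually (\<lambda>R. C * real R powr (- \<alpha>) < r / 2 \<and> 2 \<le> R) sequentially"
    using r by (intro eventually_conj order_tendstoD(2) eventually_ge_at_top) auto
  then obtain R where R: "2 \<le> R" "C * real R powr (- \<alpha>) < r / 2"
    using eventually_happens by fastforce
  obtain D n1 where D: "0 < D" "\<And>n k. n1 \<le> n \<Longrightarrow> n \<le> R * k \<Longrightarrow> ?w k * psum \<alpha> n \<le> D"
    using inverse_norming_psum_le[OF a, of R] R by auto
  define \<delta> where "\<delta> = r / (16 * D)"
  have \<delta>: "0 < \<delta>" using r D by (simp add: \<delta>_def)
  obtain C' where C': "\<And>N. \<bar>\<Sum>j<N. G j\<bar> \<le> \<delta> * psum \<alpha> N + C'" using small[OF \<delta>] by blast
  have "eventually (\<lambda>n. C' / \<delta> \<le> psum \<alpha> n) sequentially"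
    using psum_at_top[OF a(2)] by (simp add: filterlim_at_top)
  then obtain n2 where n2: "\<And>n. n2 \<le> n \<Longrightarrow> C' / \<delta> \<le> psum \<alpha> n"
    by (auto simp: eventually_sequentially)
  have "norm ((\<Sum>k\<le>n. ?w k * G (n - k)) - 0) < r" if n: "max n1 (max n2 (2 * R)) \<le> n" for n
  proof -
    \<comment> \<open>n/R rounded up, the least \<open>k\<close> with \<open>n \<le> R * k\<close>.
      The threshold \<open>2 * R\<close> for \<open>n\<close> makes it at least 2, where the weights
      become monotone.\<close>
    define k0 where "k0 = (n + R - 1) div R"
    have ge: "n \<le> R * k \<longleftrightarrow> k0 \<le> k" for k
    proof -
      have "k0 \<le> k \<longleftrightarrow> (n + R - 1) div R < Suc k" unfolding k0_def by auto
      also have "\<dots> \<longleftrightarrow> n + R - 1 < Suc k * R" using R by (subst div_less_iff_less_mult) auto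
      also have "\<dots> \<longleftrightarrow> n \<le> R * k" using R by (auto simp: mult.commute)
      finally show ?thesis by simp
    qed
    have k02: "2 \<le> k0"
    proof -
      have "n \<le> R * k0" using ge by simp
      then have "2 * R \<le> R * k0" using n by linarith
      then show ?thesis using R by simp
    qed
    have "n \<le> R * n" using R by simp
    then have k0n: "k0 \<le> n" using ge by simp
    define m where "m = n - k0"
    have lt: "R * k < n \<longleftrightarrow> k < k0" for k using ge[of k] by linarith
    have split: "{..n} = {k. k \<le> n \<and> R * k < n} \<union> {k0..n}" by (auto simp: lt)
    have "(\<Sum>k\<le>n. ?w k * G (n - k)) = (\<Sum>k | k \<le> n \<and> R * k < n. ?w k * G (n - k)) + (\<Sum>k=k0..n. ?w k * G (n - k))"
      unfolding split by (rule sum.union_disjoint) (auto simp: lt)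
    also have "(\<Sum>k=k0..n. ?w k * G (n - k)) = (\<Sum>j<Suc m. ?w (n - j) * G j)"
      by (rule sum.reindex_bij_witness[where i = "\<lambda>k. n - k" and j = "\<lambda>k. n - k"]) (use k0n in \<open>auto simp: m_def\<close>)
    finally have eq: "(\<Sum>k\<le>n. ?w k * G (n - k)) = (\<Sum>k | k \<le> n \<and> R * k < n. ?w k * G (n - k)) + (\<Sum>j<Suc m. ?w (n - j) * G j)" .
    have "\<bar>\<Sum>k | k \<le> n \<and> R * k < n. ?w k * G (n - k)\<bar> \<le> (\<Sum>k | k \<le> n \<and> R * k < n. \<bar>?w k * G (n - k)\<bar>)"
      by (rule sum_abs)
    also have "\<dots> = (\<Sum>k | k \<le> n \<and> R * k < n. ?w k * \<bar>G (n - k)\<bar>)"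
      using w0 by (intro sum.cong) (auto simp: abs_mult)
    also have "\<dots> \<le> C * real R powr (- \<alpha>)" using R n by (intro C) auto
    finally have 1: "\<bar>\<Sum>k | k \<le> n \<and> R * k < n. ?w k * G (n - k)\<bar> < r / 2" using R by linarith
    \<comment> \<open>Of the factor 4, two parts pay for
      \<open>psum \<alpha> (2 * n) \<le> 2 * psum \<alpha> n\<close> and one for the constant
      \<open>C'\<close>, which is absorbed from \<open>n2\<close> on.\<close>
    have "\<bar>\<Sum>j<Suc m. ?w (n - j) * G j\<bar> \<le> (\<bar>?w (n - m)\<bar> + (\<Sum>i<m. \<bar>?w (n - Suc i) - ?w (n - i)\<bar>)) * (4 * \<delta> * psum \<alpha> n)"
    proof (rule abel_summation_bound)
      fix k assume "k \<le> Suc m"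
      then have "k \<le> 2 * n" using n R m_def by linarith
      then have "psum \<alpha> k \<le> psum \<alpha> (2 * n)" by (rule psum_mono)
      also have "\<dots> \<le> 2 * psum \<alpha> n" using psum_mult[of \<alpha> 2 n] a by simp
      finally have "\<delta> * psum \<alpha> k \<le> 2 * \<delta> * psum \<alpha> n" using \<delta> by simp
      moreover have "C' \<le> \<delta> * psum \<alpha> n" using n2[of n] n \<delta> by (simp add: field_simps)
      moreover have "0 \<le> \<delta> * psum \<alpha> n" using \<delta> psum_nonneg by simp
      ultimately show "\<bar>\<Sum>j<k. G j\<bar> \<le> 4 * \<delta> * psum \<alpha> n" using C'[of k] by linarith
    qed
    also have "(\<Sum>i<m. \<bar>?w (n - Suc i) - ?w (n - i)\<bar>) = (\<Sum>i<m. ?w (n - Suc i) - ?w (n - i))"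
    proof (rule sum.cong[OF refl])
      fix i assume "i \<in> {..<m}"
      then have "2 \<le> n - Suc i" using k02 by (auto simp: m_def)
      then have "?w (n - i) \<le> ?w (n - Suc i)" using a by (intro inverse_norming_antimono) auto
      then show "\<bar>?w (n - Suc i) - ?w (n - i)\<bar> = ?w (n - Suc i) - ?w (n - i)" by simp
    qed
    also have "\<dots> = ?w (n - m) - ?w n" by (subst sum_lessThan_telescope) simp
    also have "(\<bar>?w (n - m)\<bar> + (?w (n - m) - ?w n)) * (4 * \<delta> * psum \<alpha> n) \<le> (2 * ?w k0) * (4 * \<delta> * psum \<alpha> n)"
      using w0[of k0] w0[of n] k0n \<delta> psum_nonneg[of \<alpha> n] by (intro mult_right_mono) (auto simp: m_def)
    also have "\<dots> = 8 * \<delta> * (?w k0 * psum \<alpha> n)" by simp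
    also have "\<dots> \<le> 8 * \<delta> * D" using n \<delta> ge by (intro mult_left_mono D) auto
    also have "\<dots> = r / 2" using D by (simp add: \<delta>_def)
    finally show ?thesis unfolding eq real_norm_def diff_0_right using 1 by linarith
  qed
  then show "\<exists>no. \<forall>n\<ge>no. norm ((\<Sum>k\<le>n. ?w k * G (n - k)) - 0) < r" by blast
qed


section \<open>Averaging over excursions\<close>

text \<open>\<open>b (k + i)\<close> is the decrement from \<open>t (k + i - 1)\<close> to
  \<open>t (k + i)\<close>; the strict inequality \<open>n0 < k\<close> keeps the smaller index at
  \<open>n0\<close> or above.\<close>

lemma sum_differences_le:
  fixes t b :: "nat \<Rightarrow> real"
  assumes b: "\<And>n. n0 \<le> n \<Longrightarrow> t n = t (Suc n) + b (Suc n)" and k: "n0 < k"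
  shows "(\<Sum>i\<in>{l..<m}. b (k + i)) = (if l \<le> m then t (k + l - 1) - t (k + m - 1) else 0)"
proof (cases "l \<le> m")
  case True
  then show ?thesis
  proof (induction m rule: dec_induct)
    case (step m)
    have "b (k + m) = t (k + m - 1) - t (k + m)"
      using b[of "k + m - 1"] k by simp
    with step show ?case by simp
  qed simp
qed simp

lemma sum_Un_le_add:
  fixes h :: "'b \<Rightarrow> real"
  assumes "finite A" "finite B" "\<And>x. 0 \<le> h x"
  shows "sum h (A \<union> B) \<le> sum h A + sum h B"
  using sum.union_inter[OF assms(1,2), of h] sum_nonneg[of "A \<inter> B" h] assms(3) by simp

text \<open>Only the indices \<open>i\<close> comparable with \<open>j\<close> need the hypothesis \<open>mid\<close>: for \<open>i \<le> \<epsilon> j\<close> and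
  for \<open>i \<ge> j / \<epsilon>\<close> the trivial bound by \<open>2 * B * b (j + i)\<close> telescopes to a small multiple of \<open>j\<close>
  to the power \<open>- \<alpha>\<close>.\<close>

lemma tail_row_error_small:
  fixes t b s :: "nat \<Rightarrow> real" and D :: "nat \<Rightarrow> nat \<Rightarrow> real"
  assumes a: "0 < \<alpha>" "\<alpha> \<le> 1" and n0: "1 \<le> n0"
    and lim: "(\<lambda>i. t i * real (Suc i) powr \<alpha>) \<longlonglongrightarrow> \<gamma>" and t0: "\<And>i. 0 \<le> t i"
    and b: "\<And>n. n0 \<le> n \<Longrightarrow> t n = t (Suc n) + b (Suc n)" and b0: "\<And>n. n0 < n \<Longrightarrow> 0 \<le> b n"
    and s: "\<And>i. n0 \<le> i \<Longrightarrow> \<bar>s i\<bar> \<le> B" and D: "\<And>j i. 1 \<le> j \<Longrightarrow> n0 \<le> i \<Longrightarrow> \<bar>D j i\<bar> \<le> B * b (j + i)"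
    and mid: "\<And>\<epsilon> \<delta>. 0 < \<epsilon> \<Longrightarrow> \<epsilon> < 1 \<Longrightarrow> 0 < \<delta> \<Longrightarrow>
      eventually (\<lambda>j. (\<Sum>i | \<epsilon> * real j < real i \<and> real i < inverse \<epsilon> * real j. \<bar>D j i - s i * b (j + i)\<bar>)
         \<le> \<delta> * real (Suc j) powr (- \<alpha>)) sequentially"
    and \<delta>: "0 < \<delta>"
  shows "\<exists>j0. \<forall>j\<ge>j0. \<forall>M. (\<Sum>i\<in>{n0..<M}. \<bar>D j i - s i * b (j + i)\<bar>) \<le> \<delta> * real (Suc j) powr (- \<alpha>)"
proof -
  have B: "0 \<le> B" using s[of n0] by simp
  have \<gamma>: "0 \<le> \<gamma>" using lim by (rule LIMSEQ_le_const) (use t0 in auto)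
  \<comment> \<open>The cost of the two extreme ranges for \<epsilon> = 1/n, after multiplication by
    \<open>P\<close>: the first summand belongs to small \<open>i\<close>, the second to large
    \<open>i\<close>.\<close>
  define err where "err n = 2 * B * ((3 + \<gamma>) * real n powr (- 1)) + 2 * B * (\<gamma> + 1) * (2 powr \<alpha> * real n powr (- \<alpha>))" for n :: nat
  have "err \<longlonglongrightarrow> 2 * B * ((3 + \<gamma>) * 0) + 2 * B * (\<gamma> + 1) * (2 powr \<alpha> * 0)"
    unfolding err_def by (intro tendsto_add tendsto_mult tendsto_const tendsto_neg_powr filterlim_real_sequentially) (use a in auto)
  then have "eventually (\<lambda>n. err n < \<delta> / 2 \<and> 2 \<le> n) sequentially"
    using \<delta> by (intro eventually_conj order_tendstoD(2)[where y = 0] eventually_ge_at_top) auto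
  then obtain n where n: "err n < \<delta> / 2" "2 \<le> n" using eventually_happens by fastforce
  define \<epsilon> where "\<epsilon> = 1 / real n"
  have \<epsilon>: "0 < \<epsilon>" "\<epsilon> < 1" using n by (auto simp: \<epsilon>_def)
  have err: "err n = 2 * B * (\<epsilon> * (3 + \<gamma>)) + 2 * B * ((\<gamma> + 1) * (2 * \<epsilon>) powr \<alpha>)"
    unfolding err_def \<epsilon>_def using powr_mult_powr_minus[of 2 \<alpha> "real n"] n by (simp add: powr_minus field_simps)
  have "eventually (\<lambda>i. \<bar>t i * real (Suc i) powr \<alpha> - \<gamma>\<bar> < \<epsilon>) sequentially"
    using tendstoD[OF lim \<epsilon>(1)] by (simp add: dist_real_def)
  then obtain i0 where i0: "\<And>i. i0 \<le> i \<Longrightarrow> \<bar>t i * real (Suc i) powr \<alpha> - \<gamma>\<bar> < \<epsilon>"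
    by (auto simp: eventually_sequentially)
  obtain j1 where j1: "\<And>j. j1 \<le> j \<Longrightarrow> (\<Sum>i | \<epsilon> * real j < real i \<and> real i < inverse \<epsilon> * real j. \<bar>D j i - s i * b (j + i)\<bar>)
         \<le> \<delta> / 2 * real (Suc j) powr (- \<alpha>)"
    using mid[OF \<epsilon>, of "\<delta> / 2"] \<delta> by (auto simp: eventually_sequentially)
  have "(\<Sum>i\<in>{n0..<M}. \<bar>D j i - s i * b (j + i)\<bar>) \<le> \<delta> * real (Suc j) powr (- \<alpha>)"
    if j: "max (max (Suc n0) i0) j1 \<le> j" for j M
  proof -
    let ?d = "\<lambda>i. \<bar>D j i - s i * b (j + i)\<bar>"
    let ?mid = "{i. \<epsilon> * real j < real i \<and> real i < inverse \<epsilon> * real j}"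
    define l where "l = nat \<lfloor>\<epsilon> * real j\<rfloor>"
    define h where "h = nat \<lceil>inverse \<epsilon> * real j\<rceil>"
    define P where "P = real (Suc j) powr \<alpha>"
    have P: "0 < P" by (simp add: P_def)
    have jj: "1 \<le> j" "n0 < j" "i0 \<le> j" using j by auto
    have d: "?d i \<le> 2 * B * b (j + i)" if "n0 \<le> i" for i
    proof -
      have "\<bar>s i * b (j + i)\<bar> \<le> B * b (j + i)"
        unfolding abs_mult using s[OF that] b0[of "j + i"] that jj by (intro mult_mono) auto
      with D[OF jj(1) that] show ?thesis by linarith
    qed
    have finmid: "finite ?mid"
      by (rule finite_subset[of _ "{..<h}"]) (auto simp: h_def zless_nat_eq_int_zless less_ceiling_iff)
    have sub: "{n0..<M} \<subseteq> {n0..<Suc l} \<union> ?mid \<union> {max n0 h..<M}"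
    proof
      fix i assume i: "i \<in> {n0..<M}"
      show "i \<in> {n0..<Suc l} \<union> ?mid \<union> {max n0 h..<M}"
      proof (cases "real i \<le> \<epsilon> * real j")
        case True
        then have "i \<le> l" unfolding l_def by (simp add: le_nat_floor)
        with i show ?thesis by simp
      next
        case F: False
        show ?thesis
        proof (cases "real i < inverse \<epsilon> * real j")
          case False
          then have "h \<le> i" unfolding h_def by (simp add: ceiling_le_iff)
          with i show ?thesis by simp
        qed (use F in auto)
      qed
    qed
    have "(\<Sum>i\<in>{n0..<M}. ?d i) \<le> (\<Sum>i\<in>{n0..<Suc l} \<union> ?mid \<union> {max n0 h..<M}. ?d i)"
      by (intro sum_mono2 sub) (use finmid in auto)
    also have "\<dots> \<le> (\<Sum>i\<in>{n0..<Suc l} \<union> ?mid. ?d i) + (\<Sum>i\<in>{max n0 h..<M}. ?d i)"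
      using finmid by (intro sum_Un_le_add) auto
    also have "\<dots> \<le> (\<Sum>i\<in>{n0..<Suc l}. ?d i) + (\<Sum>i\<in>?mid. ?d i) + (\<Sum>i\<in>{max n0 h..<M}. ?d i)"
      using finmid by (intro add_right_mono sum_Un_le_add) auto
    finally have all: "(\<Sum>i\<in>{n0..<M}. ?d i) \<le> (\<Sum>i\<in>{n0..<Suc l}. ?d i) + (\<Sum>i\<in>?mid. ?d i) + (\<Sum>i\<in>{max n0 h..<M}. ?d i)" .
    have tdec: "t (m + k) \<le> t m" if "n0 \<le> m" for m k
    proof (induction k)
      case (Suc k)
      then show ?case using b[of "m + k"] b0[of "Suc (m + k)"] that by simp
    qed simp
    have "(\<Sum>i\<in>{n0..<Suc l}. ?d i) \<le> (\<Sum>i\<in>{n0..<Suc l}. 2 * B * b (j + i))"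
      by (intro sum_mono d) auto
    also have "\<dots> = 2 * B * (\<Sum>i\<in>{n0..<Suc l}. b (j + i))" by (simp only: sum_distrib_left)
    also have "\<dots> \<le> 2 * B * (t j - t (j + l))"
    proof (intro mult_left_mono)
      have 1: "j + Suc l - 1 = j + l" by simp
      have "t (j + l) \<le> t j" using tdec jj by simp
      moreover have "t (j + n0 - 1) \<le> t j"
        using tdec[of j "n0 - 1"] n0 jj by simp
      ultimately show "(\<Sum>i\<in>{n0..<Suc l}. b (j + i)) \<le> t j - t (j + l)"
        using sum_differences_le[of n0 t b j n0 "Suc l", OF b jj(2)] by (simp split: if_splits)
    qed (use B in auto)
    finally have low: "(\<Sum>i\<in>{n0..<Suc l}. ?d i) \<le> 2 * B * (t j - t (j + l))" .
    \<comment> \<open>Scaled by their own powers, both tails lie within \<epsilon> of \<gamma>,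
      which costs 2\<epsilon>. Using the power of \<open>Suc j\<close> for the second tail costs the
      factor \<open>x powr \<alpha>\<close>, at least 1 - \<epsilon> since x \<ge> 1 - \<epsilon>
      and \<alpha> \<le> 1; this adds \<epsilon>(\<gamma> + 1).\<close>
    have "P * (t j - t (j + l)) \<le> \<epsilon> * (3 + \<gamma>)"
    proof -
      define x where "x = real (Suc j) / real (Suc (j + l))"
      have x: "0 < x" "x \<le> 1" by (auto simp: x_def)
      have "real l \<le> \<epsilon> * real j" unfolding l_def using \<epsilon> by (intro of_nat_floor) auto
      have "(1 - \<epsilon>) * real (Suc (j + l)) \<le> (1 - \<epsilon>) * ((1 + \<epsilon>) * real (Suc j))"
        using \<epsilon> \<open>real l \<le> \<epsilon> * real j\<close> by (intro mult_left_mono) (auto simp: algebra_simps)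
      also have "\<dots> = (1 - \<epsilon>\<^sup>2) * real (Suc j)" by (simp add: algebra_simps power2_eq_square)
      also have "\<dots> \<le> 1 * real (Suc j)" by (intro mult_right_mono) auto
      finally have "1 - \<epsilon> \<le> x" unfolding x_def by (simp add: field_simps)
      also have "x = x powr 1" using x by simp
      also have "\<dots> \<le> x powr \<alpha>" using x a by (intro powr_mono') auto
      finally have x\<alpha>: "1 - \<epsilon> \<le> x powr \<alpha>" .
      define \<tau> where "\<tau> = t (j + l) * real (Suc (j + l)) powr \<alpha>"
      have \<tau>: "\<bar>\<tau> - \<gamma>\<bar> < \<epsilon>" "0 \<le> \<tau>" using i0[of "j + l"] jj t0 by (auto simp: \<tau>_def)
      have "P * t (j + l) = x powr \<alpha> * \<tau>"
        unfolding x_def \<tau>_def P_def by (simp add: powr_divide)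
      also have "\<dots> \<ge> (1 - \<epsilon>) * \<tau>" using x\<alpha> \<tau> by (intro mult_right_mono) auto
      finally have 1: "\<tau> - \<epsilon> * \<tau> \<le> P * t (j + l)" by (simp add: algebra_simps)
      have "\<epsilon> * \<tau> \<le> \<epsilon> * (\<gamma> + 1)" using \<tau> \<epsilon> by (intro mult_left_mono) auto
      moreover have "P * t j < \<gamma> + \<epsilon>" using i0[of j] jj by (simp add: P_def mult.commute)
      ultimately show ?thesis using 1 \<tau> by (simp add: algebra_simps)
    qed
    then have "2 * B * (P * (t j - t (j + l))) \<le> 2 * B * (\<epsilon> * (3 + \<gamma>))"
      using B by (intro mult_left_mono) auto
    moreover have "P * (\<Sum>i\<in>{n0..<Suc l}. ?d i) \<le> P * (2 * B * (t j - t (j + l)))"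
      using low P by (intro mult_left_mono) auto
    ultimately have low': "P * (\<Sum>i\<in>{n0..<Suc l}. ?d i) \<le> 2 * B * (\<epsilon> * (3 + \<gamma>))"
      by (simp add: mult_ac)
    have hj: "real j \<le> \<epsilon> * real h"
    proof -
      have "inverse \<epsilon> * real j \<le> real h" unfolding h_def by linarith
      then have "\<epsilon> * (inverse \<epsilon> * real j) \<le> \<epsilon> * real h" by (rule mult_left_mono) (use \<epsilon> in simp)
      then show ?thesis using \<epsilon>(1) unfolding mult.assoc[symmetric] by (simp del: mult_le_cancel_left_pos)
    qed
    also have "\<dots> \<le> 1 * real h" using \<epsilon> by (intro mult_right_mono) auto
    finally have jh: "j \<le> h" by simp
    have mx: "max n0 h = h" using jh jj by simp
    have "(\<Sum>i\<in>{h..<M}. ?d i) \<le> (\<Sum>i\<in>{h..<M}. 2 * B * b (j + i))"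
      using jh jj by (intro sum_mono d) auto
    also have "\<dots> = 2 * B * (\<Sum>i\<in>{h..<M}. b (j + i))" by (simp only: sum_distrib_left)
    also have "\<dots> \<le> 2 * B * t h"
    proof (intro mult_left_mono)
      have "t (j + h - 1) \<le> t h" using tdec[of h "j - 1"] jh jj by (simp add: add.commute)
      then show "(\<Sum>i\<in>{h..<M}. b (j + i)) \<le> t h"
        using sum_differences_le[of n0 t b j h M, OF b jj(2)] t0[of "j + M - 1"] t0[of h] by (simp split: if_splits)
    qed (use B in auto)
    finally have "P * (\<Sum>i\<in>{h..<M}. ?d i) \<le> P * (2 * B * t h)"
      using P by (intro mult_left_mono) auto
    also have "\<dots> = 2 * B * (P * t h)" by simp
    also have "P * t h \<le> (\<gamma> + 1) * (2 * \<epsilon>) powr \<alpha>"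
    proof -
      define x where "x = real (Suc j) / real (Suc h)"
      \<comment> \<open>The factor 2 pays for passing from \<open>j\<close> to
        \<open>Suc j\<close>.\<close>
      have "real (Suc j) \<le> 2 * \<epsilon> * real (Suc h)" using hj jj \<epsilon> by (simp add: algebra_simps)
      then have "x \<le> 2 * \<epsilon>" unfolding x_def by (simp add: field_simps)
      then have x\<alpha>: "x powr \<alpha> \<le> (2 * \<epsilon>) powr \<alpha>" using a by (intro powr_mono2) (auto simp: x_def)
      have "P * t h = (t h * real (Suc h) powr \<alpha>) * x powr \<alpha>"
        unfolding x_def P_def by (simp add: powr_divide)
      also have "\<dots> \<le> (\<gamma> + 1) * (2 * \<epsilon>) powr \<alpha>"
        using i0[of h] jh jj t0[of h] \<epsilon> \<gamma> x\<alpha> by (intro mult_mono) auto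
      finally show ?thesis .
    qed
    finally have high': "P * (\<Sum>i\<in>{h..<M}. ?d i) \<le> 2 * B * ((\<gamma> + 1) * (2 * \<epsilon>) powr \<alpha>)"
      using B by (simp add: mult_left_mono)
    have "P * (\<Sum>i\<in>?mid. ?d i) \<le> P * (\<delta> / 2 * real (Suc j) powr (- \<alpha>))"
      using j1[of j] j P by (intro mult_left_mono) auto
    also have "\<dots> = \<delta> / 2" unfolding P_def by (simp add: powr_minus)
    finally have "P * (\<Sum>i\<in>?mid. ?d i) \<le> \<delta> / 2" .
    moreover have "P * (\<Sum>i\<in>{n0..<M}. ?d i) \<le> P * ((\<Sum>i\<in>{n0..<Suc l}. ?d i) + (\<Sum>i\<in>?mid. ?d i) + (\<Sum>i\<in>{h..<M}. ?d i))"
      using all P unfolding mx by (intro mult_left_mono) auto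
    ultimately have "P * (\<Sum>i\<in>{n0..<M}. ?d i) \<le> \<delta>"
      using low' high' n err unfolding distrib_left by linarith
    then have "(\<Sum>i\<in>{n0..<M}. ?d i) \<le> \<delta> / P"
      using P by (simp add: field_simps)
    then show ?thesis by (simp add: P_def powr_minus divide_inverse)
  qed
  then show ?thesis by blast
qed


text \<open>A shift by one step telescopes to at most \<open>u 0\<close>, and \<open>k\<close> such
  shifts are added. The boundary errors \<open>u j - u (j + n0)\<close> thus have a total bounded
  independently of \<open>N\<close>.\<close>

lemma sum_shift_difference_le:
  fixes u :: "nat \<Rightarrow> real"
  assumes "\<And>j. 0 \<le> u j" "\<And>j. u j \<le> u 0"
  shows "(\<Sum>j=1..N. u j - u (j + k)) \<le> real k * u 0"
proof (induction k)
  case (Suc k)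
  have "(\<Sum>j=1..N. u (j + k) - u (j + Suc k)) = u (1 + k) - u (N + 1 + k)"
    by (induction N) (auto simp: algebra_simps)
  also have "\<dots> \<le> u 0" using assms(1)[of "N + 1 + k"] assms(2)[of "1 + k"] by linarith
  finally have "(\<Sum>j=1..N. u (j + k) - u (j + Suc k)) \<le> u 0" .
  moreover have "(\<Sum>j=1..N. u j - u (j + Suc k)) = (\<Sum>j=1..N. u j - u (j + k)) + (\<Sum>j=1..N. u (j + k) - u (j + Suc k))"
    by (simp add: sum.distrib[symmetric])
  ultimately show ?case using Suc by (simp add: algebra_simps)
qed simp

text \<open>Multiplied by \<open>real (Suc (i + N)) powr \<alpha>\<close>, both terms are close to
  \<gamma> once \<open>i\<close> is large, so their difference is at most a small multiple of
  N^(-alpha). There are \<open>R * N\<close> such indices; the finitely many smaller ones cost at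
  most \<open>T\<close> each.\<close>

lemma scaled_tail_shift_error:
  fixes t :: "nat \<Rightarrow> real"
  assumes a: "0 < \<alpha>" and lim: "(\<lambda>i. t i * real (Suc i) powr \<alpha>) \<longlonglongrightarrow> \<gamma>"
    and t0: "\<And>i. 0 \<le> t i" and tT: "\<And>i. t i \<le> T" and \<delta>: "0 < \<delta>"
  shows "\<exists>C. \<forall>N. (\<Sum>i<R * N. \<bar>t (i + N) - t i * (real (Suc i) / real (Suc (i + N))) powr \<alpha>\<bar>) \<le> \<delta> * psum \<alpha> N + C"
proof -
  define \<eta> where "\<eta> = \<delta> / (2 * (real R + 1))"
  have \<eta>: "0 < \<eta>" "2 * \<eta> * real R \<le> \<delta>" using \<delta> by (auto simp: \<eta>_def field_simps)
  have "eventually (\<lambda>i. \<bar>t i * real (Suc i) powr \<alpha> - \<gamma>\<bar> < \<eta>) sequentially"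
    using tendstoD[OF lim \<eta>(1)] by (simp add: dist_real_def)
  then obtain i0 where i0: "\<And>i. i0 \<le> i \<Longrightarrow> \<bar>t i * real (Suc i) powr \<alpha> - \<gamma>\<bar> < \<eta>"
    by (auto simp: eventually_sequentially)
  have "(\<Sum>i<R * N. \<bar>t (i + N) - t i * (real (Suc i) / real (Suc (i + N))) powr \<alpha>\<bar>) \<le> \<delta> * psum \<alpha> N + real i0 * T" for N
  proof (cases "N = 0")
    case True
    have "0 \<le> T" using t0[of 0] tT[of 0] by linarith
    with True show ?thesis by (simp add: psum_def)
  next
    case N: False
    let ?h = "\<lambda>i. \<bar>t (i + N) - t i * (real (Suc i) / real (Suc (i + N))) powr \<alpha>\<bar>"
    have small: "?h i \<le> T" for i
    proof -
      have "(real (Suc i) / real (Suc (i + N))) powr \<alpha> \<le> 1 powr \<alpha>" using a by (intro powr_mono2) auto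
      then have "t i * (real (Suc i) / real (Suc (i + N))) powr \<alpha> \<le> T * 1"
        using t0[of i] tT[of i] by (intro mult_mono) auto
      moreover have "0 \<le> t i * (real (Suc i) / real (Suc (i + N))) powr \<alpha>" using t0 by simp
      ultimately show ?thesis using t0[of "i + N"] tT[of "i + N"] by linarith
    qed
    have large: "?h i \<le> 2 * \<eta> * real N powr (- \<alpha>)" if "i0 \<le> i" for i
    proof -
      let ?q = "real (Suc (i + N)) powr \<alpha>"
      have q: "0 < ?q" by simp
      have "t (i + N) - t i * (real (Suc i) / real (Suc (i + N))) powr \<alpha> = (t (i + N) * ?q - t i * real (Suc i) powr \<alpha>) / ?q"
        by (simp add: powr_divide diff_divide_distrib)
      then have "?h i = \<bar>t (i + N) * ?q - t i * real (Suc i) powr \<alpha>\<bar> / ?q" by simp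
      also have "\<dots> \<le> (2 * \<eta>) / ?q"
        using i0[of i] i0[of "i + N"] that by (intro divide_right_mono) auto
      also have "\<dots> = 2 * \<eta> * real (Suc (i + N)) powr (- \<alpha>)" by (simp add: powr_minus divide_inverse)
      also have "\<dots> \<le> 2 * \<eta> * real N powr (- \<alpha>)"
        using \<eta> N a by (intro mult_left_mono powr_mono2') auto
      finally show ?thesis .
    qed
    have "(\<Sum>i<R * N. ?h i) \<le> (\<Sum>i<R * N. 2 * \<eta> * real N powr (- \<alpha>) + (if i < i0 then T else 0))"
    proof (rule sum_mono)
      fix i
      have "0 \<le> 2 * \<eta> * real N powr (- \<alpha>)" using \<eta> by simp
      then show "?h i \<le> 2 * \<eta> * real N powr (- \<alpha>) + (if i < i0 then T else 0)"
        using small[of i] large[of i] by (cases "i < i0") auto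
    qed
    also have "\<dots> = 2 * \<eta> * real R * (real N * real N powr (- \<alpha>)) + (\<Sum>i<R * N. if i < i0 then T else 0)"
      by (simp add: sum.distrib)
    also have "(\<Sum>i<R * N. if i < i0 then T else 0) \<le> (\<Sum>i<i0. T)"
    proof -
      have "(\<Sum>i<R * N. if i < i0 then T else 0) = (\<Sum>i\<in>{..<R * N} \<inter> {i. i < i0}. T)"
        by (subst sum.inter_restrict) auto
      also have "\<dots> \<le> (\<Sum>i<i0. T)" using t0[of 0] tT[of 0] by (intro sum_mono2) auto
      finally show ?thesis .
    qed
    also have "2 * \<eta> * real R * (real N * real N powr (- \<alpha>)) \<le> \<delta> * psum \<alpha> N"
      using \<eta> \<delta> psum_ge_powr[of \<alpha> N] a by (intro mult_mono) auto
    finally show ?thesis by simp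
  qed
  then show ?thesis by blast
qed

text \<open>The weights decrease in \<open>i\<close> and lie in [0, 1], so the last weight plus the
  total variation is the first weight, at most 1. The longer range \<open>R * N\<close> costs a
  factor \<open>R\<close>, which the choice of \<eta> compensates.\<close>

lemma weighted_sum_small:
  fixes S :: "nat \<Rightarrow> real"
  assumes a: "0 < \<alpha>" and \<delta>: "0 < \<delta>"
    and small: "\<And>\<delta>. 0 < \<delta> \<Longrightarrow> \<exists>C. \<forall>N. \<bar>\<Sum>i<N. S i\<bar> \<le> \<delta> * psum \<alpha> N + C"
  shows "\<exists>C. \<forall>N. \<bar>\<Sum>i<R * N. (1 - (real (Suc i) / real (Suc (i + N))) powr \<alpha>) * S i\<bar> \<le> \<delta> * psum \<alpha> N + C"
proof -
  define \<eta> where "\<eta> = \<delta> / (real R + 1)"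
  have \<eta>: "0 < \<eta>" "\<eta> * real R \<le> \<delta>" using \<delta> by (auto simp: \<eta>_def field_simps)
  obtain C where C: "\<And>N. \<bar>\<Sum>i<N. S i\<bar> \<le> \<eta> * psum \<alpha> N + C" using small[OF \<eta>(1)] by blast
  have C0: "0 \<le> C" using C[of 0] by (simp add: psum_def)
  have "\<bar>\<Sum>i<R * N. (1 - (real (Suc i) / real (Suc (i + N))) powr \<alpha>) * S i\<bar> \<le> \<delta> * psum \<alpha> N + C" for N
  proof (cases "R * N")
    case 0
    show ?thesis unfolding 0 using C0 \<delta> psum_nonneg[of \<alpha> N] by simp
  next
    case (Suc m)
    define \<phi> where "\<phi> i = 1 - (real (Suc i) / real (Suc (i + N))) powr \<alpha>" for i
    have dec: "\<phi> (Suc i) \<le> \<phi> i" for i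
      unfolding \<phi>_def using a by (intro diff_left_mono powr_mono2) (auto simp: field_simps)
    have le1: "\<phi> 0 \<le> 1" by (simp add: \<phi>_def)
    have pos: "0 \<le> \<phi> i" for i
    proof -
      have "(real (Suc i) / real (Suc (i + N))) powr \<alpha> \<le> 1 powr \<alpha>" using a by (intro powr_mono2) auto
      then show ?thesis by (simp add: \<phi>_def)
    qed
    have "\<bar>\<Sum>i<Suc m. \<phi> i * S i\<bar> \<le> (\<bar>\<phi> m\<bar> + (\<Sum>i<m. \<bar>\<phi> (Suc i) - \<phi> i\<bar>)) * (\<delta> * psum \<alpha> N + C)"
    proof (rule abel_summation_bound)
      fix k assume "k \<le> Suc m"
      then have "psum \<alpha> k \<le> real R * psum \<alpha> N"
        using psum_mono[of k "R * N" \<alpha>] psum_mult[of \<alpha> R N] a Suc by simp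
      then have "\<eta> * psum \<alpha> k \<le> \<eta> * (real R * psum \<alpha> N)" using \<eta> by simp
      also have "\<dots> = (\<eta> * real R) * psum \<alpha> N" by simp
      also have "\<dots> \<le> \<delta> * psum \<alpha> N" using \<eta> psum_nonneg by (intro mult_right_mono) auto
      finally show "\<bar>\<Sum>i<k. S i\<bar> \<le> \<delta> * psum \<alpha> N + C" using C[of k] by linarith
    qed
    also have "(\<Sum>i<m. \<bar>\<phi> (Suc i) - \<phi> i\<bar>) = (\<Sum>i<m. \<phi> i - \<phi> (Suc i))"
      by (intro sum.cong refl) (use dec in \<open>simp add: abs_of_nonpos\<close>)
    also have "\<dots> = \<phi> 0 - \<phi> m" by (rule sum_lessThan_telescope')
    also have "(\<bar>\<phi> m\<bar> + (\<phi> 0 - \<phi> m)) * (\<delta> * psum \<alpha> N + C) \<le> 1 * (\<delta> * psum \<alpha> N + C)"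
      using le1 pos[of m] C0 \<delta> psum_nonneg[of \<alpha> N] by (intro mult_right_mono) auto
    finally show ?thesis unfolding Suc \<phi>_def by simp
  qed
  then show ?thesis by blast
qed


text \<open>All rows from some \<open>j0\<close> on obey the row estimate. Each earlier row costs at
  most \<open>2 * B * T\<close>, since the terms \<open>b (j + i)\<close> telescope. Uniformity in
  \<open>M\<close> allows the cutoff to grow with \<open>N\<close> later.\<close>

lemma tail_rows_error_sum_small:
  fixes t b s :: "nat \<Rightarrow> real" and D :: "nat \<Rightarrow> nat \<Rightarrow> real"
  assumes a: "0 < \<alpha>" "\<alpha> \<le> 1" and n0: "1 \<le> n0"
    and lim: "(\<lambda>i. t i * real (Suc i) powr \<alpha>) \<longlonglongrightarrow> \<gamma>" and t0: "\<And>i. 0 \<le> t i" and tT: "\<And>i. t i \<le> T"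
    and b: "\<And>n. n0 \<le> n \<Longrightarrow> t n = t (Suc n) + b (Suc n)" and b0: "\<And>n. n0 < n \<Longrightarrow> 0 \<le> b n"
    and s: "\<And>i. n0 \<le> i \<Longrightarrow> \<bar>s i\<bar> \<le> B" and D: "\<And>j i. 1 \<le> j \<Longrightarrow> n0 \<le> i \<Longrightarrow> \<bar>D j i\<bar> \<le> B * b (j + i)"
    and mid: "\<And>\<epsilon> \<delta>. 0 < \<epsilon> \<Longrightarrow> \<epsilon> < 1 \<Longrightarrow> 0 < \<delta> \<Longrightarrow>
      eventually (\<lambda>j. (\<Sum>i | \<epsilon> * real j < real i \<and> real i < inverse \<epsilon> * real j. \<bar>D j i - s i * b (j + i)\<bar>)
         \<le> \<delta> * real (Suc j) powr (- \<alpha>)) sequentially"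
    and \<delta>: "0 < \<delta>"
  shows "\<exists>C. \<forall>N M. (\<Sum>j=1..N. \<Sum>i\<in>{n0..<M}. \<bar>D j i - s i * b (j + i)\<bar>) \<le> \<delta> * psum \<alpha> N + C"
proof -
  obtain j0 where j0: "\<And>j M. j0 \<le> j \<Longrightarrow> (\<Sum>i\<in>{n0..<M}. \<bar>D j i - s i * b (j + i)\<bar>) \<le> \<delta> * real (Suc j) powr (- \<alpha>)"
    using tail_row_error_small[OF a n0 lim t0 b b0 s D mid \<delta>] by blast
  have B: "0 \<le> B" using s[of n0] by simp
  have T: "0 \<le> T" using t0[of 0] tT[of 0] by linarith
  have row: "(\<Sum>i\<in>{n0..<M}. \<bar>D j i - s i * b (j + i)\<bar>) \<le> 2 * B * T" if j: "1 \<le> j" for j M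
  proof -
    have "(\<Sum>i\<in>{n0..<M}. \<bar>D j i - s i * b (j + i)\<bar>) \<le> (\<Sum>i\<in>{n0..<M}. 2 * B * b (j + i))"
    proof (rule sum_mono)
      fix i assume i: "i \<in> {n0..<M}"
      have "\<bar>s i * b (j + i)\<bar> \<le> B * b (j + i)"
        unfolding abs_mult using s[of i] b0[of "j + i"] i j by (intro mult_mono) auto
      with D[of j i] i j show "\<bar>D j i - s i * b (j + i)\<bar> \<le> 2 * B * b (j + i)" by force
    qed
    also have "\<dots> = 2 * B * (\<Sum>i\<in>{n0..<M}. b (j + i))" by (simp only: sum_distrib_left)
    also have "(\<Sum>i\<in>{n0..<M}. b (j + i)) = (\<Sum>i\<in>{0..<M - n0}. b ((j + n0) + i))"
      by (rule sum.reindex_bij_witness[where i = "\<lambda>i. i + n0" and j = "\<lambda>i. i - n0"]) auto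
    also have "2 * B * \<dots> \<le> 2 * B * T"
    proof (rule mult_left_mono)
      show "(\<Sum>i\<in>{0..<M - n0}. b ((j + n0) + i)) \<le> T"
        using sum_differences_le[of n0 t b "j + n0" 0 "M - n0", OF b] j tT[of "j + n0 - 1"] t0[of "j + n0 + (M - n0) - 1"] by simp
    qed (use B in simp)
    finally show ?thesis .
  qed
  have BT: "0 \<le> 2 * B * T" using B T by simp
  have "(\<Sum>j=1..N. \<Sum>i\<in>{n0..<M}. \<bar>D j i - s i * b (j + i)\<bar>) \<le> \<delta> * psum \<alpha> N + (\<delta> + real j0 * (2 * B * T))" for N M
  proof -
    have "(\<Sum>j=1..N. \<Sum>i\<in>{n0..<M}. \<bar>D j i - s i * b (j + i)\<bar>) \<le> (\<Sum>j=1..N. \<delta> * real (Suc j) powr (- \<alpha>) + (if j < j0 then 2 * B * T else 0))"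
    proof (rule sum_mono)
      fix j assume j: "j \<in> {1..N}"
      have "0 \<le> \<delta> * real (Suc j) powr (- \<alpha>)" using \<delta> by simp
      then show "(\<Sum>i\<in>{n0..<M}. \<bar>D j i - s i * b (j + i)\<bar>) \<le> \<delta> * real (Suc j) powr (- \<alpha>) + (if j < j0 then 2 * B * T else 0)"
        using row[of j M] j0[of j M] j by (cases "j < j0") auto
    qed
    also have "\<dots> = \<delta> * (\<Sum>j=1..N. real (Suc j) powr (- \<alpha>)) + (\<Sum>j=1..N. if j < j0 then 2 * B * T else 0)"
      by (simp only: sum.distrib sum_distrib_left)
    also have "(\<Sum>j=1..N. if j < j0 then 2 * B * T else 0) \<le> (\<Sum>j<j0. 2 * B * T)"
    proof -
      have "(\<Sum>j=1..N. if j < j0 then 2 * B * T else 0) = (\<Sum>j\<in>{1..N} \<inter> {j. j < j0}. 2 * B * T)"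
        by (subst sum.inter_restrict) auto
      also have "\<dots> \<le> (\<Sum>j<j0. 2 * B * T)" by (intro sum_mono2) (use BT in auto)
      finally show ?thesis .
    qed
    also have "(\<Sum>j=1..N. real (Suc j) powr (- \<alpha>)) \<le> psum \<alpha> N + 1"
    proof -
      have "(\<Sum>j=1..N. real (Suc j) powr (- \<alpha>)) \<le> (\<Sum>j<Suc N. real (Suc j) powr (- \<alpha>))"
        by (intro sum_mono2) auto
      also have "\<dots> = psum \<alpha> (N + 1)" by (simp add: psum_def)
      also have "\<dots> \<le> psum \<alpha> N + psum \<alpha> 1" using a by (intro psum_subadditive) auto
      also have "psum \<alpha> 1 = 1" by (simp add: psum_def)
      finally show ?thesis .
    qed
    finally show ?thesis using \<delta> by (simp add: algebra_simps)
  qed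
  then show ?thesis by blast
qed

lemma finite_family_bounds:
  fixes h :: "'b \<Rightarrow> nat \<Rightarrow> real"
  assumes "finite P" "0 < \<delta>" and "\<And>p \<eta>. p \<in> P \<Longrightarrow> 0 < \<eta> \<Longrightarrow> \<exists>C. \<forall>N. h p N \<le> \<eta> * psum \<alpha> N + C"
  shows "\<exists>C. \<forall>N. (\<Sum>p\<in>P. h p N) \<le> \<delta> * psum \<alpha> N + C"
proof -
  define \<eta> where "\<eta> = \<delta> / (real (card P) + 1)"
  have \<eta>: "0 < \<eta>" "real (card P) * \<eta> \<le> \<delta>" using assms(2) by (auto simp: \<eta>_def field_simps)
  obtain C where C: "\<And>p N. p \<in> P \<Longrightarrow> h p N \<le> \<eta> * psum \<alpha> N + C p"
    using assms(3)[OF _ \<eta>(1)] by metis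
  have "(\<Sum>p\<in>P. h p N) \<le> \<delta> * psum \<alpha> N + (\<Sum>p\<in>P. C p)" for N
  proof -
    have "(\<Sum>p\<in>P. h p N) \<le> (\<Sum>p\<in>P. \<eta> * psum \<alpha> N + C p)" by (intro sum_mono C)
    also have "\<dots> = (real (card P) * \<eta>) * psum \<alpha> N + (\<Sum>p\<in>P. C p)" by (simp add: sum.distrib)
    also have "\<dots> \<le> \<delta> * psum \<alpha> N + (\<Sum>p\<in>P. C p)"
      using \<eta> psum_nonneg by (intro add_right_mono mult_right_mono) auto
    finally show ?thesis .
  qed
  then show ?thesis by blast
qed

text \<open>In the application \<open>t p i\<close> is the measure of \<open>X\<close> with indices \<open>i, p\<close>, \<open>s p i\<close> the mean of the
  observable over that set, \<open>b p k\<close> the measure of the points of \<open>Y\<close> of type \<open>p\<close> returning at time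
  \<open>k\<close>, and \<open>u j\<close> the measure of the points of \<open>Y\<close> returning after time \<open>j\<close>. Summing
  \<open>b p (j + i)\<close> over \<open>j \<le> N\<close> gives \<open>t p i - t p (i + N)\<close>, which is close to \<open>(1 - \<rho> N i) * t p i\<close>
  with weights \<open>1 - \<rho> N i\<close> decreasing in \<open>i\<close>, so Abel summation applies.\<close>

lemma excursion_partial_sums_small:
  fixes t b s :: "'b \<Rightarrow> nat \<Rightarrow> real" and D :: "'b \<Rightarrow> nat \<Rightarrow> nat \<Rightarrow> real" and G u :: "nat \<Rightarrow> real"
  assumes a: "0 < \<alpha>" "\<alpha> \<le> 1" and n0: "1 \<le> n0" and P: "finite P"
    and lim: "\<And>p. p \<in> P \<Longrightarrow> (\<lambda>i. t p i * real (Suc i) powr \<alpha>) \<longlonglongrightarrow> \<gamma> p"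
    and t0: "\<And>p i. p \<in> P \<Longrightarrow> 0 \<le> t p i"
    and b: "\<And>p n. p \<in> P \<Longrightarrow> n0 \<le> n \<Longrightarrow> t p n = t p (Suc n) + b p (Suc n)"
    and b0: "\<And>p n. p \<in> P \<Longrightarrow> n0 < n \<Longrightarrow> 0 \<le> b p n"
    and s: "\<And>p i. p \<in> P \<Longrightarrow> n0 \<le> i \<Longrightarrow> \<bar>s p i\<bar> \<le> B"
    and D: "\<And>p j i. p \<in> P \<Longrightarrow> 1 \<le> j \<Longrightarrow> n0 \<le> i \<Longrightarrow> \<bar>D p j i\<bar> \<le> B * b p (j + i)"
    and mid: "\<And>p \<epsilon> \<delta>. p \<in> P \<Longrightarrow> 0 < \<epsilon> \<Longrightarrow> \<epsilon> < 1 \<Longrightarrow> 0 < \<delta> \<Longrightarrow>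
      eventually (\<lambda>j. (\<Sum>i | \<epsilon> * real j < real i \<and> real i < inverse \<epsilon> * real j. \<bar>D p j i - s p i * b p (j + i)\<bar>)
         \<le> \<delta> * real (Suc j) powr (- \<alpha>)) sequentially"
    and u: "\<And>j. 0 \<le> u j" "\<And>i j. i \<le> j \<Longrightarrow> u j \<le> u i" "\<And>j. u j \<le> Cu * real (Suc j) powr (- \<alpha>)" and B: "0 \<le> B"
    and G: "\<And>j M. 1 \<le> j \<Longrightarrow> n0 \<le> M \<Longrightarrow> \<bar>G j - (\<Sum>i\<in>{n0..<M}. \<Sum>p\<in>P. D p j i)\<bar> \<le> B * (u j - u (j + n0)) + B * u M"
    and avg: "\<And>\<delta>. 0 < \<delta> \<Longrightarrow> \<exists>C. \<forall>N. \<bar>\<Sum>i<N. if n0 \<le> i then \<Sum>p\<in>P. s p i * t p i else 0\<bar> \<le> \<delta> * psum \<alpha> N + C"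
    and \<delta>: "0 < \<delta>"
  shows "\<exists>C. \<forall>N. \<bar>\<Sum>j<N. G j\<bar> \<le> \<delta> * psum \<alpha> N + C"
proof -
  \<comment> \<open>One quarter for each of four errors: truncation at \<open>M\<close>, deviation
    of \<open>D\<close> from the averages, replacement of \<open>t p (i + N)\<close>, and the
    weighted sum itself.\<close>
  define \<eta> where "\<eta> = \<delta> / 4"
  have \<eta>: "0 < \<eta>" using \<delta> by (simp add: \<eta>_def)
  \<comment> \<open>Truncation at \<open>M = R * N\<close> costs \<open>B * u M\<close> for each of
    \<open>N\<close> values of \<open>j\<close>, in total at most
    \<open>B * Cu * real R powr (- \<alpha>)\<close> times \<open>psum \<alpha> N\<close>. This
    dictates how large \<open>R\<close> must be.\<close>
  have "(\<lambda>R. B * Cu * real R powr (- \<alpha>)) \<longlonglongrightarrow> 0"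
    using a by (intro tendsto_mult_right_zero tendsto_neg_powr filterlim_real_sequentially) auto
  then have "eventually (\<lambda>R. B * Cu * real R powr (- \<alpha>) < \<eta> \<and> n0 \<le> R) sequentially"
    using \<eta> by (intro eventually_conj order_tendstoD(2) eventually_ge_at_top) auto
  then obtain R where R: "B * Cu * real R powr (- \<alpha>) < \<eta>" "n0 \<le> R"
    using eventually_happens by fastforce
  have "\<exists>T. \<forall>i. t p i \<le> T" if p: "p \<in> P" for p
  proof -
    have "Bseq (\<lambda>i. t p i * real (Suc i) powr \<alpha>)" using convergent_imp_Bseq[OF convergentI[OF lim[OF p]]] .
    then obtain T where T: "\<And>i. norm (t p i * real (Suc i) powr \<alpha>) \<le> T" unfolding Bseq_def by blast
    have "t p i \<le> T" for i
    proof -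
      have "1 \<le> real (Suc i) powr \<alpha>" using a by (intro ge_one_powr_ge_zero) auto
      then have "t p i * 1 \<le> t p i * real (Suc i) powr \<alpha>" using t0[OF p] by (intro mult_left_mono) auto
      with T[of i] show ?thesis by simp
    qed
    then show ?thesis by blast
  qed
  then obtain T where T: "\<And>p i. p \<in> P \<Longrightarrow> t p i \<le> T p" by metis
  define \<rho> where "\<rho> N i = (real (Suc i) / real (Suc (i + N))) powr \<alpha>" for N i
  define S where "S i = (if n0 \<le> i then \<Sum>p\<in>P. s p i * t p i else 0)" for i
  define e1 where "e1 p N = (\<Sum>j=1..N. \<Sum>i\<in>{n0..<R * N}. \<bar>D p j i - s p i * b p (j + i)\<bar>)" for p N
  define e2 where "e2 p N = B * (\<Sum>i<R * N. \<bar>t p (i + N) - t p i * \<rho> N i\<bar>)" for p N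
  have "\<exists>C. \<forall>N. e1 p N \<le> \<zeta> * psum \<alpha> N + C" if "p \<in> P" "0 < \<zeta>" for p \<zeta>
    unfolding e1_def
    using tail_rows_error_sum_small[OF a n0 lim t0 T b b0 s D mid, of p] that by blast
  from finite_family_bounds[where h = e1, OF P \<eta> this]
  obtain C1 where C1: "\<And>N. (\<Sum>p\<in>P. e1 p N) \<le> \<eta> * psum \<alpha> N + C1" by blast
  have "\<exists>C. \<forall>N. e2 p N \<le> \<zeta> * psum \<alpha> N + C" if p: "p \<in> P" and \<zeta>: "0 < \<zeta>" for p \<zeta>
  proof -
    have z: "0 < \<zeta> / (B + 1)" "B * (\<zeta> / (B + 1)) \<le> \<zeta>" using \<zeta> B by (auto simp: field_simps)
    obtain C where C: "\<And>N. (\<Sum>i<R * N. \<bar>t p (i + N) - t p i * \<rho> N i\<bar>) \<le> \<zeta> / (B + 1) * psum \<alpha> N + C"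
      unfolding \<rho>_def using scaled_tail_shift_error[OF a(1) lim t0 T z(1), of p] p by blast
    have "e2 p N \<le> \<zeta> * psum \<alpha> N + B * C" for N
    proof -
      have "e2 p N \<le> B * (\<zeta> / (B + 1) * psum \<alpha> N + C)"
        unfolding e2_def using C B by (intro mult_left_mono) auto
      also have "\<dots> = (B * (\<zeta> / (B + 1))) * psum \<alpha> N + B * C" by (simp add: algebra_simps)
      also have "\<dots> \<le> \<zeta> * psum \<alpha> N + B * C"
        using z psum_nonneg by (intro add_right_mono mult_right_mono) auto
      finally show ?thesis .
    qed
    then show ?thesis by blast
  qed
  from finite_family_bounds[where h = e2, OF P \<eta> this]
  obtain C2 where C2: "\<And>N. (\<Sum>p\<in>P. e2 p N) \<le> \<eta> * psum \<alpha> N + C2" by blast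
  obtain C3 where C3: "\<And>N. \<bar>\<Sum>i<R * N. (1 - \<rho> N i) * S i\<bar> \<le> \<eta> * psum \<alpha> N + C3"
    using weighted_sum_small[OF a(1) \<eta> avg, of R] unfolding \<rho>_def S_def by blast
  have main: "\<bar>\<Sum>j=1..N. G j\<bar> \<le> \<delta> * psum \<alpha> N + (B * (real n0 * u 0) + C1 + C2 + C3)" if N: "1 \<le> N" for N
  proof -
    define M where "M = R * N"
    have M: "n0 \<le> M" using R N by (simp add: M_def le_trans[of n0 R "R * N"])
    define E where "E j = G j - (\<Sum>i\<in>{n0..<M}. \<Sum>p\<in>P. D p j i)" for j
    have E: "\<bar>E j\<bar> \<le> B * (u j - u (j + n0)) + B * u M" if "j \<in> {1..N}" for j
      unfolding E_def using G[of j M] that M by simp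
    have "(\<Sum>j=1..N. \<bar>E j\<bar>) \<le> (\<Sum>j=1..N. B * (u j - u (j + n0)) + B * u M)"
      by (intro sum_mono E)
    also have "\<dots> = B * (\<Sum>j=1..N. u j - u (j + n0)) + B * (real N * u M)"
      by (simp add: sum.distrib sum_distrib_left[symmetric])
    also have "\<dots> \<le> B * (real n0 * u 0) + \<eta> * psum \<alpha> N"
    proof (rule add_mono)
      show "B * (\<Sum>j=1..N. u j - u (j + n0)) \<le> B * (real n0 * u 0)"
        using B u by (intro mult_left_mono sum_shift_difference_le) auto
      have Cu0: "0 \<le> Cu" using u(1)[of 0] u(3)[of 0] by simp
      have "u M \<le> Cu * real (Suc M) powr (- \<alpha>)" by (rule u)
      also have "\<dots> \<le> Cu * real M powr (- \<alpha>)"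
        using Cu0 a M n0 by (intro mult_left_mono powr_mono2') auto
      also have "real M powr (- \<alpha>) = real R powr (- \<alpha>) * real N powr (- \<alpha>)"
        by (simp add: M_def powr_mult)
      finally have "B * (real N * u M) \<le> B * (real N * (Cu * (real R powr (- \<alpha>) * real N powr (- \<alpha>))))"
        using B by (intro mult_left_mono) auto
      also have "\<dots> = (B * Cu * real R powr (- \<alpha>)) * (real N * real N powr (- \<alpha>))" by simp
      also have "\<dots> \<le> \<eta> * psum \<alpha> N"
        using R \<eta> psum_ge_powr[of \<alpha> N] a by (intro mult_mono) auto
      finally show "B * (real N * u M) \<le> \<eta> * psum \<alpha> N" .
    qed
    finally have 1: "(\<Sum>j=1..N. \<bar>E j\<bar>) \<le> B * (real n0 * u 0) + \<eta> * psum \<alpha> N" .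
    define F where "F p j i = D p j i - s p i * b p (j + i)" for p j i
    have 2: "\<bar>\<Sum>j=1..N. \<Sum>i\<in>{n0..<M}. \<Sum>p\<in>P. F p j i\<bar> \<le> \<eta> * psum \<alpha> N + C1"
    proof -
      have "\<bar>\<Sum>j=1..N. \<Sum>i\<in>{n0..<M}. \<Sum>p\<in>P. F p j i\<bar> \<le> (\<Sum>j=1..N. \<Sum>i\<in>{n0..<M}. \<Sum>p\<in>P. \<bar>F p j i\<bar>)"
        by (intro order_trans[OF sum_abs] sum_mono order_refl)
      also have "\<dots> = (\<Sum>j=1..N. \<Sum>p\<in>P. \<Sum>i\<in>{n0..<M}. \<bar>F p j i\<bar>)"
        by (intro sum.cong refl sum.swap)
      also have "\<dots> = (\<Sum>p\<in>P. e1 p N)"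
        unfolding e1_def M_def F_def by (rule sum.swap)
      finally show ?thesis using C1[of N] by linarith
    qed
    have bsum: "(\<Sum>j=1..N. b p (j + i)) = t p i - t p (i + N)" if "p \<in> P" "n0 \<le> i" for p i
    proof (induction N)
      case (Suc N)
      then show ?case using b[OF that(1), of "i + N"] that(2) by (simp add: add.commute)
    qed simp
    have 3: "(\<Sum>j=1..N. \<Sum>i\<in>{n0..<M}. \<Sum>p\<in>P. s p i * b p (j + i))
        = (\<Sum>i<M. (1 - \<rho> N i) * S i) - (\<Sum>p\<in>P. \<Sum>i\<in>{n0..<M}. s p i * (t p (i + N) - t p i * \<rho> N i))"
    proof -
      have "(\<Sum>j=1..N. \<Sum>i\<in>{n0..<M}. \<Sum>p\<in>P. s p i * b p (j + i)) = (\<Sum>i\<in>{n0..<M}. \<Sum>p\<in>P. \<Sum>j=1..N. s p i * b p (j + i))"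
        by (subst sum.swap) (intro sum.cong refl sum.swap)
      also have "\<dots> = (\<Sum>i\<in>{n0..<M}. \<Sum>p\<in>P. s p i * (t p i - t p (i + N)))"
        unfolding sum_distrib_left[symmetric] by (intro sum.cong refl) (simp only: bsum atLeastLessThan_iff)
      \<comment> \<open>\<open>t p (i + N)\<close> is written as \<open>\<rho> N i * t p i\<close>
        plus an error. The weight \<open>1 - \<rho> N i\<close> is common to all \<open>p\<close>,
        so the main terms combine into \<open>S i\<close>.\<close>
      also have "\<dots> = (\<Sum>i\<in>{n0..<M}. \<Sum>p\<in>P. (1 - \<rho> N i) * (s p i * t p i) - s p i * (t p (i + N) - t p i * \<rho> N i))"
        by (intro sum.cong refl) (simp add: algebra_simps)
      also have "\<dots> = (\<Sum>i\<in>{n0..<M}. (1 - \<rho> N i) * S i) - (\<Sum>i\<in>{n0..<M}. \<Sum>p\<in>P. s p i * (t p (i + N) - t p i * \<rho> N i))"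
        by (simp add: sum_subtractf sum_distrib_left S_def)
      also have "(\<Sum>i\<in>{n0..<M}. (1 - \<rho> N i) * S i) = (\<Sum>i<M. (1 - \<rho> N i) * S i)"
        by (rule sum.mono_neutral_left) (auto simp: S_def)
      also have "(\<Sum>i\<in>{n0..<M}. \<Sum>p\<in>P. s p i * (t p (i + N) - t p i * \<rho> N i)) = (\<Sum>p\<in>P. \<Sum>i\<in>{n0..<M}. s p i * (t p (i + N) - t p i * \<rho> N i))"
        by (rule sum.swap)
      finally show ?thesis .
    qed
    have 4: "\<bar>\<Sum>p\<in>P. \<Sum>i\<in>{n0..<M}. s p i * (t p (i + N) - t p i * \<rho> N i)\<bar> \<le> \<eta> * psum \<alpha> N + C2"
    proof -
      have "\<bar>\<Sum>p\<in>P. \<Sum>i\<in>{n0..<M}. s p i * (t p (i + N) - t p i * \<rho> N i)\<bar> \<le> (\<Sum>p\<in>P. \<Sum>i\<in>{n0..<M}. \<bar>s p i * (t p (i + N) - t p i * \<rho> N i)\<bar>)"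
        by (intro order_trans[OF sum_abs] sum_mono order_refl)
      also have "\<dots> \<le> (\<Sum>p\<in>P. \<Sum>i\<in>{n0..<M}. B * \<bar>t p (i + N) - t p i * \<rho> N i\<bar>)"
        unfolding abs_mult by (intro sum_mono mult_right_mono s) auto
      also have "\<dots> \<le> (\<Sum>p\<in>P. \<Sum>i<M. B * \<bar>t p (i + N) - t p i * \<rho> N i\<bar>)"
        using B by (intro sum_mono sum_mono2) auto
      also have "\<dots> = (\<Sum>p\<in>P. e2 p N)" unfolding e2_def M_def by (simp only: sum_distrib_left)
      finally show ?thesis using C2[of N] by linarith
    qed
    have "(\<Sum>j=1..N. G j) = (\<Sum>j=1..N. E j + ((\<Sum>i\<in>{n0..<M}. \<Sum>p\<in>P. F p j i) + (\<Sum>i\<in>{n0..<M}. \<Sum>p\<in>P. s p i * b p (j + i))))"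
      unfolding E_def F_def sum.distrib[symmetric] by (intro sum.cong) auto
    also have "\<dots> = (\<Sum>j=1..N. E j) + (\<Sum>j=1..N. \<Sum>i\<in>{n0..<M}. \<Sum>p\<in>P. F p j i) + (\<Sum>j=1..N. \<Sum>i\<in>{n0..<M}. \<Sum>p\<in>P. s p i * b p (j + i))"
      by (simp only: sum.distrib add.assoc)
    finally have "\<bar>\<Sum>j=1..N. G j\<bar> \<le> (B * (real n0 * u 0) + \<eta> * psum \<alpha> N) + (\<eta> * psum \<alpha> N + C1) + ((\<eta> * psum \<alpha> N + C3) + (\<eta> * psum \<alpha> N + C2))"
      unfolding 3 using 1 2 4 C3[of N, folded M_def] sum_abs[of E "{1..N}"] by linarith
    also have "\<dots> = 4 * \<eta> * psum \<alpha> N + (B * (real n0 * u 0) + C1 + C2 + C3)" by simp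
    finally show ?thesis by (simp add: \<eta>_def)
  qed
  \<comment> \<open>The estimates hold for j \<ge> 1; the value at 0 goes into the constant.\<close>
  have "\<bar>\<Sum>j<N. G j\<bar> \<le> \<delta> * psum \<alpha> N + (\<bar>G 0\<bar> + \<bar>B * (real n0 * u 0) + C1 + C2 + C3\<bar>)" for N
  proof (cases "N \<le> 1")
    case True
    then have "N = 0 \<or> N = 1" by auto
    then have "\<bar>\<Sum>j<N. G j\<bar> \<le> \<bar>G 0\<bar>" by auto
    moreover have "0 \<le> \<delta> * psum \<alpha> N" using \<delta> psum_nonneg by simp
    ultimately show ?thesis by linarith
  next
    case False
    have "{..<N} = insert 0 {1..N - 1}" using False by auto
    then have "(\<Sum>j<N. G j) = G 0 + (\<Sum>j=1..N - 1. G j)" by simp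
    moreover have "\<bar>\<Sum>j=1..N - 1. G j\<bar> \<le> \<delta> * psum \<alpha> (N - 1) + (B * (real n0 * u 0) + C1 + C2 + C3)"
      using main[of "N - 1"] False by simp
    moreover have "\<delta> * psum \<alpha> (N - 1) \<le> \<delta> * psum \<alpha> N"
      using \<delta> psum_mono[of "N - 1" N \<alpha>] by simp
    ultimately show ?thesis by linarith
  qed
  then show ?thesis by blast
qed


section \<open>Correlations of functions of mean zero under exact maps\<close>

text \<open>Integrates the pointwise inequality |y| \<le> y^2/\<eta> + \<eta>. It takes the place of
  Cauchy-Schwarz: a square integral of order \<eta>^2 yields an L^1 norm of order \<eta>.\<close>

lemma (in prob_space) integral_abs_le_square:
  fixes C :: real
  assumes [measurable]: "h \<in> borel_measurable M" and bd: "AE x in M. \<bar>h x\<bar> \<le> C" and \<eta>: "0 < \<eta>"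
  shows "(\<integral>x. \<bar>h x\<bar> \<partial>M) \<le> (\<integral>x. (h x)\<^sup>2 \<partial>M) / \<eta> + \<eta>"
proof -
  have ih: "integrable M h" using bd by (intro integrable_const_bound[of _ C]) auto
  have ih2: "integrable M (\<lambda>x. (h x)\<^sup>2)"
    using bd by (intro integrable_const_bound[of _ "C\<^sup>2"]) (auto simp: abs_le_square_iff[symmetric] elim!: eventually_mono)
  have "\<bar>y\<bar> \<le> y\<^sup>2 / \<eta> + \<eta>" for y :: real
  proof (cases "\<bar>y\<bar> \<le> \<eta>")
    case True
    moreover have "0 \<le> y\<^sup>2 / \<eta>" using \<eta> by simp
    ultimately show ?thesis by linarith
  next
    case False
    then have "\<bar>y\<bar> * \<eta> \<le> \<bar>y\<bar> * \<bar>y\<bar>" by (intro mult_left_mono) auto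
    then have "\<bar>y\<bar> \<le> y\<^sup>2 / \<eta>" using \<eta> by (simp add: field_simps power2_eq_square)
    then show ?thesis using \<eta> by linarith
  qed
  then have "(\<integral>x. \<bar>h x\<bar> \<partial>M) \<le> (\<integral>x. (h x)\<^sup>2 / \<eta> + \<eta> \<partial>M)"
    using ih ih2 by (intro integral_mono) auto
  also have "\<dots> = (\<integral>x. (h x)\<^sup>2 \<partial>M) / \<eta> + \<eta>"
    using ih2 by (subst Bochner_Integration.integral_add) (auto simp: prob_space)
  finally show ?thesis .
qed

text \<open>The sum of the absolute increments has finite integral, so it is finite almost
  everywhere, and the sequence is a telescoping series.\<close>

lemma AE_convergent_if_summable_L1:
  fixes X :: "nat \<Rightarrow> 'a \<Rightarrow> real"
  assumes int: "\<And>k. integrable M (X k)" and summ: "summable (\<lambda>k. \<integral>x. \<bar>X (Suc k) x - X k x\<bar> \<partial>M)"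
  shows "AE x in M. convergent (\<lambda>k. X k x)"
proof -
  have [measurable]: "X k \<in> borel_measurable M" for k using int[of k] by auto
  have "(\<integral>\<^sup>+x. (\<Sum>k. ennreal \<bar>X (Suc k) x - X k x\<bar>) \<partial>M) = (\<Sum>k. \<integral>\<^sup>+x. ennreal \<bar>X (Suc k) x - X k x\<bar> \<partial>M)"
    by (intro nn_integral_suminf) measurable
  also have "\<dots> = (\<Sum>k. ennreal (\<integral>x. \<bar>X (Suc k) x - X k x\<bar> \<partial>M))"
    by (intro suminf_cong nn_integral_eq_integral) (use int in auto)
  also have "\<dots> = ennreal (\<Sum>k. \<integral>x. \<bar>X (Suc k) x - X k x\<bar> \<partial>M)"
    by (intro suminf_ennreal2 summ) auto
  finally have "(\<integral>\<^sup>+x. (\<Sum>k. ennreal \<bar>X (Suc k) x - X k x\<bar>) \<partial>M) \<noteq> \<infinity>" by simp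
  then have "AE x in M. (\<Sum>k. ennreal \<bar>X (Suc k) x - X k x\<bar>) \<noteq> \<infinity>"
    by (intro nn_integral_PInf_AE) auto
  then show ?thesis
  proof eventually_elim
    case (elim x)
    have "summable (\<lambda>k. \<bar>X (Suc k) x - X k x\<bar>)"
      by (intro summable_suminf_not_top) (use elim in auto)
    then have "summable (\<lambda>k. X (Suc k) x - X k x)" by (rule summable_rabs_cancel)
    then have "convergent (\<lambda>n. \<Sum>k<n. X (Suc k) x - X k x)" by (simp add: summable_iff_convergent)
    then obtain y where "(\<lambda>n. \<Sum>k<n. X (Suc k) x - X k x) \<longlonglongrightarrow> y" by (auto simp: convergent_def)
    then have "(\<lambda>n. X n x - X 0 x) \<longlonglongrightarrow> y"
      by (subst (asm) sum_lessThan_telescope)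
    from tendsto_add[OF this tendsto_const[of "X 0 x"]] show ?case by (auto simp: convergent_def)
  qed
qed

text \<open>By orthogonality the conditional expectations are Cauchy in the square norm; the limit is
  measurable with respect to the trivial intersection, hence constant and equal to the mean.\<close>

lemma (in prob_space) decreasing_cond_exp_null:
  assumes sub: "\<And>n. subalgebra M (F n)" and dec: "\<And>n m. n \<le> m \<Longrightarrow> sets (F m) \<subseteq> sets (F n)"
    and triv: "\<And>A. (\<And>n. A \<in> sets (F n)) \<Longrightarrow> prob A = 0 \<or> prob A = 1"
    and [measurable]: "\<phi> \<in> borel_measurable M" and bd: "\<And>x. \<bar>\<phi> x\<bar> \<le> C" and mean: "(\<integral>x. \<phi> x \<partial>M) = 0"
  shows "(\<lambda>n. \<integral>x. \<bar>real_cond_exp M (F n) \<phi> x\<bar> \<partial>M) \<longlonglongrightarrow> 0"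
proof -
  have sfs: "sigma_finite_subalgebra M (F n)" for n
    by (rule finite_measure_subalgebra_is_sigma_finite) (intro finite_measure_subalgebra.intro finite_measure_axioms finite_measure_subalgebra_axioms.intro sub)
  define E where "E n = real_cond_exp M (F n) \<phi>" for n
  have [measurable]: "E n \<in> borel_measurable M" for n by (simp add: E_def)
  have EF: "E m \<in> borel_measurable (F n)" if "n \<le> m" for n m
  proof -
    have "E m \<in> borel_measurable (F m)" by (simp add: E_def borel_measurable_cond_exp)
    moreover have "space (F m) = space (F n)" using sub by (auto simp: subalgebra_def)
    ultimately show ?thesis using dec[OF that] by (auto simp: measurable_def)
  qed
  have i\<phi>: "integrable M \<phi>" using bd by (intro integrable_const_bound[of _ C]) auto
  have bE: "AE x in M. \<bar>E n x\<bar> \<le> C" for n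
  proof -
    have "AE x in M. E n x \<ge> - C" unfolding E_def
      by (rule sigma_finite_subalgebra.real_cond_exp_ge_c[OF sfs i\<phi>]) (use bd in \<open>auto simp: abs_le_iff minus_le_iff\<close>)
    moreover have "AE x in M. E n x \<le> C" unfolding E_def
      by (rule sigma_finite_subalgebra.real_cond_exp_le_c[OF sfs i\<phi>]) (use bd in \<open>auto simp: abs_le_iff\<close>)
    ultimately show ?thesis by eventually_elim auto
  qed
  have iE: "integrable M (E n)" for n using bE by (intro integrable_const_bound[of _ C]) auto
  have bEE: "AE x in M. \<bar>E n x * E m x\<bar> \<le> C * C" for n m
    using bE[of n] bE[of m] by eventually_elim (auto simp: abs_mult intro: mult_mono)
  have iEE: "integrable M (\<lambda>x. E n x * E m x)" for n m
    using bEE by (intro integrable_const_bound[of _ "C * C"]) auto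
  \<comment> \<open>\<open>E m\<close> is measurable with respect to the larger algebra
    \<open>F n\<close> and can be moved out of the conditional expectation on \<open>F n\<close>.
    This orthogonality turns squared distances into differences of squared norms.\<close>
  have proj: "(\<integral>x. E m x * E n x \<partial>M) = (\<integral>x. E m x * \<phi> x \<partial>M)" if "n \<le> m" for n m
  proof -
    have "AE x in M. \<bar>E m x * \<phi> x\<bar> \<le> C * C"
      using bE[of m] by eventually_elim (use bd in \<open>auto simp: abs_mult intro: mult_mono\<close>)
    then have "integrable M (\<lambda>x. E m x * \<phi> x)" by (intro integrable_const_bound[of _ "C * C"]) auto
    from sigma_finite_subalgebra.real_cond_exp_intg(2)[OF sfs this EF[OF that]]
    show ?thesis by (simp add: E_def[of n])
  qed
  define a where "a n = (\<integral>x. (E n x)\<^sup>2 \<partial>M)" for n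
  have a0: "0 \<le> a n" for n by (simp add: a_def)
  have diff: "(\<integral>x. (E m x - E n x)\<^sup>2 \<partial>M) = a n - a m" if "n \<le> m" for n m
  proof -
    have "(\<integral>x. (E m x - E n x)\<^sup>2 \<partial>M) = (\<integral>x. E m x * E m x - 2 * (E m x * E n x) + E n x * E n x \<partial>M)"
      by (intro Bochner_Integration.integral_cong) (auto simp: power2_eq_square algebra_simps)
    also have "\<dots> = (\<integral>x. E m x * E m x \<partial>M) - 2 * (\<integral>x. E m x * E n x \<partial>M) + (\<integral>x. E n x * E n x \<partial>M)"
      using iEE by simp
    finally show ?thesis using proj[OF that] proj[of m m] by (simp add: a_def power2_eq_square)
  qed
  have adec: "a m \<le> a n" if "n \<le> m" for n m
  proof -
    have "0 \<le> (\<integral>x. (E m x - E n x)\<^sup>2 \<partial>M)" by simp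
    with diff[OF that] show ?thesis by simp
  qed
  have "decseq a" using adec by (auto simp: decseq_def)
  then obtain l where l: "a \<longlonglongrightarrow> l" using decseq_convergent[of a 0] a0 by blast
  have la: "l \<le> a n" for n using \<open>decseq a\<close> l by (rule decseq_ge)
  \<comment> \<open>Closeness of order 4^(-k) in the square norm gives L^1 increments of order
    2^(-k), by the choice \<eta> = 2^(-k), and these are summable.\<close>
  have "\<exists>r. strict_mono r \<and> (\<forall>k. a (r k) < l + (1/4) ^ k)"
  proof -
    have "\<exists>n>m. a n < l + (1/4) ^ k" for m k
    proof -
      have "eventually (\<lambda>n. a n < l + (1/4) ^ k \<and> m < n) sequentially"
        by (intro eventually_conj order_tendstoD(2)[OF l] eventually_gt_at_top) auto
      then show ?thesis using eventually_happens by fastforce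
    qed
    then obtain nx where nx: "\<And>m k. m < nx m k" "\<And>m k. a (nx m k) < l + (1/4) ^ k" by metis
    define r where "r = rec_nat (nx 0 0) (\<lambda>k m. nx m (Suc k))"
    have "a (r k) < l + (1/4) ^ k" for k
    proof (cases k)
      case 0
      show ?thesis using nx(2)[of 0 0] by (simp add: r_def 0)
    next
      case (Suc j)
      show ?thesis using nx(2)[of "r j" "Suc j"] by (simp add: r_def Suc)
    qed
    moreover have "strict_mono r" by (rule strict_monoI_Suc) (simp add: r_def nx)
    ultimately show ?thesis by blast
  qed
  then obtain r where r: "strict_mono r" "\<And>k. a (r k) < l + (1/4) ^ k" by blast
  have L1: "(\<integral>x. \<bar>E (r (Suc k)) x - E (r k) x\<bar> \<partial>M) \<le> 2 * (1/2) ^ k" for k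
  proof -
    have "(\<integral>x. (E (r (Suc k)) x - E (r k) x)\<^sup>2 \<partial>M) = a (r k) - a (r (Suc k))"
      by (rule diff) (use r in \<open>auto simp: strict_mono_less_eq\<close>)
    also have "\<dots> \<le> (1/4) ^ k" using r(2)[of k] la[of "r (Suc k)"] by linarith
    finally have 1: "(\<integral>x. (E (r (Suc k)) x - E (r k) x)\<^sup>2 \<partial>M) \<le> (1/4) ^ k" .
    have "AE x in M. \<bar>E (r (Suc k)) x - E (r k) x\<bar> \<le> 2 * C"
      using bE[of "r k"] bE[of "r (Suc k)"] by eventually_elim linarith
    then have "(\<integral>x. \<bar>E (r (Suc k)) x - E (r k) x\<bar> \<partial>M) \<le> (\<integral>x. (E (r (Suc k)) x - E (r k) x)\<^sup>2 \<partial>M) / (1/2) ^ k + (1/2) ^ k"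
      by (intro integral_abs_le_square) auto
    also have "\<dots> \<le> (1/4) ^ k / (1/2) ^ k + (1/2) ^ k"
      using 1 by (intro add_right_mono divide_right_mono) auto
    also have "\<dots> = 2 * (1/2) ^ k" by (simp add: power_divide[symmetric])
    finally show ?thesis .
  qed
  have "summable (\<lambda>k. \<integral>x. \<bar>E (r (Suc k)) x - E (r k) x\<bar> \<partial>M)"
  proof (rule summable_comparison_test')
    show "summable (\<lambda>k. 2 * (1/2::real) ^ k)" by (intro summable_mult summable_geometric) simp
  qed (use L1 in simp)
  then have conv: "AE x in M. convergent (\<lambda>k. E (r k) x)"
    by (rule AE_convergent_if_summable_L1[rotated]) (rule iE)
  \<comment> \<open>A limsup is defined everywhere and ignores finitely many terms, so
    \<open>Z\<close> is measurable for every \<open>F m\<close> exactly, not just up to null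
    sets.\<close>
  define Z where "Z x = limsup (\<lambda>k. ereal (E (r k) x))" for x
  have Z: "Z \<in> borel_measurable (F m)" for m
  proof -
    have "Z x = limsup (\<lambda>k. ereal (E (r (k + m)) x))" for x
      unfolding Z_def by (rule limsup_shift_k[symmetric])
    moreover have "E (r (k + m)) \<in> borel_measurable (F m)" for k
      using r(1) by (intro EF) (meson le_add2 order_trans seq_suble)
    then have "(\<lambda>x. limsup (\<lambda>k. ereal (E (r (k + m)) x))) \<in> borel_measurable (F m)" by measurable
    ultimately show ?thesis by (simp cong: measurable_cong)
  qed
  have spF: "space (F m) = space M" for m using sub by (auto simp: subalgebra_def)
  \<comment> \<open>This single set suffices: if it is null or conull, \<open>\<psi>\<close> has
    constant sign almost everywhere, and its mean is 0.\<close>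
  define A where "A = {x \<in> space M. Z x \<le> 0}"
  have AF: "A \<in> sets (F m)" for m
  proof -
    note [measurable] = Z[of m]
    have "{x \<in> space (F m). Z x \<le> 0} \<in> sets (F m)" by measurable
    then show ?thesis by (simp add: A_def spF)
  qed
  have AM[measurable]: "A \<in> sets M" using AF sub by (auto simp: subalgebra_def)
  define \<psi> where "\<psi> x = real_of_ereal (Z x)" for x
  have ZM[measurable]: "Z \<in> borel_measurable M"
    using measurable_from_subalg[OF sub Z] .
  have [measurable]: "\<psi> \<in> borel_measurable M" unfolding \<psi>_def by measurable
  have lim\<psi>: "AE x in M. (\<lambda>k. E (r k) x) \<longlonglongrightarrow> \<psi> x \<and> Z x = ereal (\<psi> x)"
    using conv
  proof eventually_elim
    case (elim x)
    then obtain y where y: "(\<lambda>k. E (r k) x) \<longlonglongrightarrow> y" by (auto simp: convergent_def)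
    then have "(\<lambda>k. ereal (E (r k) x)) \<longlonglongrightarrow> ereal y" by simp
    then have "Z x = ereal y" unfolding Z_def by (rule lim_imp_Limsup[rotated]) simp
    with y show ?case by (simp add: \<psi>_def)
  qed
  have "(\<lambda>k. \<integral>x. E (r k) x \<partial>M) \<longlonglongrightarrow> (\<integral>x. \<psi> x \<partial>M)"
    by (rule integral_dominated_convergence[where w = "\<lambda>_. C"]) (use lim\<psi> bE in \<open>auto elim: eventually_mono\<close>)
  moreover have "(\<integral>x. E n x \<partial>M) = 0" for n
    unfolding E_def using sigma_finite_subalgebra.real_cond_exp_int(2)[OF sfs i\<phi>] mean by simp
  ultimately have \<psi>0: "(\<integral>x. \<psi> x \<partial>M) = 0" by (simp add: LIMSEQ_const_iff)
  have b\<psi>: "AE x in M. \<bar>\<psi> x\<bar> \<le> C"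
  proof -
    have "AE x in M. \<forall>k. \<bar>E (r k) x\<bar> \<le> C" using bE by (simp add: AE_all_countable)
    then show ?thesis
      using lim\<psi>
    proof eventually_elim
      case (elim x)
      have "(\<lambda>k. \<bar>E (r k) x\<bar>) \<longlonglongrightarrow> \<bar>\<psi> x\<bar>" using elim(2) by (intro tendsto_rabs) auto
      then show ?case by (rule LIMSEQ_le_const2) (use elim(1) in auto)
    qed
  qed
  have i\<psi>: "integrable M \<psi>" using b\<psi> by (intro integrable_const_bound[of _ C]) auto
  have "AE x in M. \<psi> x = 0"
    using triv[OF AF]
  proof
    assume "prob A = 0"
    then have "AE x in M. x \<notin> A" 
      by (intro AE_not_in null_setsI AM) (simp add: emeasure_eq_measure)
    then have "AE x in M. 0 \<le> \<psi> x"
      using lim\<psi> AE_space by eventually_elim (auto simp: A_def)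
    then show ?thesis using integral_nonneg_eq_0_iff_AE[OF i\<psi>] \<psi>0 by simp
  next
    assume "prob A = 1"
    then have "AE x in M. x \<in> A" by (simp add: prob_eq_1)
    then have "AE x in M. 0 \<le> - \<psi> x"
      using lim\<psi> by eventually_elim (auto simp: A_def)
    then have "AE x in M. - \<psi> x = 0"
      using integral_nonneg_eq_0_iff_AE[of M "\<lambda>x. - \<psi> x"] i\<psi> \<psi>0 by simp
    then show ?thesis by simp
  qed
  \<comment> \<open>The whole sequence \<open>a\<close> converges to \<open>l\<close>, so a null
    subsequence settles its limit.\<close>
  have "(\<lambda>k. \<integral>x. (E (r k) x)\<^sup>2 \<partial>M) \<longlonglongrightarrow> (\<integral>x. 0 \<partial>M)"
  proof (rule integral_dominated_convergence[where w = "\<lambda>_. C * C"])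
    show "AE x in M. (\<lambda>k. (E (r k) x)\<^sup>2) \<longlonglongrightarrow> 0"
      using lim\<psi> \<open>AE x in M. \<psi> x = 0\<close> by eventually_elim (auto intro: tendsto_eq_intros)
    show "AE x in M. norm ((E (r k) x)\<^sup>2) \<le> C * C" for k
      using bEE[of "r k" "r k"] by (simp add: power2_eq_square)
  qed auto
  then have "(\<lambda>k. a (r k)) \<longlonglongrightarrow> 0" by (simp add: a_def)
  moreover have "(\<lambda>k. a (r k)) \<longlonglongrightarrow> l" using LIMSEQ_subseq_LIMSEQ[OF l r(1)] by (simp add: o_def)
  ultimately have "l = 0" using LIMSEQ_unique by blast
  show ?thesis
  proof (rule LIMSEQ_I)
    fix e :: real assume e: "0 < e"
    have "eventually (\<lambda>n. a n < e / 2 * (e / 2)) sequentially"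
      using l e unfolding \<open>l = 0\<close> by (intro order_tendstoD(2)) auto
    then obtain n0 where n0: "\<And>n. n0 \<le> n \<Longrightarrow> a n < e / 2 * (e / 2)" by (auto simp: eventually_sequentially)
    have "norm ((\<integral>x. \<bar>E n x\<bar> \<partial>M) - 0) < e" if "n0 \<le> n" for n
    proof -
      have "(\<integral>x. \<bar>E n x\<bar> \<partial>M) \<le> a n / (e / 2) + e / 2"
        unfolding a_def using bE e by (intro integral_abs_le_square) auto
      also have "a n / (e / 2) < e / 2" using n0[OF that] e by (simp add: field_simps)
      finally show ?thesis by simp
    qed
    then show "\<exists>no. \<forall>n\<ge>no. norm ((\<integral>x. \<bar>real_cond_exp M (F n) \<phi> x\<bar> \<partial>M) - 0) < e"
      by (auto simp: E_def)
  qed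
qed


lemma funpow_measurable [measurable (raw)]:
  "f \<in> measurable M M \<Longrightarrow> (f ^^ n) \<in> measurable M M"
  by (induction n) (auto intro: measurable_comp[unfolded comp_def] simp: comp_def)

text \<open>Conditional expectations are taken under an equivalent probability measure
  \<open>P\<close> with density \<open>h\<close>, where \<open>v\<close> becomes
  \<open>\<phi> = v / h\<close>. Since g o f^n is measurable for \<open>F n\<close>, the correlation
  sees only the conditional expectation of \<open>\<phi>\<close>, and its L^1 norm tends to 0
  because exactness makes the intersection of the \<open>F n\<close> trivial for \<open>P\<close> as
  well.\<close>

lemma exact_correlations_null:
  fixes M :: "'a measure" and v g :: "'a \<Rightarrow> real"
  assumes "sigma_finite_measure M" and nz: "emeasure M (space M) \<noteq> 0"
    and f [measurable]: "f \<in> measurable M M" and ex: "exact_map M f"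
    and v: "integrable M v" "(\<integral>x. v x \<partial>M) = 0"
    and g [measurable]: "g \<in> borel_measurable M" and gB: "\<And>x. \<bar>g x\<bar> \<le> B"
  shows "(\<lambda>n. \<integral>x. v x * g ((f ^^ n) x) \<partial>M) \<longlonglongrightarrow> 0"
proof -
  interpret sigma_finite_measure M by fact
  have [measurable]: "v \<in> borel_measurable M" using v by auto
  obtain h0 :: "'a \<Rightarrow> real" where h0: "h0 \<in> borel_measurable M" "\<And>x. 0 < h0 x" "integrable M h0"
    using obtain_positive_integrable_function by metis
  have "(\<integral>x. h0 x \<partial>M) \<noteq> 0"
  proof
    assume "(\<integral>x. h0 x \<partial>M) = 0"
    then have "AE x in M. h0 x = 0"
      using integral_nonneg_eq_0_iff_AE[OF h0(3)] h0(2) by (simp add: less_imp_le)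
    then have "AE x in M. False" using h0(2) by (auto elim!: eventually_mono simp: less_le)
    then show False using nz by (simp add: AE_iff_null null_sets_def)
  qed
  moreover have "0 \<le> (\<integral>x. h0 x \<partial>M)" using h0(2) by (simp add: less_imp_le)
  ultimately have c: "0 < (\<integral>x. h0 x \<partial>M)" by linarith
  define h where "h x = h0 x / (\<integral>x. h0 x \<partial>M)" for x
  have h [measurable]: "h \<in> borel_measurable M" and hpos: "\<And>x. 0 < h x" and hint: "integrable M h"
    and h1: "(\<integral>x. h x \<partial>M) = 1"
    using h0 c by (auto simp: h_def[abs_def])
  define P where "P = density M (\<lambda>x. ennreal (h x))"
  have [measurable_cong]: "sets P = sets M" by (simp add: P_def)
  have spP: "space P = space M" by (simp add: P_def)
  have "emeasure P (space P) = 1"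
  proof -
    have "emeasure P (space P) = (\<integral>\<^sup>+x. ennreal (h x) \<partial>M)"
      unfolding P_def by (simp add: emeasure_density cong: nn_integral_cong_simp)
    also have "\<dots> = ennreal (\<integral>x. h x \<partial>M)"
      using hint hpos by (intro nn_integral_eq_integral) (auto simp: less_imp_le)
    finally show ?thesis by (simp add: h1)
  qed
  then interpret P: prob_space P by (rule prob_spaceI)
  have Pint: "(\<integral>x. k x \<partial>P) = (\<integral>x. h x * k x \<partial>M)" if "k \<in> borel_measurable M" for k :: "'a \<Rightarrow> real"
    unfolding P_def using that hpos by (subst integral_density) (auto simp: less_imp_le)
  have Pintg: "integrable P k \<longleftrightarrow> integrable M (\<lambda>x. h x * k x)" if "k \<in> borel_measurable M" for k :: "'a \<Rightarrow> real"
    unfolding P_def using that hpos by (subst integrable_density) (auto simp: less_imp_le)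
  have Pnull: "P.prob A = 0" if "A \<in> sets M" "emeasure M A = 0" for A
  proof -
    have "A \<in> null_sets P"
      unfolding P_def using that AE_not_in[of A M] by (subst null_sets_density_iff) (auto simp: null_sets_def elim: eventually_mono)
    then show ?thesis by (simp add: measure_eq_emeasure_eq_ennreal null_setsD1 measure_def)
  qed
  define F where "F n = vimage_algebra (space M) (f ^^ n) M" for n
  have fsp: "(f ^^ n) x \<in> space M" if "x \<in> space M" for n x
    using measurable_space[OF funpow_measurable[OF f] that] .
  have Fsets: "sets (F n) = {(f ^^ n) -` A \<inter> space M | A. A \<in> sets M}" for n
    unfolding F_def using fsp by (intro sets_vimage_algebra2) auto
  have sub: "subalgebra P (F n)" for n
  proof -
    have "sets (F n) \<subseteq> sets M" unfolding Fsets using measurable_sets[OF funpow_measurable[OF f]] by auto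
    then show ?thesis by (simp add: subalgebra_def F_def spP \<open>sets P = sets M\<close>)
  qed
  have dec: "sets (F m) \<subseteq> sets (F n)" if "n \<le> m" for n m
  proof
    fix A assume "A \<in> sets (F m)"
    then obtain S where S: "S \<in> sets M" "A = (f ^^ m) -` S \<inter> space M" by (auto simp: Fsets)
    have "f ^^ m = (f ^^ (m - n)) \<circ> (f ^^ n)" using that by (simp add: funpow_add[symmetric])
    then have "A = (f ^^ n) -` ((f ^^ (m - n)) -` S \<inter> space M) \<inter> space M"
      using S(2) fsp by auto
    moreover have "(f ^^ (m - n)) -` S \<inter> space M \<in> sets M" using S(1) by measurable
    ultimately show "A \<in> sets (F n)" unfolding Fsets by blast
  qed
  have triv: "P.prob A = 0 \<or> P.prob A = 1" if A: "\<And>n. A \<in> sets (F n)" for A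
  proof -
    have AM: "A \<in> sets M" using A[of 0] sub[of 0] by (auto simp: subalgebra_def \<open>sets P = sets M\<close>)
    have "\<forall>n. \<exists>C\<in>sets M. A = (f ^^ n) -` C \<inter> space M" using A unfolding Fsets by blast
    then have "emeasure M A = 0 \<or> emeasure M (space M - A) = 0" using ex unfolding exact_map_def by blast
    then show ?thesis
    proof
      assume "emeasure M (space M - A) = 0"
      then have "P.prob (space M - A) = 0" using AM by (intro Pnull) auto
      then show ?thesis using P.prob_compl[of A] AM by (simp add: spP \<open>sets P = sets M\<close>)
    qed (use Pnull[OF AM] in simp)
  qed
  have gF: "(\<lambda>x. g ((f ^^ n) x)) \<in> borel_measurable (F n)" for n
  proof -
    have "(f ^^ n) \<in> measurable (F n) M"
      unfolding F_def using fsp by (intro measurable_vimage_algebra1) auto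
    then show ?thesis using g by (rule measurable_compose)
  qed
  have B: "0 \<le> B" by (rule order_trans[OF abs_ge_zero]) (rule gB[of undefined])
  have bounded_case: "(\<lambda>n. \<integral>x. \<phi> x * g ((f ^^ n) x) \<partial>P) \<longlonglongrightarrow> 0"
    if [measurable]: "\<phi> \<in> borel_measurable M" and \<phi>: "\<And>x. \<bar>\<phi> x\<bar> \<le> C" "(\<integral>x. \<phi> x \<partial>P) = 0" for \<phi> C
  proof -
    have i\<phi>: "integrable P \<phi>" using \<phi> by (intro P.integrable_const_bound[of _ C]) auto
    have "(\<lambda>n. \<integral>x. \<bar>real_cond_exp P (F n) \<phi> x\<bar> \<partial>P) \<longlonglongrightarrow> 0"
      using \<phi> by (intro P.decreasing_cond_exp_null[OF sub dec triv]) auto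
    then have lim: "(\<lambda>n. B * (\<integral>x. \<bar>real_cond_exp P (F n) \<phi> x\<bar> \<partial>P)) \<longlonglongrightarrow> 0" by (rule tendsto_mult_right_zero)
    have "norm (\<integral>x. \<phi> x * g ((f ^^ n) x) \<partial>P) \<le> B * (\<integral>x. \<bar>real_cond_exp P (F n) \<phi> x\<bar> \<partial>P)" for n
    proof -
      have sfs: "sigma_finite_subalgebra P (F n)"
        by (rule finite_measure_subalgebra_is_sigma_finite) (intro finite_measure_subalgebra.intro P.finite_measure_axioms finite_measure_subalgebra_axioms.intro sub)
      have iE: "integrable P (real_cond_exp P (F n) \<phi>)"
        using sigma_finite_subalgebra.real_cond_exp_int(1)[OF sfs i\<phi>] .
      have "integrable P (\<lambda>x. g ((f ^^ n) x) * \<phi> x)"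
        using \<phi>(1) gB B by (intro P.integrable_const_bound[of _ "B * C"]) (auto simp: abs_mult intro!: mult_mono)
      moreover have "\<phi> \<in> borel_measurable P" by measurable
      ultimately have eq: "integrable P (\<lambda>x. g ((f ^^ n) x) * real_cond_exp P (F n) \<phi> x)"
        "(\<integral>x. g ((f ^^ n) x) * real_cond_exp P (F n) \<phi> x \<partial>P) = (\<integral>x. g ((f ^^ n) x) * \<phi> x \<partial>P)"
        using sigma_finite_subalgebra.real_cond_exp_intg[OF sfs _ gF] by blast+
      have "(\<integral>x. \<phi> x * g ((f ^^ n) x) \<partial>P) = (\<integral>x. g ((f ^^ n) x) * real_cond_exp P (F n) \<phi> x \<partial>P)"
        using eq(2) by (simp add: mult.commute)
      also have "norm \<dots> \<le> (\<integral>x. norm (g ((f ^^ n) x) * real_cond_exp P (F n) \<phi> x) \<partial>P)"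
        by (rule integral_norm_bound)
      also have "\<dots> \<le> (\<integral>x. B * \<bar>real_cond_exp P (F n) \<phi> x\<bar> \<partial>P)"
      proof (rule integral_mono)
        show "integrable P (\<lambda>x. norm (g ((f ^^ n) x) * real_cond_exp P (F n) \<phi> x))"
          using eq(1) by (rule integrable_norm)
        show "norm (g ((f ^^ n) x) * real_cond_exp P (F n) \<phi> x) \<le> B * \<bar>real_cond_exp P (F n) \<phi> x\<bar>" for x
          using gB by (simp add: abs_mult mult_right_mono)
      qed (use iE in simp)
      finally show ?thesis by simp
    qed
    then show ?thesis using lim by (intro Lim_null_comparison[OF _ lim]) auto
  qed
  define \<phi> where "\<phi> x = v x / h x" for x
  have [measurable]: "\<phi> \<in> borel_measurable M" unfolding \<phi>_def by measurable
  have h\<phi>: "h x * \<phi> x = v x" for x using hpos[of x] by (simp add: \<phi>_def)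
  have i\<phi>: "integrable P \<phi>" using v by (subst Pintg) (auto simp: h\<phi>)
  have mean: "(\<integral>x. \<phi> x \<partial>P) = 0" using v by (subst Pint) (auto simp: h\<phi>)
  \<comment> \<open>The truncation is bounded but no longer centred. Its mean \<open>m\<close> is
    subtracted; \<open>\<bar>m\<bar>\<close> is at most the L^1 error of the truncation because
    \<open>\<phi>\<close> has mean 0.\<close>
  define tr where "tr k x = max (- real k) (min (real k) (\<phi> x))" for k x
  have [measurable]: "tr k \<in> borel_measurable M" for k unfolding tr_def by measurable
  have tr_le: "\<bar>tr k x\<bar> \<le> \<bar>\<phi> x\<bar>" "\<bar>tr k x\<bar> \<le> real k" for k x by (auto simp: tr_def)
  have itr: "integrable P (tr k)" for k using tr_le by (intro P.integrable_const_bound[of _ "real k"]) auto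
  have tr_lim: "(\<lambda>k. tr k x) \<longlonglongrightarrow> \<phi> x" for x
  proof (rule tendsto_eventually)
    have "eventually (\<lambda>k. nat \<lceil>\<bar>\<phi> x\<bar>\<rceil> \<le> k) sequentially" by (rule eventually_ge_at_top)
    then show "eventually (\<lambda>k. tr k x = \<phi> x) sequentially"
    proof eventually_elim
      case (elim k)
      then have "\<bar>\<phi> x\<bar> \<le> real k" by linarith
      then show ?case by (auto simp: tr_def)
    qed
  qed
  have L1: "(\<lambda>k. \<integral>x. \<bar>tr k x - \<phi> x\<bar> \<partial>P) \<longlonglongrightarrow> (\<integral>x. 0 \<partial>P)"
  proof (rule integral_dominated_convergence[where w = "\<lambda>x. 2 * \<bar>\<phi> x\<bar>"])
    show "AE x in P. (\<lambda>k. \<bar>tr k x - \<phi> x\<bar>) \<longlonglongrightarrow> 0"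
      using tr_lim by (auto intro!: tendsto_rabs_zero simp: LIM_zero_iff)
    show "AE x in P. norm \<bar>tr k x - \<phi> x\<bar> \<le> 2 * \<bar>\<phi> x\<bar>" for k
      using tr_le(1)[of k] by (intro AE_I2) (smt (verit) real_norm_def)
  qed (use i\<phi> in auto)
  show ?thesis
  proof (rule LIMSEQ_I)
    fix e :: real assume e: "0 < e"
    \<comment> \<open>Truncation and recentring each contribute this much times \<open>B\<close>;
      adding 1 avoids division by zero.\<close>
    have "0 < e / (4 * (B + 1))" using e B by simp
    then have "eventually (\<lambda>k. (\<integral>x. \<bar>tr k x - \<phi> x\<bar> \<partial>P) < e / (4 * (B + 1))) sequentially"
      using L1 by (intro order_tendstoD(2)[of _ 0]) auto
    then obtain k where k: "(\<integral>x. \<bar>tr k x - \<phi> x\<bar> \<partial>P) < e / (4 * (B + 1))"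
      using eventually_happens by fastforce
    define m where "m = (\<integral>x. tr k x \<partial>P)"
    have m: "\<bar>m\<bar> \<le> (\<integral>x. \<bar>tr k x - \<phi> x\<bar> \<partial>P)"
    proof -
      have "m = (\<integral>x. tr k x - \<phi> x \<partial>P)" using itr i\<phi> mean by (simp add: m_def)
      also have "\<bar>\<dots>\<bar> \<le> (\<integral>x. \<bar>tr k x - \<phi> x\<bar> \<partial>P)" using integral_norm_bound[of P "\<lambda>x. tr k x - \<phi> x"] by simp
      finally show ?thesis .
    qed
    have "(\<lambda>n. \<integral>x. (tr k x - m) * g ((f ^^ n) x) \<partial>P) \<longlonglongrightarrow> 0"
    proof (rule bounded_case)
      show "\<bar>tr k x - m\<bar> \<le> real k + \<bar>m\<bar>" for x using tr_le(2)[of k x] by linarith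
      show "(\<integral>x. tr k x - m \<partial>P) = 0" using itr P.prob_space by (simp add: m_def)
    qed auto
    then obtain N where N: "\<And>n. N \<le> n \<Longrightarrow> \<bar>\<integral>x. (tr k x - m) * g ((f ^^ n) x) \<partial>P\<bar> < e / 2"
      using LIMSEQ_D[of _ 0 "e / 2"] e by force
    have "norm ((\<integral>x. v x * g ((f ^^ n) x) \<partial>M) - 0) < e" if n: "N \<le> n" for n
    proof -
      have ib: "integrable P (\<lambda>x. w x * g ((f ^^ n) x))" if "integrable P w" for w
      proof (rule Bochner_Integration.integrable_bound)
        show "integrable P (\<lambda>x. B * w x)" using that by simp
        have [measurable]: "w \<in> borel_measurable P" using that by auto
        show "(\<lambda>x. w x * g ((f ^^ n) x)) \<in> borel_measurable P" by measurable
        show "AE x in P. norm (w x * g ((f ^^ n) x)) \<le> norm (B * w x)"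
          using gB B by (intro AE_I2) (simp add: abs_mult mult.commute[of B] mult_left_mono)
      qed
      have i1: "integrable P (\<lambda>x. tr k x - m)" using itr by auto
      have i2: "integrable P (\<lambda>x. \<phi> x - tr k x + m)" using itr i\<phi> by auto
      have "(\<integral>x. v x * g ((f ^^ n) x) \<partial>M) = (\<integral>x. \<phi> x * g ((f ^^ n) x) \<partial>P)"
        by (subst Pint) (auto simp: mult.assoc[symmetric] h\<phi>)
      also have "\<dots> = (\<integral>x. (tr k x - m) * g ((f ^^ n) x) + (\<phi> x - tr k x + m) * g ((f ^^ n) x) \<partial>P)"
        by (simp add: algebra_simps)
      also have "\<dots> = (\<integral>x. (tr k x - m) * g ((f ^^ n) x) \<partial>P) + (\<integral>x. (\<phi> x - tr k x + m) * g ((f ^^ n) x) \<partial>P)"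
        by (intro Bochner_Integration.integral_add ib i1 i2)
      finally have eq: "(\<integral>x. v x * g ((f ^^ n) x) \<partial>M) = \<dots>" .
      have "\<bar>\<integral>x. (\<phi> x - tr k x + m) * g ((f ^^ n) x) \<partial>P\<bar> \<le> (\<integral>x. \<bar>(\<phi> x - tr k x + m) * g ((f ^^ n) x)\<bar> \<partial>P)"
        using integral_norm_bound[of P "\<lambda>x. (\<phi> x - tr k x + m) * g ((f ^^ n) x)"] by simp
      also have "\<dots> \<le> (\<integral>x. B * (\<bar>tr k x - \<phi> x\<bar> + \<bar>m\<bar>) \<partial>P)"
      proof (rule integral_mono)
        show "integrable P (\<lambda>x. \<bar>(\<phi> x - tr k x + m) * g ((f ^^ n) x)\<bar>)" using ib[OF i2] by simp
        show "integrable P (\<lambda>x. B * (\<bar>tr k x - \<phi> x\<bar> + \<bar>m\<bar>))" using itr i\<phi> by auto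
        fix x
        have "\<bar>\<phi> x - tr k x + m\<bar> * \<bar>g ((f ^^ n) x)\<bar> \<le> (\<bar>tr k x - \<phi> x\<bar> + \<bar>m\<bar>) * B"
          using gB by (intro mult_mono) auto
        then show "\<bar>(\<phi> x - tr k x + m) * g ((f ^^ n) x)\<bar> \<le> B * (\<bar>tr k x - \<phi> x\<bar> + \<bar>m\<bar>)"
          by (simp add: abs_mult mult.commute)
      qed
      also have "\<dots> = B * ((\<integral>x. \<bar>tr k x - \<phi> x\<bar> \<partial>P) + \<bar>m\<bar>)"
        using itr i\<phi> P.prob_space by simp
      also have "\<dots> \<le> B * (2 * (e / (4 * (B + 1))))"
        using m k B by (intro mult_left_mono) auto
      also have "\<dots> \<le> e / 2" using B e by (simp add: field_simps)
      finally show ?thesis unfolding eq using N[OF n] by simp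
    qed
    then show "\<exists>no. \<forall>n\<ge>no. norm ((\<integral>x. v x * g ((f ^^ n) x) \<partial>M) - 0) < e" by blast
  qed
qed


section \<open>Excursions from \<open>Y\<close>\<close>

text \<open>A nonempty infimum in the well-ordered extended naturals is attained, and the empty one
  is infinite, so infima of \<open>enat\<close> can be avoided from here on.\<close>

lemma return_time_eq_enat_iff:
  "return_time f Y x = enat n \<longleftrightarrow> 1 \<le> n \<and> (f ^^ n) x \<in> Y \<and> (\<forall>m. 1 \<le> m \<and> m < n \<longrightarrow> (f ^^ m) x \<notin> Y)"
    (is "?L \<longleftrightarrow> ?R")
proof
  let ?S = "{n. 1 \<le> n \<and> (f ^^ n) x \<in> Y}"
  {
    assume n: ?L
    have lower: "enat n \<le> enat m" if "m \<in> ?S" for m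
      unfolding n[symmetric] return_time_def using that by (rule INF_lower)
    have "\<exists>k. k \<in> ?S"
    proof (rule ccontr)
      assume "\<nexists>k. k \<in> ?S"
      then have "?S = {}" by blast
      then have "return_time f Y x = \<infinity>" unfolding return_time_def by (simp only: image_empty Inf_empty top_enat_def)
      with n show False by simp
    qed
    then obtain k where "k \<in> ?S" by blast
    then have "(INF n\<in>?S. enat n) \<in> enat ` ?S" by (intro wellorder_InfI[of "enat k"] imageI)
    then have "n \<in> ?S" using n unfolding return_time_def by force
    with lower show ?R by (fastforce simp del: funpow.simps)
  }
  assume ?R
  then have n: "n \<in> ?S" and min: "\<And>m. m \<in> ?S \<Longrightarrow> n \<le> m" by (blast, metis (no_types, lifting) mem_Collect_eq not_less)
  show ?L
    unfolding return_time_def using n min by (intro antisym INF_lower INF_greatest) (simp_all only: enat_ord_simps)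
qed

locale conservative_system =
  fixes M :: "'a measure" and f :: "'a \<Rightarrow> 'a" and Y :: "'a set"
  assumes mpt: "measure_preserving_map M f" and cons: "conservative_map M f"
    and Y [measurable]: "Y \<in> sets M" and finY: "emeasure M Y < \<infinity>"
begin

definition U :: "nat \<Rightarrow> 'a set" where
  "U j = {y \<in> Y. \<forall>m\<in>{1..j}. (f ^^ m) y \<notin> Y}"

lemma f_measurable [measurable]: "f \<in> measurable M M"
  using mpt by (simp add: measure_preserving_map_def)

lemma fn_measurable [measurable]: "(f ^^ n) \<in> measurable M M"
  by (rule funpow_measurable) simp

lemma fn_space: "x \<in> space M \<Longrightarrow> (f ^^ n) x \<in> space M"
  using measurable_space[OF fn_measurable] .

lemma distr_fn: "distr M M (f ^^ n) = M"
proof (rule measure_eqI)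
  fix A assume "A \<in> sets (distr M M (f ^^ n))"
  then have A: "A \<in> sets M" by simp
  have "emeasure M ((f ^^ n) -` A \<inter> space M) = emeasure M A"
  proof (induction n)
    case 0
    then show ?case using sets.sets_into_space[OF A] by (simp add: Int_absorb2)
  next
    case (Suc n)
    have "(f ^^ Suc n) -` A \<inter> space M = f -` ((f ^^ n) -` A \<inter> space M) \<inter> space M"
      using fn_space[of _ 1] by (auto simp: funpow_swap1)
    moreover have "(f ^^ n) -` A \<inter> space M \<in> sets M" using A by measurable
    then have "emeasure M (f -` ((f ^^ n) -` A \<inter> space M) \<inter> space M) = emeasure M ((f ^^ n) -` A \<inter> space M)"
      using mpt unfolding measure_preserving_map_def by blast
    ultimately show ?case using Suc by (simp only:)
  qed
  with A show "emeasure (distr M M (f ^^ n)) A = emeasure M A" by (simp add: emeasure_distr)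
qed simp

lemma emeasure_vimage_fn: "A \<in> sets M \<Longrightarrow> emeasure M ((f ^^ n) -` A \<inter> space M) = emeasure M A"
  using emeasure_distr[of "f ^^ n" M M A] by (simp add: distr_fn)

lemma AE_fn: "AE x in M. P x \<Longrightarrow> AE x in M. P ((f ^^ n) x)"
  using AE_distrD[OF fn_measurable[of n]] distr_fn by metis

lemma U_measurable [measurable]: "U j \<in> sets M"
proof -
  have "U j = {y \<in> space M. y \<in> Y \<and> (\<forall>m\<in>{1..j}. (f ^^ m) y \<notin> Y)}"
    using sets.sets_into_space[OF Y] by (auto simp: U_def)
  also have "\<dots> \<in> sets M" by measurable
  finally show ?thesis .
qed

lemma U_mono: "i \<le> j \<Longrightarrow> U j \<subseteq> U i"
  by (auto simp: U_def)

lemma U_0: "U 0 = Y" by (auto simp: U_def)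

lemma emeasure_subset_Y: "A \<subseteq> Y \<Longrightarrow> emeasure M A < \<infinity>"
  using emeasure_mono[of A Y M] finY Y by (simp add: le_less_trans)

lemma U_subset_Y: "U j \<subseteq> Y" by (auto simp: U_def)

lemma U_fmeasurable [simp]: "U j \<in> fmeasurable M"
  using emeasure_subset_Y[OF U_subset_Y] by (intro fmeasurableI) auto

lemma Y_level_eq: "Y_level f Y (Suc n) = U n - U (Suc n)"
proof -
  have "U (Suc n) = {y \<in> U n. (f ^^ Suc n) y \<notin> Y}"
    unfolding U_def by (simp add: atLeastAtMostSuc_conv del: funpow.simps) blast
  moreover have "Y_level f Y (Suc n) = {y \<in> U n. (f ^^ Suc n) y \<in> Y}"
    by (auto simp: Y_level_def return_time_eq_enat_iff U_def less_Suc_eq_le simp del: funpow.simps)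
  ultimately show ?thesis by blast
qed

lemma Y_level_measurable [measurable]: "Y_level f Y (Suc n) \<in> sets M"
  unfolding Y_level_eq by measurable

lemma indicator_Y_level: "indicator (Y_level f Y (Suc n)) x = (indicator (U n) x - indicator (U (Suc n)) x :: real)"
  unfolding Y_level_eq using U_mono[of n "Suc n"] by (auto simp: indicator_def)

definition V :: "nat \<Rightarrow> 'a set" where
  "V j = {x \<in> space M. \<exists>m\<le>j. (f ^^ m) x \<in> Y}"

lemma V_measurable [measurable]: "V j \<in> sets M"
  unfolding V_def by measurable

text \<open>Both sides are the increment of the measure of \<open>V\<close>: splitting \<open>V (Suc n)\<close> by the first entrance
  to \<open>Y\<close> yields the left one, splitting it by the last visit yields the right one.\<close>

lemma X_level_measurable [measurable]: "X_level M f Y (Suc n) \<in> sets M"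
  and emeasure_X_level: "emeasure M (X_level M f Y (Suc n)) = emeasure M (U (Suc n))"
proof -
  have X: "X_level M f Y (Suc n) = V (Suc n) - V n"
  proof (intro equalityI subsetI)
    fix x assume x: "x \<in> X_level M f Y (Suc n)"
    then have "(f ^^ m) x \<notin> Y" if "m \<le> n" for m
      using that x by (cases "m = 0") (auto simp: X_level_def return_time_eq_enat_iff)
    with x show "x \<in> V (Suc n) - V n" by (auto simp: X_level_def return_time_eq_enat_iff V_def simp del: funpow.simps)
  next
    fix x assume x: "x \<in> V (Suc n) - V n"
    then have no: "(f ^^ m) x \<notin> Y" if "m \<le> n" for m using that by (auto simp: V_def)
    from x obtain m where m: "m \<le> Suc n" "(f ^^ m) x \<in> Y" "x \<in> space M" by (auto simp: V_def)
    with no have "m = Suc n" by (metis le_SucE)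
    then show "x \<in> X_level M f Y (Suc n)"
      using m no[of 0] no by (auto simp: X_level_def return_time_eq_enat_iff less_Suc_eq_le simp del: funpow.simps)
  qed
  then show "X_level M f Y (Suc n) \<in> sets M" by simp
  have sub: "V n \<subseteq> V (Suc n)" by (auto simp: V_def intro: le_SucI)
  \<comment> \<open>A point of \<open>V (Suc n)\<close> either visits \<open>Y\<close> at a time in
    \<open>{1..Suc n}\<close>, so that its image lies in \<open>V n\<close>, or it visits
    \<open>Y\<close> at time 0 only.\<close>
  have Vsuc: "V (Suc n) = (f ^^ 1) -` V n \<inter> space M \<union> U (Suc n)"
  proof (intro equalityI subsetI)
    fix x assume "x \<in> V (Suc n)"
    then obtain m where m: "m \<le> Suc n" "(f ^^ m) x \<in> Y" "x \<in> space M" by (auto simp: V_def)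
    show "x \<in> (f ^^ 1) -` V n \<inter> space M \<union> U (Suc n)"
    proof (cases "\<exists>k\<in>{1..Suc n}. (f ^^ k) x \<in> Y")
      case True
      then obtain k where k: "1 \<le> k" "k \<le> Suc n" "(f ^^ k) x \<in> Y" by auto
      then have "(f ^^ (k - 1)) (f x) \<in> Y" by (cases k) (auto simp: funpow_swap1)
      then have "f x \<in> V n" using k m fn_space[of x 1] unfolding V_def by (intro CollectI conjI exI[of _ "k - 1"]) auto
      with m show ?thesis by simp
    next
      case False
      with m have "m = 0" by (metis atLeastAtMost_iff less_one not_le)
      with m False show ?thesis by (auto simp: U_def)
    qed
  next
    fix x assume "x \<in> (f ^^ 1) -` V n \<inter> space M \<union> U (Suc n)"
    then show "x \<in> V (Suc n)"
    proof
      assume x: "x \<in> (f ^^ 1) -` V n \<inter> space M"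
      then obtain m where "m \<le> n" "(f ^^ m) (f x) \<in> Y" by (auto simp: V_def)
      then have "(f ^^ Suc m) x \<in> Y" "Suc m \<le> Suc n" by (auto simp: funpow_swap1)
      with x show ?thesis unfolding V_def by blast
    next
      assume "x \<in> U (Suc n)"
      then have "x \<in> Y" by (simp add: U_def)
      then show ?thesis using sets.sets_into_space[OF Y] unfolding V_def by (intro CollectI conjI exI[of _ 0]) auto
    qed
  qed
  have "((f ^^ 1) -` V n \<inter> space M) \<inter> U (Suc n) = {}"
  proof (intro equals0I)
    fix x assume x: "x \<in> ((f ^^ 1) -` V n \<inter> space M) \<inter> U (Suc n)"
    then obtain m where "m \<le> n" "(f ^^ m) (f x) \<in> Y" by (auto simp: V_def)
    then have "(f ^^ Suc m) x \<in> Y" "Suc m \<in> {1..Suc n}" by (auto simp: funpow_swap1)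
    with x show False unfolding U_def by blast
  qed
  then have "emeasure M (V (Suc n)) = emeasure M ((f ^^ 1) -` V n \<inter> space M) + emeasure M (U (Suc n))"
    unfolding Vsuc by (intro plus_emeasure[symmetric]) auto
  then have 1: "emeasure M (V (Suc n)) = emeasure M (V n) + emeasure M (U (Suc n))"
    by (simp only: emeasure_vimage_fn[OF V_measurable])
  have "emeasure M (V n) < \<infinity>"
  proof -
    have "V n = (\<Union>m\<in>{..n}. (f ^^ m) -` Y \<inter> space M)" by (auto simp: V_def)
    also have "emeasure M \<dots> \<le> (\<Sum>m\<in>{..n}. emeasure M ((f ^^ m) -` Y \<inter> space M))"
      by (intro emeasure_subadditive_finite) auto
    also have "\<dots> = (\<Sum>m\<in>{..n}. emeasure M Y)" by (simp add: emeasure_vimage_fn)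
    also have "\<dots> < \<infinity>" using finY by (simp add: ennreal_mult_less_top of_nat_less_top)
    finally show ?thesis .
  qed
  moreover have "emeasure M (X_level M f Y (Suc n)) = emeasure M (V (Suc n)) - emeasure M (V n)"
    unfolding X using \<open>emeasure M (V n) < \<infinity>\<close> sub by (intro emeasure_Diff) auto
  ultimately show "emeasure M (X_level M f Y (Suc n)) = emeasure M (U (Suc n))"
    unfolding 1 by (simp add: ennreal_add_diff_cancel_left)
qed

definition u :: "nat \<Rightarrow> real" where "u j = measure M (U j)"

lemma u_nonneg: "0 \<le> u j" by (simp add: u_def)

lemma u_antimono: "i \<le> j \<Longrightarrow> u j \<le> u i"
  unfolding u_def by (intro measure_mono_fmeasurable U_mono) auto

lemma measure_X_level: "measure M (X_level M f Y (Suc n)) = u (Suc n)"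
  by (simp add: u_def measure_def emeasure_X_level)

text \<open>The intersection of all \<open>U j\<close> consists of the points of \<open>Y\<close>
  that never return. It is a wandering set, hence null by conservativity, and continuity from above
  applies.\<close>

lemma u_tendsto_0: "u \<longlonglongrightarrow> 0"
proof -
  define W where "W = (\<Inter>j. U j)"
  have W: "W \<in> sets M" unfolding W_def by measurable
  have never: "(f ^^ m) y \<notin> Y" if "y \<in> W" "1 \<le> m" for y m
    using that unfolding W_def U_def by (metis (no_types, lifting) INT_D UNIV_I atLeastAtMost_iff mem_Collect_eq order_refl)
  have WY: "W \<subseteq> Y" using U_0 by (auto simp: W_def)
  have "disjoint_family (\<lambda>n. (f ^^ n) -` W \<inter> space M)"
  proof -
    have False if "n < m" "(f ^^ n) x \<in> W" "(f ^^ m) x \<in> W" for n m x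
    proof -
      have "(f ^^ m) x = (f ^^ (m - n)) ((f ^^ n) x)" using that(1) by (metis add.commute comp_apply funpow_add le_add_diff_inverse less_imp_le)
      moreover have "1 \<le> m - n" using that(1) by simp
      ultimately show False using never[OF that(2), of "m - n"] that(3) WY by auto
    qed
    then show ?thesis by (auto simp: disjoint_family_on_def) (metis linorder_neqE_nat)
  qed
  then have W0: "emeasure M W = 0" using cons W by (auto simp: conservative_map_def)
  have "(\<lambda>j. measure M (U j)) \<longlonglongrightarrow> measure M (\<Inter>j. U j)"
  proof (rule Lim_measure_decseq)
    show "range U \<subseteq> sets M" by auto
    show "decseq U" using U_mono by (auto simp: decseq_def)
    show "emeasure M (U i) \<noteq> \<infinity>" for i using emeasure_subset_Y[OF U_subset_Y, of i] by simp
  qed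
  then show ?thesis using W0 by (simp add: u_def[abs_def] W_def measure_def)
qed

lemma integrable_U_bounded:
  assumes [measurable]: "h \<in> borel_measurable M" and bd: "\<And>x. \<bar>h x\<bar> \<le> (B::real)"
  shows "integrable M (\<lambda>x. indicator (U j) x * h x)"
proof (rule Bochner_Integration.integrable_bound)
  show "integrable M (\<lambda>x. B * indicator (U j) x :: real)" by (simp add: fmeasurableD2 integrable_real_indicator less_top[symmetric])
  have "0 \<le> B" using abs_ge_zero bd order_trans by blast
  then show "AE x in M. norm (indicator (U j) x * h x) \<le> norm (B * indicator (U j) x :: real)"
    using bd by (intro AE_I2) (auto simp: indicator_def)
qed measurable

lemma integral_indicator_U: "(\<integral>x. indicator (U j) x \<partial>M) = u j"
  by (simp add: u_def)

definition G :: "('a \<Rightarrow> real) \<Rightarrow> nat \<Rightarrow> real" where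
  "G g j = (\<integral>x. indicator (U j) x * g ((f ^^ j) x) \<partial>M)"

lemma last_visit_decomposition:
  fixes g :: "'a \<Rightarrow> real"
  assumes [measurable]: "g \<in> borel_measurable M" and bd: "\<And>x. \<bar>g x\<bar> \<le> B"
  shows "(\<integral>x. indicator Y x * g ((f ^^ n) x) \<partial>M)
    = (\<Sum>k\<le>n. \<integral>x. indicator Y x * (indicator (U (n - k)) ((f ^^ k) x) * g ((f ^^ (n - k)) ((f ^^ k) x))) \<partial>M)"
proof -
  have pw: "indicator Y x * g ((f ^^ n) x) = (\<Sum>k\<le>n. indicator Y x * (indicator (U (n - k)) ((f ^^ k) x) * g ((f ^^ (n - k)) ((f ^^ k) x))))" for x
  proof (cases "x \<in> Y")
    case True
    \<comment> \<open>The last visit up to time \<open>n\<close>; time 0 is a visit, so the maximum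
      exists. It is the only \<open>k \<le> n\<close> with \<open>(f ^^ k) x\<close> in
      \<open>U (n - k)\<close>.\<close>
    define k0 where "k0 = Max {k. k \<le> n \<and> (f ^^ k) x \<in> Y}"
    have fin: "finite {k. k \<le> n \<and> (f ^^ k) x \<in> Y}" by simp
    have ne: "{k. k \<le> n \<and> (f ^^ k) x \<in> Y} \<noteq> {}" using True by (auto intro: exI[of _ 0])
    have k0: "k0 \<le> n" "(f ^^ k0) x \<in> Y" using Max_in[OF fin ne] by (auto simp: k0_def)
    have k0max: "k \<le> k0" if "k \<le> n" "(f ^^ k) x \<in> Y" for k
      using Max_ge[OF fin, of k] that by (simp add: k0_def)
    have comp: "(f ^^ m) ((f ^^ k) x) = (f ^^ (m + k)) x" for m k by (simp add: funpow_add)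
    have ind: "(f ^^ k) x \<in> U (n - k) \<longleftrightarrow> k = k0" if "k \<le> n" for k
    proof
      assume "(f ^^ k) x \<in> U (n - k)"
      then have kY: "(f ^^ k) x \<in> Y" and no: "\<And>m. 1 \<le> m \<Longrightarrow> m \<le> n - k \<Longrightarrow> (f ^^ (m + k)) x \<notin> Y"
        by (auto simp: U_def comp)
      have "k \<le> k0" using k0max[OF that kY] .
      moreover have "\<not> k < k0"
      proof
        assume "k < k0"
        then have "1 \<le> k0 - k" "k0 - k \<le> n - k" "k0 - k + k = k0" using k0 by auto
        with no[of "k0 - k"] k0 show False by simp
      qed
      ultimately show "k = k0" by simp
    next
      assume k: "k = k0"
      have "(f ^^ (m + k0)) x \<notin> Y" if "1 \<le> m" "m \<le> n - k0" for m
      proof -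
        have "m + k0 \<le> n" using that k0(1) by linarith
        with k0max[of "m + k0"] that(1) show ?thesis by auto
      qed
      then show "(f ^^ k) x \<in> U (n - k)" using k0 by (auto simp: U_def comp k)
    qed
    have "(\<Sum>k\<le>n. indicator Y x * (indicator (U (n - k)) ((f ^^ k) x) * g ((f ^^ (n - k)) ((f ^^ k) x))))
        = (\<Sum>k\<le>n. if k = k0 then g ((f ^^ n) x) else 0)"
      using True ind by (intro sum.cong) (auto simp: comp indicator_def)
    also have "\<dots> = g ((f ^^ n) x)" using k0 by simp
    finally show ?thesis using True by simp
  qed simp
  show ?thesis
  proof (subst pw, rule Bochner_Integration.integral_sum)
    fix k
    have "integrable M (\<lambda>x. indicator (U 0) x * (indicator (U (n - k)) ((f ^^ k) x) * g ((f ^^ (n - k)) ((f ^^ k) x))))"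
    proof (rule integrable_U_bounded)
      show "\<bar>indicator (U (n - k)) ((f ^^ k) x) * g ((f ^^ (n - k)) ((f ^^ k) x))\<bar> \<le> B" for x
        using bd[of "(f ^^ (n - k)) ((f ^^ k) x)"] abs_ge_zero[of "g ((f ^^ (n - k)) ((f ^^ k) x))"] by (auto simp: indicator_def)
    qed measurable
    then show "integrable M (\<lambda>x. indicator Y x * (indicator (U (n - k)) ((f ^^ k) x) * g ((f ^^ (n - k)) ((f ^^ k) x))))"
      by (simp add: U_0)
  qed
qed

lemma G_bound:
  assumes [measurable]: "g \<in> borel_measurable M" and bd: "\<And>x. \<bar>g x\<bar> \<le> B"
  shows "\<bar>G g j\<bar> \<le> B * u j"
proof -
  have "\<bar>G g j\<bar> \<le> (\<integral>x. \<bar>indicator (U j) x * g ((f ^^ j) x)\<bar> \<partial>M)"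
    unfolding G_def using integral_norm_bound[of M "\<lambda>x. indicator (U j) x * g ((f ^^ j) x)"] by simp
  also have "\<dots> \<le> (\<integral>x. indicator (U j) x * B \<partial>M)"
  proof (rule integral_mono)
    show "integrable M (\<lambda>x. \<bar>indicator (U j) x * g ((f ^^ j) x)\<bar>)"
      using integrable_U_bounded[of "\<lambda>x. g ((f ^^ j) x)" B j] bd by simp
    show "integrable M (\<lambda>x. indicator (U j) x * B)"
      using integrable_U_bounded[of "\<lambda>x. B" "\<bar>B\<bar>" j] by simp
    show "\<bar>indicator (U j) x * g ((f ^^ j) x)\<bar> \<le> indicator (U j) x * B" for x
      using bd by (auto simp: indicator_def)
  qed
  also have "\<dots> = B * u j" by (simp add: u_def)
  finally show ?thesis .
qed

end


section \<open>Iterates of the transfer operator and the renewal estimate\<close>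

text \<open>Boundedness everywhere passes from \<open>w\<close> to its composition with
  \<open>f\<close>, which keeps the test function admissible when the induction peels off one
  application of \<open>L\<close>.\<close>

lemma transfer_operator_funpow:
  fixes w :: "'a \<Rightarrow> real"
  assumes L: "transfer_operator M f L" and f [measurable]: "f \<in> measurable M M" and v: "integrable M v"
  shows "integrable M ((L ^^ k) v)"
    and "w \<in> borel_measurable M \<Longrightarrow> (\<And>x. \<bar>w x\<bar> \<le> B) \<Longrightarrow>
      (\<integral>x. (L ^^ k) v x * w x \<partial>M) = (\<integral>x. v x * w ((f ^^ k) x) \<partial>M)"
proof -
  have int: "integrable M ((L ^^ k) v)" for k
    by (induction k) (use L v in \<open>auto simp: transfer_operator_def\<close>)
  then show "integrable M ((L ^^ k) v)" .
  show "(\<integral>x. (L ^^ k) v x * w x \<partial>M) = (\<integral>x. v x * w ((f ^^ k) x) \<partial>M)"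
    if "w \<in> borel_measurable M" "\<And>x. \<bar>w x\<bar> \<le> B"
    using that
  proof (induction k arbitrary: w)
    case (Suc k)
    note [measurable] = Suc.prems(1)
    have "Linf_norm M w \<le> ereal B"
      unfolding Linf_norm_def by (intro esssup_I) (use Suc.prems in auto)
    then have "w \<in> Linf_space M" using Suc.prems by (auto simp: Linf_space_def)
    then have "(\<integral>x. L ((L ^^ k) v) x * w x \<partial>M) = (\<integral>x. (L ^^ k) v x * w (f x) \<partial>M)"
      using L int[of k] by (auto simp: transfer_operator_def)
    also have "\<dots> = (\<integral>x. v x * w (f ((f ^^ k) x)) \<partial>M)"
      using Suc.prems by (intro Suc.IH) auto
    finally show ?case by simp
  qed simp
qed

context conservative_system
begin

text \<open>Duality moves the iterate of \<open>f\<close> onto 1_Y, leaving L^k 1_Y tested against a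
  function supported in \<open>U j\<close>, a subset of \<open>Y\<close>, where the norm bound
  applies. The sequence \<open>e\<close> is a_k times the norm, so that \<open>e k\<close> over a_k
  is the norm again; it depends on neither \<open>g\<close> nor \<open>j\<close>.\<close>

lemma renewal_error:
  fixes L :: "('a \<Rightarrow> real) \<Rightarrow> ('a \<Rightarrow> real)"
  assumes L: "transfer_operator M f L" and K: "0 \<le> K"
    and renewal: "(\<lambda>n. ereal (norming_seq \<alpha> n) *
        Linf_norm M (\<lambda>x. indicator Y x * ((L ^^ n) (indicator Y) x - K * inverse (norming_seq \<alpha> n))))
        \<longlonglongrightarrow> 0"
  shows "\<exists>e. e \<longlonglongrightarrow> 0 \<and> (\<forall>g B k j. g \<in> borel_measurable M \<longrightarrow> (\<forall>x. \<bar>g x\<bar> \<le> B) \<longrightarrow>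
      \<bar>(\<integral>x. indicator Y x * (indicator (U j) ((f ^^ k) x) * g ((f ^^ j) ((f ^^ k) x))) \<partial>M)
        - K * inverse (norming_seq \<alpha> k) * G g j\<bar> \<le> B * (e k * inverse (norming_seq \<alpha> k) * u j))"
proof -
  define w where "w k = inverse (norming_seq \<alpha> k)" for k
  have w: "0 < w k" for k unfolding w_def by (rule inverse_norming_pos)
  have nw: "norming_seq \<alpha> k = 1 / w k" for k by (simp add: w_def inverse_eq_divide)
  define N where "N n = Linf_norm M (\<lambda>x. indicator Y x * ((L ^^ n) (indicator Y) x - K * w n))" for n
  \<comment> \<open>The norm may be infinite for finitely many indices; there a trivial bound is used.\<close>
  define e where "e k = (if \<bar>N k\<bar> = \<infinity> then (1 + K * w k) / w k else max 0 (real_of_ereal (N k) / w k))" for k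
  have lim: "(\<lambda>n. ereal (1 / w n) * N n) \<longlonglongrightarrow> 0"
    unfolding nw[symmetric] N_def unfolding w_def by (rule renewal)
  have fin: "eventually (\<lambda>n. \<bar>N n\<bar> \<noteq> \<infinity>) sequentially"
  proof -
    have "eventually (\<lambda>n. ereal (1 / w n) * N n < 1) sequentially" "eventually (\<lambda>n. ereal (1 / w n) * N n > - 1) sequentially"
      using lim by (auto intro: order_tendstoD)
    then show ?thesis
    proof eventually_elim
      case (elim n)
      then show ?case using w[of n] by (cases "N n") auto
    qed
  qed
  have e0: "e \<longlonglongrightarrow> 0"
  proof -
    have "(\<lambda>n. real_of_ereal (ereal (1 / w n) * N n)) \<longlonglongrightarrow> 0"
      using lim by (intro lim_real_of_ereal) (simp add: zero_ereal_def)
    then have "(\<lambda>n. max 0 (real_of_ereal (ereal (1 / w n) * N n))) \<longlonglongrightarrow> max 0 0"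
      by (intro tendsto_max tendsto_const)
    moreover have "eventually (\<lambda>n. max 0 (real_of_ereal (ereal (1 / w n) * N n)) = e n) sequentially"
      using fin by eventually_elim (auto simp: e_def)
    ultimately show ?thesis by (simp add: filterlim_cong[OF refl refl])
  qed
  have "\<bar>(\<integral>x. indicator Y x * (indicator (U j) ((f ^^ k) x) * g ((f ^^ j) ((f ^^ k) x))) \<partial>M) - K * w k * G g j\<bar> \<le> B * (e k * w k * u j)"
    if [measurable]: "g \<in> borel_measurable M" and bd: "\<And>x. \<bar>g x\<bar> \<le> B" for g B k j
  proof -
    define h where "h x = indicator (U j) x * g ((f ^^ j) x)" for x
    have [measurable]: "h \<in> borel_measurable M" unfolding h_def by measurable
    have B: "0 \<le> B" using bd[of undefined] by linarith
    have hB: "\<bar>h x\<bar> \<le> B * indicator (U j) x" for x using bd by (auto simp: h_def indicator_def)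
    have hB': "\<bar>h x\<bar> \<le> B" for x using bd B by (auto simp: h_def indicator_def)
    have iU: "integrable M (\<lambda>x. indicator (U j) x :: real)"
      using integrable_U_bounded[of "\<lambda>_. 1" 1 j] by simp
    have G: "G g j = (\<integral>x. h x \<partial>M)" by (simp add: G_def h_def)
    have ih: "integrable M h" unfolding h_def using bd by (intro integrable_U_bounded[where B = B]) auto
    let ?Q = "\<integral>x. indicator Y x * h ((f ^^ k) x) \<partial>M"
    have "\<bar>?Q - K * w k * G g j\<bar> \<le> B * (e k * w k * u j)"
    proof (cases "\<bar>N k\<bar> = \<infinity>")
      case True
      \<comment> \<open>Invariance of the measure bounds the integral by \<open>B * u j\<close>, and
        the main term is at most \<open>K * w k * (B * u j)\<close>. The value of \<open>e k\<close>
        is set so that \<open>e k * w k = 1 + K * w k\<close>.\<close>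
      have "integrable (distr M M (f ^^ k)) (\<lambda>x. indicator (U j) x :: real)" using iU by (simp add: distr_fn)
      then have iUk: "integrable M (\<lambda>x. indicator (U j) ((f ^^ k) x) :: real)" by (rule integrable_distr[OF fn_measurable])
      have "\<bar>?Q\<bar> \<le> (\<integral>x. \<bar>indicator Y x * h ((f ^^ k) x)\<bar> \<partial>M)"
        using integral_norm_bound[of M "\<lambda>x. indicator Y x * h ((f ^^ k) x)"] by simp
      also have "\<dots> \<le> (\<integral>x. B * indicator (U j) ((f ^^ k) x) \<partial>M)"
      proof (rule integral_mono)
        have "integrable M (\<lambda>x. indicator (U 0) x * h ((f ^^ k) x))"
          using hB' by (intro integrable_U_bounded) auto
        then show "integrable M (\<lambda>x. \<bar>indicator Y x * h ((f ^^ k) x)\<bar>)" unfolding U_0 by (rule integrable_abs)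
        show "integrable M (\<lambda>x. B * indicator (U j) ((f ^^ k) x))" using iUk by simp
        show "\<bar>indicator Y x * h ((f ^^ k) x)\<bar> \<le> B * indicator (U j) ((f ^^ k) x)" for x
          using hB[of "(f ^^ k) x"] B by (auto simp: indicator_def)
      qed
      also have "\<dots> = B * (\<integral>x. indicator (U j) ((f ^^ k) x) \<partial>M)" by simp
      also have "(\<integral>x. indicator (U j) ((f ^^ k) x) \<partial>M) = (\<integral>x. (indicator (U j) x :: real) \<partial>distr M M (f ^^ k))"
        by (rule integral_distr[symmetric]) auto
      also have "\<dots> = u j" unfolding distr_fn by (rule integral_indicator_U)
      finally have 1: "\<bar>?Q\<bar> \<le> B * u j" .
      have "\<bar>K * w k * G g j\<bar> = K * w k * \<bar>G g j\<bar>" using K w[of k] by (simp add: abs_mult)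
      also have "\<dots> \<le> K * w k * (B * u j)" using K w[of k] G_bound[OF that] by (intro mult_left_mono) auto
      finally have "\<bar>?Q - K * w k * G g j\<bar> \<le> B * u j + K * w k * (B * u j)" using 1 by linarith
      also have "\<dots> = B * ((1 + K * w k) * u j)" by (simp add: algebra_simps)
      also have "1 + K * w k = e k * w k" using True w[of k] by (simp add: e_def)
      finally show ?thesis .
    next
      case False
      then obtain r where r: "N k = ereal r" by auto
      have iY: "integrable M (indicator Y :: 'a \<Rightarrow> real)" using finY by (simp add: integrable_indicator_iff)
      have iL: "integrable M ((L ^^ k) (indicator Y))"
        by (rule transfer_operator_funpow(1)[OF L f_measurable iY])
      have [measurable]: "(L ^^ k) (indicator Y) \<in> borel_measurable M" using iL by auto
      have iLh: "integrable M (\<lambda>x. (L ^^ k) (indicator Y) x * h x)"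
      proof (rule Bochner_Integration.integrable_bound)
        show "integrable M (\<lambda>x. B * (L ^^ k) (indicator Y) x)" using iL by simp
        show "AE x in M. norm ((L ^^ k) (indicator Y) x * h x) \<le> norm (B * (L ^^ k) (indicator Y) x)"
          using hB' B by (intro AE_I2) (simp add: abs_mult mult.commute[of B] mult_left_mono)
      qed measurable
      have "?Q = (\<integral>x. (L ^^ k) (indicator Y) x * h x \<partial>M)"
        using hB' by (intro transfer_operator_funpow(2)[OF L f_measurable iY, symmetric]) auto
      then have "?Q - K * w k * G g j = (\<integral>x. (L ^^ k) (indicator Y) x * h x \<partial>M) - (\<integral>x. K * w k * h x \<partial>M)"
        by (simp add: G)
      also have "\<dots> = (\<integral>x. (L ^^ k) (indicator Y) x * h x - K * w k * h x \<partial>M)"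
        using iLh ih by (intro Bochner_Integration.integral_diff[symmetric]) auto
      finally have eq: "?Q - K * w k * G g j = (\<integral>x. (L ^^ k) (indicator Y) x * h x - K * w k * h x \<partial>M)" .
      have rk: "r \<le> e k * w k"
        using w[of k] r by (auto simp: e_def max_def field_simps)
      have "AE x in M. ereal \<bar>indicator Y x * ((L ^^ k) (indicator Y) x - K * w k)\<bar> \<le> N k"
        unfolding N_def Linf_norm_def by (rule esssup_AE)
      then have "AE x in M. \<bar>(L ^^ k) (indicator Y) x * h x - K * w k * h x\<bar> \<le> (e k * w k * B) * indicator (U j) x"
      proof eventually_elim
        case (elim x)
        show ?case
        proof (cases "x \<in> U j")
          case True
          then have "x \<in> Y" using U_subset_Y by auto
          with elim r have "\<bar>(L ^^ k) (indicator Y) x - K * w k\<bar> \<le> r" by simp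
          then have "\<bar>(L ^^ k) (indicator Y) x - K * w k\<bar> * \<bar>h x\<bar> \<le> (e k * w k) * B"
            using hB'[of x] rk by (intro mult_mono) auto
          moreover have "\<bar>(L ^^ k) (indicator Y) x * h x - K * w k * h x\<bar> = \<bar>(L ^^ k) (indicator Y) x - K * w k\<bar> * \<bar>h x\<bar>"
            by (simp add: abs_mult[symmetric] algebra_simps)
          ultimately show ?thesis using True by simp
        qed (simp add: h_def)
      qed
      then have "(\<integral>x. \<bar>(L ^^ k) (indicator Y) x * h x - K * w k * h x\<bar> \<partial>M) \<le> (\<integral>x. (e k * w k * B) * indicator (U j) x \<partial>M)"
        using iLh ih iU by (intro integral_mono_AE) auto
      also have "\<dots> = B * (e k * w k * u j)" by (simp add: u_def)
      finally show ?thesis unfolding eq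
        using integral_norm_bound[of M "\<lambda>x. (L ^^ k) (indicator Y) x * h x - K * w k * h x"] unfolding real_norm_def by linarith
    qed
    then show ?thesis by (simp only: h_def)
  qed
  then show ?thesis using e0 unfolding w_def by (intro exI[of _ e] conjI allI impI) blast+
qed

end


section \<open>Disjoint unions and sums over countable index sets\<close>

text \<open>Indices outside the range of the enumeration receive the empty set. A family over any
  countable set, finite or infinite, thus becomes a sequence to which sigma-additivity
  applies.\<close>

lemma disjoint_family_from_nat_into:
  assumes I: "countable I" and disj: "disjoint_family_on F I"
  shows "disjoint_family (\<lambda>n. if n \<in> to_nat_on I ` I then F (from_nat_into I n) else {})"
  unfolding disjoint_family_on_def
proof (intro ballI impI)
  fix m n :: nat assume mn: "m \<noteq> n"
  let ?F = "\<lambda>n. if n \<in> to_nat_on I ` I then F (from_nat_into I n) else {}"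
  show "?F m \<inter> ?F n = {}"
  proof (cases "m \<in> to_nat_on I ` I \<and> n \<in> to_nat_on I ` I")
    case True
    then obtain x y where xy: "x \<in> I" "m = to_nat_on I x" "y \<in> I" "n = to_nat_on I y" by blast
    then have "F x \<inter> F y = {}" using disjoint_family_onD[OF disj, of x y] mn by auto
    then show ?thesis using xy I by simp
  qed auto
qed

lemma has_sum_measure_countable_disjoint:
  assumes I: "countable I" and disj: "disjoint_family_on F I" and F: "\<And>i. i \<in> I \<Longrightarrow> F i \<in> sets M"
    and fin: "emeasure M (\<Union>i\<in>I. F i) \<noteq> \<infinity>"
  shows "((\<lambda>i. measure M (F i)) has_sum measure M (\<Union>i\<in>I. F i)) I"
proof -
  let ?N = "to_nat_on I ` I"
  define F' where "F' n = (if n \<in> ?N then F (from_nat_into I n) else {})" for n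
  have Un: "(\<Union>n. F' n) = (\<Union>i\<in>I. F i)" using I by (auto simp: F'_def split: if_splits)
  have inj: "inj_on (to_nat_on I) I" using I by (rule inj_on_to_nat_on)
  have "disjoint_family F'"
    unfolding F'_def by (rule disjoint_family_from_nat_into[OF I disj])
  moreover have "range F' \<subseteq> sets M" using F I by (auto simp: F'_def split: if_splits)
  ultimately have "(\<lambda>n. measure M (F' n)) sums measure M (\<Union>n. F' n)"
    using fin by (intro measure_UNION) (simp_all only: Un, simp)
  then have "((\<lambda>n. measure M (F' n)) has_sum measure M (\<Union>n. F' n)) UNIV"
    by (rule sums_nonneg_imp_has_sum) simp
  then have "((\<lambda>n. measure M (F (from_nat_into I n))) has_sum measure M (\<Union>i\<in>I. F i)) ?N"
    unfolding Un by (subst (asm) has_sum_cong_neutral[where T = ?N]) (auto simp: F'_def)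
  then show ?thesis
    unfolding has_sum_reindex[OF inj] using I by (subst (asm) has_sum_cong) (auto simp: o_def)
qed

lemma infsum_ennreal_eq_suminf:
  fixes h :: "'b \<Rightarrow> ennreal"
  assumes I: "countable I"
  shows "infsum h I = (\<Sum>n. if n \<in> to_nat_on I ` I then h (from_nat_into I n) else 0)"
proof -
  let ?N = "to_nat_on I ` I"
  have inj: "inj_on (to_nat_on I) I" using I by (rule inj_on_to_nat_on)
  have "infsum h I = infsum ((\<lambda>n. h (from_nat_into I n)) \<circ> to_nat_on I) I"
    using I by (intro infsum_cong) simp
  also have "\<dots> = infsum (\<lambda>n. h (from_nat_into I n)) ?N" by (rule infsum_reindex[OF inj, symmetric])
  also have "\<dots> = infsum (\<lambda>n. if n \<in> ?N then h (from_nat_into I n) else 0) UNIV"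
    by (rule infsum_cong_neutral) auto
  also have "\<dots> = (\<Sum>n. if n \<in> ?N then h (from_nat_into I n) else 0)"
    by (intro sums_unique has_sum_imp_sums has_sum_infsum nonneg_summable_on_complete) simp
  finally show ?thesis .
qed

lemma emeasure_UN_countable_infsum:
  assumes I: "countable I" and disj: "disjoint_family_on F I" and F: "\<And>i. i \<in> I \<Longrightarrow> F i \<in> sets M"
  shows "emeasure M (\<Union>i\<in>I. F i) = (\<Sum>\<^sub>\<infinity>i\<in>I. emeasure M (F i))"
proof -
  let ?N = "to_nat_on I ` I"
  define F' where "F' n = (if n \<in> ?N then F (from_nat_into I n) else {})" for n
  have Un: "(\<Union>n. F' n) = (\<Union>i\<in>I. F i)" using I by (auto simp: F'_def split: if_splits)
  have "disjoint_family F'"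
    unfolding F'_def by (rule disjoint_family_from_nat_into[OF I disj])
  moreover have "range F' \<subseteq> sets M" using F I by (auto simp: F'_def split: if_splits)
  ultimately have "(\<Sum>n. emeasure M (F' n)) = emeasure M (\<Union>n. F' n)"
    by (intro suminf_emeasure)
  moreover have "emeasure M (F' n) = (if n \<in> ?N then emeasure M (F (from_nat_into I n)) else 0)" for n
    by (simp add: F'_def)
  ultimately show ?thesis by (simp only: infsum_ennreal_eq_suminf[OF I] Un)
qed

lemma nn_integral_infsum:
  assumes I: "countable I" and F: "\<And>i. i \<in> I \<Longrightarrow> F i \<in> borel_measurable M"
  shows "(\<integral>\<^sup>+x. (\<Sum>\<^sub>\<infinity>i\<in>I. F i x) \<partial>M) = (\<Sum>\<^sub>\<infinity>i\<in>I. \<integral>\<^sup>+x. F i x \<partial>M)"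
proof -
  let ?N = "to_nat_on I ` I"
  have "(\<integral>\<^sup>+x. (\<Sum>\<^sub>\<infinity>i\<in>I. F i x) \<partial>M) = (\<integral>\<^sup>+x. (\<Sum>n. if n \<in> ?N then F (from_nat_into I n) x else 0) \<partial>M)"
    by (simp only: infsum_ennreal_eq_suminf[OF I])
  also have "\<dots> = (\<Sum>n. \<integral>\<^sup>+x. (if n \<in> ?N then F (from_nat_into I n) x else 0) \<partial>M)"
  proof (rule nn_integral_suminf)
    fix n show "(\<lambda>x. if n \<in> ?N then F (from_nat_into I n) x else 0) \<in> borel_measurable M"
      using F I by (cases "n \<in> ?N") auto
  qed
  also have "\<dots> = (\<Sum>n. if n \<in> ?N then \<integral>\<^sup>+x. F (from_nat_into I n) x \<partial>M else 0)"
    by (intro suminf_cong) simp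
  finally show ?thesis by (simp only: infsum_ennreal_eq_suminf[OF I])
qed

section \<open>Level decompositions\<close>

locale level_system = conservative_system M f Y
  for M :: "'a measure" and f :: "'a \<Rightarrow> 'a" and Y :: "'a set" +
  fixes n0 q :: nat and A :: "'r set" and \<psi> :: "'r \<Rightarrow> nat"
    and XX :: "nat \<Rightarrow> nat \<Rightarrow> 'a set" and YY :: "nat \<Rightarrow> 'r \<Rightarrow> 'a set"
  assumes dec: "level_decomposition M f Y n0 q A \<psi> XX YY"
begin

lemma n0: "1 \<le> n0" and countable_A: "countable A" and \<psi>_image: "\<psi> ` A = {1..q}"
  using dec by (auto simp: level_decomposition_def)

lemma XX_sets: "n0 \<le> n \<Longrightarrow> p \<in> {1..q} \<Longrightarrow> XX n p \<in> sets M"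
  and XX_disjoint: "n0 \<le> n \<Longrightarrow> disjoint_family_on (XX n) {1..q}"
  and X_level_eq: "n0 \<le> n \<Longrightarrow> X_level M f Y n = (\<Union>p\<in>{1..q}. XX n p)"
  and YY_sets: "n0 \<le> n \<Longrightarrow> r \<in> A \<Longrightarrow> YY n r \<in> sets M"
  and YY_disjoint: "n0 \<le> n \<Longrightarrow> disjoint_family_on (YY n) A"
  using dec by (auto simp: level_decomposition_def)

lemma YY_bij: "1 \<le> j \<Longrightarrow> n0 \<le> n \<Longrightarrow> r \<in> A \<Longrightarrow> bij_betw (f ^^ j) (YY (j + n) r) (XX n (\<psi> r))"
  using dec by (auto simp: level_decomposition_def)

text \<open>All branches of one type are merged, since \<open>f ^^ j\<close> sends each of them at
  level \<open>j + i\<close> onto the same set \<open>XX i p\<close>.\<close>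

definition Yp :: "nat \<Rightarrow> nat \<Rightarrow> 'a set" where
  "Yp p k = (\<Union>r\<in>{r \<in> A. \<psi> r = p}. YY k r)"

lemma Y_level_eq_Yp: "n0 \<le> n \<Longrightarrow> Y_level f Y n = (\<Union>p\<in>{1..q}. Yp p n)"
  using dec unfolding level_decomposition_def Yp_def by blast

lemma Yp_sets: "n0 \<le> k \<Longrightarrow> Yp p k \<in> sets M"
  unfolding Yp_def using countable_A YY_sets by (intro sets.countable_UN') (auto intro: countable_subset)

lemma Yp_disjoint: "n0 \<le> k \<Longrightarrow> disjoint_family_on (\<lambda>p. Yp p k) {1..q}"
  unfolding disjoint_family_on_def
proof (intro ballI impI equals0I)
  fix p p' x assume *: "n0 \<le> k" "p \<noteq> p'" "x \<in> Yp p k \<inter> Yp p' k"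
  then obtain r r' where "r \<in> A" "r' \<in> A" "\<psi> r = p" "\<psi> r' = p'" "x \<in> YY k r" "x \<in> YY k r'"
    by (auto simp: Yp_def)
  then show False using disjoint_family_onD[OF YY_disjoint[OF *(1)], of r r'] *(2) by auto
qed

lemma Yp_subset_level: "n0 \<le> k \<Longrightarrow> p \<in> {1..q} \<Longrightarrow> Yp p k \<subseteq> Y_level f Y k"
  using Y_level_eq_Yp by blast

lemma Yp_subset_Y: "n0 \<le> k \<Longrightarrow> p \<in> {1..q} \<Longrightarrow> Yp p k \<subseteq> Y"
  using Yp_subset_level by (force simp: Y_level_def)

lemma Yp_maps_to: "1 \<le> j \<Longrightarrow> n0 \<le> i \<Longrightarrow> x \<in> Yp p (j + i) \<Longrightarrow> (f ^^ j) x \<in> XX i p"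
  using YY_bij[of j i] unfolding Yp_def bij_betw_def by blast

definition t :: "nat \<Rightarrow> nat \<Rightarrow> real" where "t p n = measure M (XX n p)"
definition b :: "nat \<Rightarrow> nat \<Rightarrow> real" where "b p k = measure M (Yp p k)"

lemma X_level_fmeasurable: "1 \<le> n \<Longrightarrow> X_level M f Y n \<in> fmeasurable M"
proof -
  assume "1 \<le> n"
  then obtain m where n: "n = Suc m" by (cases n) auto
  have "emeasure M (X_level M f Y (Suc m)) < \<infinity>"
    unfolding emeasure_X_level using emeasure_subset_Y[OF U_subset_Y] .
  then show ?thesis unfolding n by (intro fmeasurableI X_level_measurable)
qed

lemma measure_X_level_n: "n0 \<le> n \<Longrightarrow> measure M (X_level M f Y n) = u n"
  using measure_X_level[of "n - 1"] n0 by simp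

lemma XX_subset: "n0 \<le> n \<Longrightarrow> p \<in> {1..q} \<Longrightarrow> XX n p \<subseteq> X_level M f Y n"
  using X_level_eq by blast

lemma XX_fin: "n0 \<le> n \<Longrightarrow> p \<in> {1..q} \<Longrightarrow> XX n p \<in> fmeasurable M"
  using fmeasurableI2[OF X_level_fmeasurable[OF order_trans[OF n0]] XX_subset XX_sets] by blast

lemma Yp_fin: "n0 \<le> n \<Longrightarrow> p \<in> {1..q} \<Longrightarrow> Yp p n \<in> fmeasurable M"
  using fmeasurableI2[OF U_fmeasurable[of 0], unfolded U_0] Yp_subset_Y Yp_sets by blast

lemma t_le_u: "n0 \<le> n \<Longrightarrow> p \<in> {1..q} \<Longrightarrow> t p n \<le> u n"
  unfolding t_def measure_X_level_n[symmetric]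
  by (intro measure_mono_fmeasurable XX_subset XX_sets X_level_fmeasurable[OF order_trans[OF n0]])

lemma u_eq_sum_t: "n0 \<le> n \<Longrightarrow> u n = (\<Sum>p\<in>{1..q}. t p n)"
  unfolding measure_X_level_n[symmetric] t_def X_level_eq
  using fmeasurableD2[OF XX_fin] by (intro measure_finite_Union XX_disjoint) (auto intro: XX_sets)

text \<open>Types persist along an excursion. With invariance of the measure this gives the
  recursion \<open>t p n = t p (Suc n) + b p (Suc n)\<close>, the source of every telescoping sum
  over excursions.\<close>

lemma vimage_XX:
  assumes n: "n0 \<le> n" and p: "p \<in> {1..q}"
  shows "f -` XX n p \<inter> space M = XX (Suc n) p \<union> Yp p (Suc n)"
proof -
  \<comment> \<open>The decomposition describes images of pieces of \<open>Y\<close> only. So a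
    point of \<open>XX (Suc n) p'\<close> is first written as \<open>f y\<close> with
    \<open>y\<close> in a branch of level \<open>n + 2\<close>; the bijection for two steps then
    locates \<open>f x\<close>.\<close>
  have X_to: "f x \<in> XX n p'" if x: "x \<in> XX (Suc n) p'" and p': "p' \<in> {1..q}" for x p'
  proof -
    obtain r where r: "r \<in> A" "\<psi> r = p'" using p' \<psi>_image by (metis imageE)
    have "bij_betw (f ^^ 1) (YY (1 + Suc n) r) (XX (Suc n) p')" using YY_bij[of 1 "Suc n" r] n r by simp
    then obtain y where y: "y \<in> YY (2 + n) r" "x = f y" using x by (auto simp: bij_betw_def)
    have "bij_betw (f ^^ 2) (YY (2 + n) r) (XX n p')" using YY_bij[of 2 n r] n r by simp
    then have "(f ^^ 2) y \<in> XX n p'" using y by (auto simp: bij_betw_def)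
    then show ?thesis using y by (simp add: numeral_2_eq_2)
  qed
  have Y_to: "f x \<in> XX n p'" if "x \<in> Yp p' (Suc n)" for x p'
    using Yp_maps_to[of 1 n x p'] that n by simp
  have same: "p' = p" if "x \<in> XX n p" "x \<in> XX n p'" "p' \<in> {1..q}" for x p'
    using disjoint_family_onD[OF XX_disjoint[OF n], of p p'] p that by blast
  show ?thesis
  proof (intro equalityI subsetI)
    fix x assume x: "x \<in> f -` XX n p \<inter> space M"
    then have "f x \<in> X_level M f Y n" using XX_subset[OF n p] by auto
    then have "f x \<notin> Y" "(f ^^ n) (f x) \<in> Y" and no: "\<And>m. 1 \<le> m \<Longrightarrow> m < n \<Longrightarrow> (f ^^ m) (f x) \<notin> Y"
      by (auto simp: X_level_def return_time_eq_enat_iff)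
    have "(f ^^ m) x \<notin> Y" if "1 \<le> m" "m < Suc n" for m
    proof (cases "m = 1")
      case True
      then show ?thesis using \<open>f x \<notin> Y\<close> by simp
    next
      case False
      then have "(f ^^ (m - 1)) (f x) \<notin> Y" using that by (intro no) auto
      moreover have "m = Suc (m - 1)" using that by simp
      ultimately show ?thesis by (metis comp_apply funpow_Suc_right)
    qed
    moreover have "(f ^^ Suc n) x \<in> Y" using \<open>(f ^^ n) (f x) \<in> Y\<close> by (metis comp_apply funpow_Suc_right)
    ultimately have rt: "return_time f Y x = enat (Suc n)" by (simp add: return_time_eq_enat_iff)
    show "x \<in> XX (Suc n) p \<union> Yp p (Suc n)"
    proof (cases "x \<in> Y")
      case True
      then have "x \<in> Y_level f Y (Suc n)" using rt by (simp add: Y_level_def)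
      then obtain p' where p': "p' \<in> {1..q}" "x \<in> Yp p' (Suc n)" using Y_level_eq_Yp[of "Suc n"] n by auto
      then have "p' = p" using same[of "f x" p'] Y_to[of x p'] x by auto
      with p' show ?thesis by simp
    next
      case False
      then have "x \<in> X_level M f Y (Suc n)" using rt x by (simp add: X_level_def)
      then obtain p' where p': "p' \<in> {1..q}" "x \<in> XX (Suc n) p'" using X_level_eq[of "Suc n"] n by auto
      then have "p' = p" using same[of "f x" p'] X_to[of x p'] x by auto
      with p' show ?thesis by simp
    qed
  next
    fix x assume "x \<in> XX (Suc n) p \<union> Yp p (Suc n)"
    moreover have "XX (Suc n) p \<subseteq> space M" "Yp p (Suc n) \<subseteq> space M"
      using XX_sets[of "Suc n" p] Yp_sets[of "Suc n" p] n p sets.sets_into_space by auto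
    ultimately show "x \<in> f -` XX n p \<inter> space M" using X_to[OF _ p] Y_to by auto
  qed
qed

lemma t_Suc:
  assumes n: "n0 \<le> n" and p: "p \<in> {1..q}"
  shows "t p n = t p (Suc n) + b p (Suc n)"
proof -
  have "measure M (XX n p) = measure M (f -` XX n p \<inter> space M)"
    using emeasure_vimage_fn[OF XX_sets[OF n p], of 1] by (simp add: measure_def)
  also have "\<dots> = measure M (XX (Suc n) p) + measure M (Yp p (Suc n))"
    unfolding vimage_XX[OF n p]
  proof (rule measure_Union)
    show "XX (Suc n) p \<inter> Yp p (Suc n) = {}"
      using XX_subset[of "Suc n" p] Yp_subset_Y[of "Suc n" p] n p by (auto simp: X_level_def)
  qed (use n p in \<open>auto intro!: fmeasurableD fmeasurableD2 XX_fin Yp_fin\<close>)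
  finally show ?thesis by (simp add: t_def b_def)
qed


lemma t_nonneg: "0 \<le> t p n" and b_nonneg: "0 \<le> b p n"
  by (simp_all add: t_def b_def)

lemma t_tendsto_0: "p \<in> {1..q} \<Longrightarrow> t p \<longlonglongrightarrow> 0"
  by (rule tendsto_sandwich[OF _ _ tendsto_const u_tendsto_0])
    (auto simp: eventually_sequentially t_nonneg intro!: exI[of _ n0] t_le_u)

lemma Y_level_unique: "x \<in> Y_level f Y m \<Longrightarrow> x \<in> Y_level f Y n \<Longrightarrow> m = n"
  by (simp add: Y_level_def)

lemma YY_subset_Yp: "r \<in> A \<Longrightarrow> YY k r \<subseteq> Yp (\<psi> r) k"
  by (auto simp: Yp_def)

lemma \<psi>_mem: "r \<in> A \<Longrightarrow> \<psi> r \<in> {1..q}"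
  using \<psi>_image by blast

text \<open>The double sum is the measure of a disjoint union, regrouped by return time into the
  sets \<open>Yp p (n + k)\<close>, whose measures telescope. This converts (i) into an asymptotic
  for the measures of the sets \<open>XX i p\<close>.\<close>

lemma tail_sum_eq:
  assumes n: "n0 < n" and p: "p \<in> {1..q}"
  shows "(\<Sum>\<^sub>\<infinity>r\<in>{r \<in> A. \<psi> r = p}. \<Sum>\<^sub>\<infinity>j\<in>{n..}. measure M (YY j r)) = t p (n - 1)"
proof -
  have lev: "x \<in> Y_level f Y j" if "x \<in> YY j r" "r \<in> A" "n \<le> j" for x j r
    using YY_subset_Yp[OF that(2), of j] Yp_subset_level[of j "\<psi> r"] \<psi>_mem[OF that(2)] that n by auto
  have inY: "x \<in> Y" if "x \<in> YY j r" "r \<in> A" "n \<le> j" for x j r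
    using lev[OF that] by (simp add: Y_level_def)
  define F where "F r = (\<Union>j\<in>{n..}. YY j r)" for r
  have F_sets: "F r \<in> sets M" if "r \<in> A" for r
    unfolding F_def using YY_sets that n by (intro sets.countable_UN') auto
  have finsub: "emeasure M S \<noteq> \<infinity>" if "S \<subseteq> Y" for S
    using emeasure_subset_Y[OF that] by simp
  have inner: "(\<Sum>\<^sub>\<infinity>j\<in>{n..}. measure M (YY j r)) = measure M (F r)" if "r \<in> A" for r
    unfolding F_def
  proof (intro infsumI has_sum_measure_countable_disjoint)
    show "disjoint_family_on (\<lambda>j. YY j r) {n..}"
      using lev[OF _ that] Y_level_unique by (auto simp: disjoint_family_on_def) blast
    show "emeasure M (\<Union>j\<in>{n..}. YY j r) \<noteq> \<infinity>" using inY[OF _ that] by (intro finsub) auto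
  qed (use that n YY_sets in auto)
  have "(\<Sum>\<^sub>\<infinity>r\<in>{r \<in> A. \<psi> r = p}. \<Sum>\<^sub>\<infinity>j\<in>{n..}. measure M (YY j r)) = (\<Sum>\<^sub>\<infinity>r\<in>{r \<in> A. \<psi> r = p}. measure M (F r))"
    using inner by (intro infsum_cong) auto
  also have "\<dots> = measure M (\<Union>r\<in>{r \<in> A. \<psi> r = p}. F r)"
  proof (intro infsumI has_sum_measure_countable_disjoint)
    show "countable {r \<in> A. \<psi> r = p}" by (rule countable_subset[OF _ countable_A]) auto
    show "disjoint_family_on F {r \<in> A. \<psi> r = p}"
      unfolding disjoint_family_on_def
    proof (intro ballI impI equals0I)
      fix r r' x assume r: "r \<in> {r \<in> A. \<psi> r = p}" "r' \<in> {r \<in> A. \<psi> r = p}" "r \<noteq> r'" "x \<in> F r \<inter> F r'"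
      then obtain j j' where j: "n \<le> j" "x \<in> YY j r" "n \<le> j'" "x \<in> YY j' r'" by (auto simp: F_def)
      then have "j = j'" using lev[of x j r] lev[of x j' r'] Y_level_unique r by blast
      then show False using disjoint_family_onD[OF YY_disjoint[of j], of r r'] j n r by auto
    qed
    show "emeasure M (\<Union>r\<in>{r \<in> A. \<psi> r = p}. F r) \<noteq> \<infinity>" using inY by (intro finsub) (auto simp: F_def)
  qed (use F_sets in auto)
  also have "(\<Union>r\<in>{r \<in> A. \<psi> r = p}. F r) = (\<Union>k. Yp p (n + k))"
  proof -
    have "{n..} = range ((+) n)" by (auto simp: image_iff le_iff_add)
    then have "F r = (\<Union>k. YY (n + k) r)" for r by (simp only: F_def image_image)
    then show ?thesis unfolding Yp_def by (simp only:) (rule SUP_commute)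
  qed
  also have "measure M (\<Union>k. Yp p (n + k)) = t p (n - 1)"
  proof -
    have "(\<lambda>k. measure M (Yp p (n + k))) sums measure M (\<Union>k. Yp p (n + k))"
    proof (rule measure_UNION)
      show "range (\<lambda>k. Yp p (n + k)) \<subseteq> sets M" using Yp_sets n by auto
      show "disjoint_family (\<lambda>k. Yp p (n + k))"
        unfolding disjoint_family_on_def
      proof (intro ballI impI equals0I)
        fix k k' x assume "k \<noteq> k'" "x \<in> Yp p (n + k) \<inter> Yp p (n + k')"
        then show False
          using Yp_subset_level[of "n + k" p] Yp_subset_level[of "n + k'" p] Y_level_unique[of x "n + k" "n + k'"] n p by auto
      qed
      show "emeasure M (\<Union>k. Yp p (n + k)) \<noteq> \<infinity>"
        by (intro finsub UN_least Yp_subset_Y) (use n p in auto)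
    qed
    \<comment> \<open>The telescoping series has full value \<open>t p (n - 1)\<close> because
      \<open>t p\<close> tends to 0, which comes from conservativity.\<close>
    moreover have "(\<lambda>k. measure M (Yp p (n + k))) sums (t p (n - 1))"
    proof -
      have "(\<lambda>k. t p (n - 1 + k)) \<longlonglongrightarrow> 0"
        using LIMSEQ_ignore_initial_segment[OF t_tendsto_0[OF p], of "n - 1"] by (simp add: add.commute)
      from telescope_sums'[OF this]
      have "(\<lambda>k. t p (n - 1 + k) - t p (n - 1 + Suc k)) sums t p (n - 1)" by simp
      moreover have "t p (n - 1 + k) - t p (n - 1 + Suc k) = measure M (Yp p (n + k))" for k
        using t_Suc[of "n - 1 + k" p] n p by (simp add: b_def)
      ultimately show ?thesis by simp
    qed
    ultimately show ?thesis by (rule sums_unique2)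
  qed
  finally show ?thesis .
qed

text \<open>The contribution to \<open>G g j\<close> of the excursions of type \<open>p\<close> that
  at time \<open>j\<close> still have \<open>i\<close> steps to go before returning.\<close>

definition D :: "('a \<Rightarrow> real) \<Rightarrow> nat \<Rightarrow> nat \<Rightarrow> nat \<Rightarrow> real" where
  "D g p j i = (\<integral>x. indicator (Yp p (j + i)) x * g ((f ^^ j) x) \<partial>M)"

lemma integrable_indicator_bounded:
  fixes h :: "'a \<Rightarrow> real"
  assumes S: "S \<in> fmeasurable M" and [measurable]: "h \<in> borel_measurable M" and bd: "\<And>x. \<bar>h x\<bar> \<le> B"
  shows "integrable M (\<lambda>x. indicator S x * h x)"
    and "\<bar>\<integral>x. indicator S x * h x \<partial>M\<bar> \<le> B * measure M S"
proof -
  have [measurable]: "S \<in> sets M" using S by auto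
  have B: "0 \<le> B" using bd[of undefined] by linarith
  have iS: "integrable M (\<lambda>x. indicator S x :: real)"
    using S by (simp add: integrable_indicator_iff fmeasurable_def)
  show i: "integrable M (\<lambda>x. indicator S x * h x)"
  proof (rule Bochner_Integration.integrable_bound)
    show "integrable M (\<lambda>x. B * indicator S x :: real)" using iS by simp
    show "AE x in M. norm (indicator S x * h x) \<le> norm (B * indicator S x :: real)"
      using bd B by (intro AE_I2) (auto simp: indicator_def)
  qed measurable
  have "\<bar>\<integral>x. indicator S x * h x \<partial>M\<bar> \<le> (\<integral>x. \<bar>indicator S x * h x\<bar> \<partial>M)"
    using integral_norm_bound[of M "\<lambda>x. indicator S x * h x"] unfolding real_norm_def .
  also have "\<dots> \<le> (\<integral>x. B * indicator S x \<partial>M)"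
    using i iS bd B by (intro integral_mono) (auto simp: indicator_def)
  also have "\<dots> = B * measure M S" by simp
  finally show "\<bar>\<integral>x. indicator S x * h x \<partial>M\<bar> \<le> B * measure M S" .
qed

lemma D_bound:
  assumes [measurable]: "g \<in> borel_measurable M" and "\<And>x. \<bar>g x\<bar> \<le> B" "n0 \<le> i" "p \<in> {1..q}"
  shows "\<bar>D g p j i\<bar> \<le> B * b p (j + i)"
  unfolding D_def b_def using assms by (intro integrable_indicator_bounded(2)[OF Yp_fin]) auto

text \<open>For fixed \<open>i\<close> the types fill \<open>U (j + i - 1) - U (j + i)\<close>, so
  the double sum telescopes. What is left over are the points returning before time
  \<open>j + n0\<close> and those in \<open>U (j + N - 1)\<close>; the bound enlarges both
  slightly.\<close>

lemma G_decomposition: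
  assumes g [measurable]: "g \<in> borel_measurable M" and bd: "\<And>x. \<bar>g x\<bar> \<le> B"
    and j: "1 \<le> j" and N: "n0 \<le> N"
  shows "\<bar>G g j - (\<Sum>i\<in>{n0..<N}. \<Sum>p\<in>{1..q}. D g p j i)\<bar> \<le> B * (u j - u (j + n0)) + B * u N"
proof -
  have B: "0 \<le> B" using bd[of undefined] by linarith
  define I where "I S = (\<integral>x. indicator S x * g ((f ^^ j) x) \<partial>M)" for S
  have int: "integrable M (\<lambda>x. indicator S x * g ((f ^^ j) x))" if "S \<in> fmeasurable M" for S
    using that bd by (intro integrable_indicator_bounded(1)[where B = B]) auto
  have Ibd: "\<bar>I S\<bar> \<le> B * measure M S" if "S \<in> fmeasurable M" for S
    unfolding I_def using that bd by (intro integrable_indicator_bounded(2)) auto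
  have row: "(\<Sum>p\<in>{1..q}. D g p j i) = I (U (j + i - 1)) - I (U (j + i))" if i: "n0 \<le> i" for i
  proof -
    have ind: "(\<Sum>p\<in>{1..q}. indicator (Yp p (j + i)) x) = (indicator (U (j + i - 1)) x - indicator (U (j + i)) x :: real)" for x
    proof -
      have "(\<Sum>p\<in>{1..q}. indicator (Yp p (j + i)) x) = (indicator (\<Union>p\<in>{1..q}. Yp p (j + i)) x :: real)"
        using Yp_disjoint[of "j + i"] i by (intro indicator_UN_disjoint[symmetric]) auto
      also have "(\<Union>p\<in>{1..q}. Yp p (j + i)) = Y_level f Y (Suc (j + i - 1))"
        using Y_level_eq_Yp[of "j + i"] i j by simp
      finally show ?thesis using indicator_Y_level[of "j + i - 1" x] j by simp
    qed
    have "(\<Sum>p\<in>{1..q}. D g p j i) = (\<integral>x. (\<Sum>p\<in>{1..q}. indicator (Yp p (j + i)) x * g ((f ^^ j) x)) \<partial>M)"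
      unfolding D_def using i by (intro Bochner_Integration.integral_sum[symmetric] int Yp_fin) auto
    also have "\<dots> = (\<integral>x. indicator (U (j + i - 1)) x * g ((f ^^ j) x) - indicator (U (j + i)) x * g ((f ^^ j) x) \<partial>M)"
      by (simp only: sum_distrib_right[symmetric] ind left_diff_distrib)
    also have "\<dots> = I (U (j + i - 1)) - I (U (j + i))"
      unfolding I_def by (intro Bochner_Integration.integral_diff int) auto
    finally show ?thesis .
  qed
  have "(\<Sum>i\<in>{n0..<N}. \<Sum>p\<in>{1..q}. D g p j i) = (\<Sum>i\<in>{n0..<N}. I (U (j + i - 1)) - I (U (j + i)))"
    by (intro sum.cong row) auto
  also have "\<dots> = I (U (j + n0 - 1)) - I (U (j + N - 1))"
    using N
  proof (induction N rule: dec_induct)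
    case (step N)
    then show ?case using j by simp
  qed simp
  finally have "G g j - (\<Sum>i\<in>{n0..<N}. \<Sum>p\<in>{1..q}. D g p j i) = (I (U j) - I (U (j + n0 - 1))) + I (U (j + N - 1))"
    by (simp add: G_def I_def)
  moreover have "\<bar>I (U (j + N - 1))\<bar> \<le> B * u N"
  proof -
    have "\<bar>I (U (j + N - 1))\<bar> \<le> B * u (j + N - 1)" unfolding u_def by (rule Ibd) simp
    also have "\<dots> \<le> B * u N" using B j by (intro mult_left_mono u_antimono) auto
    finally show ?thesis .
  qed
  moreover have "\<bar>I (U j) - I (U (j + n0 - 1))\<bar> \<le> B * (u j - u (j + n0))"
  proof -
    have sub: "U (j + n0 - 1) \<subseteq> U j" using n0 by (intro U_mono) auto
    have "indicator (U j) x - indicator (U (j + n0 - 1)) x = (indicator (U j - U (j + n0 - 1)) x :: real)" for x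
      using sub by (auto simp: indicator_def)
    then have "I (U j) - I (U (j + n0 - 1)) = I (U j - U (j + n0 - 1))"
      unfolding I_def by (subst Bochner_Integration.integral_diff[symmetric]) (auto intro!: int simp: left_diff_distrib[symmetric])
    also have "\<bar>\<dots>\<bar> \<le> B * measure M (U j - U (j + n0 - 1))" by (intro Ibd fmeasurable.Diff) auto
    also have "measure M (U j - U (j + n0 - 1)) = u j - u (j + n0 - 1)"
      unfolding u_def by (rule measurable_measure_Diff) (use sub in auto)
    also have "B * (u j - u (j + n0 - 1)) \<le> B * (u j - u (j + n0))"
      using B by (intro mult_left_mono diff_left_mono u_antimono) auto
    finally show ?thesis .
  qed
  ultimately show ?thesis by linarith
qed

section \<open>Jacobians and averages over the pieces\<close>

text \<open>Preimages of null sets are null, so the push-forward of each branch has a density with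
  respect to the finite measure on \<open>XX i p\<close>. The branches are disjoint and countable in
  number, so these densities add up to that of their union.\<close>

lemma density_jacobian:
  assumes J: "jacobian_sums M f n0 q A \<psi> XX YY J" and j: "1 \<le> j" and i: "n0 \<le> i" and p: "p \<in> {1..q}"
  shows "density (restrict_space M (XX i p)) (\<lambda>x. ennreal (J j i p x))
    = distr (restrict_space M (Yp p (j + i))) (restrict_space M (XX i p)) (f ^^ j)"
proof (rule measure_eqI)
  let ?X = "XX i p" and ?R = "restrict_space M (XX i p)" and ?Ap = "{r \<in> A. \<psi> r = p}"
  have X: "?X \<in> sets M" using XX_sets[OF i p] .
  have X': "?X \<inter> space M \<in> sets M" using X by simp
  have [measurable]: "J j i p \<in> borel_measurable ?R" using J j i p by (auto simp: jacobian_sums_def)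
  have Ji: "AE x in ?R. ennreal (J j i p x) = (\<Sum>\<^sub>\<infinity>r\<in>?Ap. pushforward_density M (f ^^ j) (YY (j + i) r) ?X x)"
    using J j i p unfolding jacobian_sums_def by blast
  have maps: "(f ^^ j) \<in> YY (j + i) r \<rightarrow> ?X" if "r \<in> ?Ap" for r
    using YY_bij[of j i r] that j i by (auto simp: bij_betw_def)
  have mr: "(f ^^ j) \<in> measurable (restrict_space M (YY (j + i) r)) ?R" if "r \<in> ?Ap" for r
    by (rule measurable_restrict_space3[OF fn_measurable maps[OF that]])
  have mY: "(f ^^ j) \<in> measurable (restrict_space M (Yp p (j + i))) ?R"
    by (rule measurable_restrict_space3[OF fn_measurable]) (use Yp_maps_to[OF j i] in auto)
  have fr: "finite_measure ?R"
    by (rule finite_measureI) (use XX_fin[OF i p] X' sets.sets_into_space[OF X] in \<open>simp add: emeasure_restrict_space space_restrict_space fmeasurableD2 Int_absorb2\<close>)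
  interpret R: finite_measure ?R by fact
  show "sets (density ?R (\<lambda>x. ennreal (J j i p x))) = sets (distr (restrict_space M (Yp p (j + i))) ?R (f ^^ j))" by simp
  fix B assume "B \<in> sets (density ?R (\<lambda>x. ennreal (J j i p x)))"
  then have B: "B \<in> sets ?R" by simp
  then have BX: "B \<subseteq> ?X" and BM: "B \<in> sets M" using X by (auto simp: sets_restrict_space_iff[OF X'])
  have pre: "emeasure (distr (restrict_space M S) ?R (f ^^ j)) B = emeasure M ((f ^^ j) -` B \<inter> S)"
    if S: "S \<in> sets M" "(f ^^ j) \<in> measurable (restrict_space M S) ?R" for S
    using S B sets.sets_into_space[OF S(1)] by (subst emeasure_distr) (auto simp: emeasure_restrict_space space_restrict_space Int_absorb2)
  have piece: "(\<integral>\<^sup>+x. pushforward_density M (f ^^ j) (YY (j + i) r) ?X x * indicator B x \<partial>?R) = emeasure M ((f ^^ j) -` B \<inter> YY (j + i) r)"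
    if r: "r \<in> ?Ap" for r
  proof -
    let ?N = "distr (restrict_space M (YY (j + i) r)) ?R (f ^^ j)"
    have Ys: "YY (j + i) r \<in> sets M" using YY_sets r i by auto
    have "absolutely_continuous ?R ?N"
      unfolding absolutely_continuous_def
    proof
      fix S assume S: "S \<in> null_sets ?R"
      then have S0: "S \<subseteq> ?X" "S \<in> null_sets M" by (auto simp: null_sets_restrict_space[OF X])
      have "emeasure ?N S = emeasure (restrict_space M (YY (j + i) r)) ((f ^^ j) -` S \<inter> space (restrict_space M (YY (j + i) r)))"
        using S mr[OF r] by (intro emeasure_distr) auto
      also have "\<dots> \<le> emeasure M ((f ^^ j) -` S \<inter> space M)"
        using Ys sets.sets_into_space[OF Ys] S0 by (subst emeasure_restrict_space) (auto simp: space_restrict_space intro!: emeasure_mono)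
      also have "\<dots> = 0" using S0 by (simp add: emeasure_vimage_fn null_setsD1 null_setsD2)
      finally show "S \<in> null_sets ?N" using S by (auto simp: null_sets_def)
    qed
    then have "density ?R (RN_deriv ?R ?N) = ?N" by (rule R.density_RN_deriv) simp
    then have "(\<integral>\<^sup>+x. RN_deriv ?R ?N x * indicator B x \<partial>?R) = emeasure ?N B"
      using B by (metis borel_measurable_RN_deriv emeasure_density)
    then show ?thesis using pre[OF Ys mr[OF r]] by (simp add: pushforward_density_def)
  qed
  have cA: "countable ?Ap" by (rule countable_subset[OF _ countable_A]) auto
  have "emeasure (density ?R (\<lambda>x. ennreal (J j i p x))) B = (\<integral>\<^sup>+x. ennreal (J j i p x) * indicator B x \<partial>?R)"
    using B by (intro emeasure_density) auto
  also have "\<dots> = (\<integral>\<^sup>+x. (\<Sum>\<^sub>\<infinity>r\<in>?Ap. pushforward_density M (f ^^ j) (YY (j + i) r) ?X x * indicator B x) \<partial>?R)"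
  proof (rule nn_integral_cong_AE)
    show "AE x in ?R. ennreal (J j i p x) * indicator B x = (\<Sum>\<^sub>\<infinity>r\<in>?Ap. pushforward_density M (f ^^ j) (YY (j + i) r) ?X x * indicator B x)"
      using Ji by eventually_elim (auto simp: indicator_def)
  qed
  also have "\<dots> = (\<Sum>\<^sub>\<infinity>r\<in>?Ap. \<integral>\<^sup>+x. pushforward_density M (f ^^ j) (YY (j + i) r) ?X x * indicator B x \<partial>?R)"
    using B by (intro nn_integral_infsum[OF cA]) (auto simp: pushforward_density_def)
  also have "\<dots> = (\<Sum>\<^sub>\<infinity>r\<in>?Ap. emeasure M ((f ^^ j) -` B \<inter> YY (j + i) r))"
    by (intro infsum_cong piece)
  also have "\<dots> = emeasure M (\<Union>r\<in>?Ap. (f ^^ j) -` B \<inter> YY (j + i) r)"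
  proof (rule emeasure_UN_countable_infsum[OF cA, symmetric])
    show "disjoint_family_on (\<lambda>r. (f ^^ j) -` B \<inter> YY (j + i) r) ?Ap"
      using YY_disjoint[of "j + i"] i by (auto simp: disjoint_family_on_def)
    show "(f ^^ j) -` B \<inter> YY (j + i) r \<in> sets M" if "r \<in> ?Ap" for r
    proof -
      have Ys: "YY (j + i) r \<in> sets M" using YY_sets that i by auto
      have "(f ^^ j) -` B \<inter> YY (j + i) r = ((f ^^ j) -` B \<inter> space M) \<inter> YY (j + i) r"
        using sets.sets_into_space[OF Ys] by auto
      then show ?thesis using measurable_sets[OF fn_measurable BM] Ys by auto
    qed
  qed
  also have "(\<Union>r\<in>?Ap. (f ^^ j) -` B \<inter> YY (j + i) r) = (f ^^ j) -` B \<inter> Yp p (j + i)"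
    by (auto simp: Yp_def)
  also have "emeasure M \<dots> = emeasure (distr (restrict_space M (Yp p (j + i))) ?R (f ^^ j)) B"
    by (rule pre[symmetric]) (use Yp_sets i mY in auto)
  finally show "emeasure (density ?R (\<lambda>x. ennreal (J j i p x))) B = emeasure (distr (restrict_space M (Yp p (j + i))) ?R (f ^^ j)) B" .
qed

end


context level_system
begin

lemma jacobian_integral:
  assumes J: "jacobian_sums M f n0 q A \<psi> XX YY J" and j: "1 \<le> j" and i: "n0 \<le> i" and p: "p \<in> {1..q}"
    and g [measurable]: "g \<in> borel_measurable M" and bd: "\<And>x. \<bar>g x\<bar> \<le> B"
  shows "integrable M (\<lambda>x. indicator (XX i p) x * (J j i p x * g x))"
    and "D g p j i = (\<integral>x. indicator (XX i p) x * (J j i p x * g x) \<partial>M)"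
proof -
  let ?R = "restrict_space M (XX i p)" and ?S = "restrict_space M (Yp p (j + i))"
  have X: "XX i p \<inter> space M \<in> sets M" using XX_sets[OF i p] by simp
  have Y: "Yp p (j + i) \<inter> space M \<in> sets M" using Yp_sets[of "j + i" p] i by simp
  have [measurable]: "J j i p \<in> borel_measurable ?R" and Jpos: "\<And>x. x \<in> XX i p \<Longrightarrow> 0 < J j i p x"
    using J j i p by (auto simp: jacobian_sums_def)
  have J0: "AE x in ?R. 0 \<le> J j i p x"
    using Jpos by (intro AE_I2) (auto simp: space_restrict_space less_imp_le)
  have gR: "g \<in> borel_measurable ?R" by (rule measurable_restrict_space1) measurable
  have mY: "(f ^^ j) \<in> measurable ?S ?R"
    by (rule measurable_restrict_space3[OF fn_measurable]) (use Yp_maps_to[OF j i] in auto)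
  note dens = density_jacobian[OF J j i p]
  have iY: "integrable M (\<lambda>x. indicator (Yp p (j + i)) x * g ((f ^^ j) x))"
    using i p bd by (intro integrable_indicator_bounded(1)[OF Yp_fin]) auto
  then have "integrable ?S (\<lambda>x. g ((f ^^ j) x))"
    using integrable_restrict_space[OF Y, of "\<lambda>x. g ((f ^^ j) x)"] by simp
  then have "integrable (distr ?S ?R (f ^^ j)) g"
    using integrable_distr_eq[OF mY gR] by simp
  then have "integrable ?R (\<lambda>x. J j i p x *\<^sub>R g x)"
    unfolding dens[symmetric] using integrable_density[OF gR _ J0] by simp
  then show "integrable M (\<lambda>x. indicator (XX i p) x * (J j i p x * g x))"
    using integrable_restrict_space[OF X, of "\<lambda>x. J j i p x * g x"] by simp
  have "D g p j i = integral\<^sup>L ?S (\<lambda>x. g ((f ^^ j) x))"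
    using integral_restrict_space[OF Y, of "\<lambda>x. g ((f ^^ j) x)"] by (simp add: D_def)
  also have "\<dots> = integral\<^sup>L (density ?R (\<lambda>x. ennreal (J j i p x))) g"
    unfolding dens by (rule integral_distr[OF mY gR, symmetric])
  also have "\<dots> = integral\<^sup>L ?R (\<lambda>x. J j i p x *\<^sub>R g x)"
    by (rule integral_density[OF gR _ J0]) measurable
  also have "\<dots> = (\<integral>x. indicator (XX i p) x * (J j i p x * g x) \<partial>M)"
    using integral_restrict_space[OF X, of "\<lambda>x. J j i p x * g x"] by simp
  finally show "D g p j i = (\<integral>x. indicator (XX i p) x * (J j i p x * g x) \<partial>M)" .
qed

text \<open>If \<open>t p i = 0\<close> the division yields 0; the integral then vanishes too, so
  the product with \<open>t p i\<close> is the integral in every case.\<close>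

definition avg :: "('a \<Rightarrow> real) \<Rightarrow> nat \<Rightarrow> nat \<Rightarrow> real" where
  "avg g p i = (\<integral>x. indicator (XX i p) x * g x \<partial>M) / t p i"

lemma avg_times_t:
  assumes [measurable]: "g \<in> borel_measurable M" and bd: "\<And>x. \<bar>g x\<bar> \<le> B" and i: "n0 \<le> i" and p: "p \<in> {1..q}"
  shows "avg g p i * t p i = (\<integral>x. indicator (XX i p) x * g x \<partial>M)" and "\<bar>avg g p i\<bar> \<le> B"
proof -
  have le: "\<bar>\<integral>x. indicator (XX i p) x * g x \<partial>M\<bar> \<le> B * t p i"
    unfolding t_def using bd by (intro integrable_indicator_bounded(2)[OF XX_fin[OF i p]]) auto
  show "avg g p i * t p i = (\<integral>x. indicator (XX i p) x * g x \<partial>M)"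
    using le by (auto simp: avg_def)
  have "0 \<le> B" using bd[of undefined] by linarith
  then show "\<bar>avg g p i\<bar> \<le> B"
    using le t_nonneg[of p i] by (cases "t p i = 0") (auto simp: avg_def field_simps)
qed

text \<open>If \<open>J\<close> stays within \<sigma> of the constant \<open>c\<close>, then
  \<open>D g\<close> is \<open>c\<close> times the integral of \<open>g\<close> up to
  \<open>B * t p i * \<sigma>\<close>. For the function 1 this says that \<open>b p (j + i)\<close>
  is close to \<open>c * t p i\<close>. Eliminating \<open>c\<close> between the two estimates
  doubles the error.\<close>

lemma D_near_average:
  assumes J: "jacobian_sums M f n0 q A \<psi> XX YY J" and j: "1 \<le> j" and i: "n0 \<le> i" and p: "p \<in> {1..q}"
    and g [measurable]: "g \<in> borel_measurable M" and bd: "\<And>x. \<bar>g x\<bar> \<le> B"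
    and fin: "(SUP x\<in>XX i p. ennreal \<bar>J j i p x - c\<bar>) \<noteq> \<infinity>"
  shows "\<bar>D g p j i - avg g p i * b p (j + i)\<bar> \<le> 2 * B * t p i * enn2real (SUP x\<in>XX i p. ennreal \<bar>J j i p x - c\<bar>)"
proof -
  define \<sigma> where "\<sigma> = enn2real (SUP x\<in>XX i p. ennreal \<bar>J j i p x - c\<bar>)"
  have \<sigma>: "\<bar>J j i p x - c\<bar> \<le> \<sigma>" if "x \<in> XX i p" for x
  proof -
    have "ennreal \<bar>J j i p x - c\<bar> \<le> (SUP x\<in>XX i p. ennreal \<bar>J j i p x - c\<bar>)" using that by (rule SUP_upper)
    also have "\<dots> = ennreal \<sigma>"
      unfolding \<sigma>_def using fin by (intro ennreal_enn2real[symmetric]) (simp only: less_top infinity_ennreal_def)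
    finally have "ennreal \<bar>J j i p x - c\<bar> \<le> ennreal \<sigma>" .
    moreover have "0 \<le> \<sigma>" by (simp add: \<sigma>_def)
    ultimately show ?thesis by simp
  qed
  have near: "\<bar>D h p j i - c * (\<integral>x. indicator (XX i p) x * h x \<partial>M)\<bar> \<le> B' * t p i * \<sigma>"
    if h [measurable]: "h \<in> borel_measurable M" and hb: "\<And>x. \<bar>h x\<bar> \<le> B'" for h B'
  proof -
    have B': "0 \<le> B'" using hb[of undefined] by linarith
    have \<sigma>0: "0 \<le> \<sigma>" by (simp add: \<sigma>_def)
    note iJ = jacobian_integral[OF J j i p h hb]
    have ih: "integrable M (\<lambda>x. indicator (XX i p) x * h x)"
      using hb by (intro integrable_indicator_bounded(1)[OF XX_fin[OF i p]]) auto
    have i1: "integrable M (\<lambda>x. indicator (XX i p) x * (B' * \<sigma>))"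
      using B' \<sigma>0 by (intro integrable_indicator_bounded(1)[OF XX_fin[OF i p], where B = "B' * \<sigma>"]) auto
    have "D h p j i - c * (\<integral>x. indicator (XX i p) x * h x \<partial>M)
        = (\<integral>x. indicator (XX i p) x * (J j i p x * h x) - c * (indicator (XX i p) x * h x) \<partial>M)"
      using iJ ih by simp
    also have "\<bar>\<dots>\<bar> \<le> (\<integral>x. \<bar>indicator (XX i p) x * (J j i p x * h x) - c * (indicator (XX i p) x * h x)\<bar> \<partial>M)"
      using integral_norm_bound[of M "\<lambda>x. indicator (XX i p) x * (J j i p x * h x) - c * (indicator (XX i p) x * h x)"] unfolding real_norm_def .
    also have "\<dots> \<le> (\<integral>x. indicator (XX i p) x * (B' * \<sigma>) \<partial>M)"
    proof (rule integral_mono)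
      show "integrable M (\<lambda>x. \<bar>indicator (XX i p) x * (J j i p x * h x) - c * (indicator (XX i p) x * h x)\<bar>)"
        using iJ(1) ih by auto
      show "\<bar>indicator (XX i p) x * (J j i p x * h x) - c * (indicator (XX i p) x * h x)\<bar> \<le> indicator (XX i p) x * (B' * \<sigma>)" for x
      proof (cases "x \<in> XX i p")
        case True
        have "\<bar>J j i p x * h x - c * h x\<bar> = \<bar>h x\<bar> * \<bar>J j i p x - c\<bar>" by (simp add: abs_mult[symmetric] algebra_simps)
        also have "\<dots> \<le> B' * \<sigma>" using \<sigma>[OF True] hb B' by (intro mult_mono) auto
        finally show ?thesis using True by simp
      qed simp
    qed (rule i1)
    also have "\<dots> = B' * t p i * \<sigma>" using XX_sets[OF i p] by (simp add: t_def)
    finally show ?thesis .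
  qed
  have D1: "D (\<lambda>_. 1) p j i = b p (j + i)" using Yp_sets[of "j + i" p] i by (simp add: D_def b_def)
  have t1: "(\<integral>x. indicator (XX i p) x * 1 \<partial>M) = t p i" using XX_sets[OF i p] by (simp add: t_def)
  have 1: "\<bar>D g p j i - c * (avg g p i * t p i)\<bar> \<le> B * t p i * \<sigma>"
    using near[OF g bd] avg_times_t(1)[OF g bd i p] by simp
  have "\<bar>b p (j + i) - c * t p i\<bar> \<le> 1 * t p i * \<sigma>"
    using near[of "\<lambda>_. 1" 1] unfolding D1 t1 by simp
  then have "\<bar>avg g p i\<bar> * \<bar>b p (j + i) - c * t p i\<bar> \<le> B * (t p i * \<sigma>)"
    using avg_times_t(2)[OF g bd i p] t_nonneg[of p i] by (intro mult_mono) (auto simp: \<sigma>_def)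
  then have "\<bar>avg g p i * b p (j + i) - c * (avg g p i * t p i)\<bar> \<le> B * t p i * \<sigma>"
    by (simp add: abs_mult[symmetric] algebra_simps)
  with 1 show ?thesis unfolding \<sigma>_def[symmetric] by linarith
qed

text \<open>In the window i > \<epsilon> j the factor \<open>t p i\<close> is O(j^(-alpha)) with a
  constant depending on \<epsilon>, and the suprema multiplying it have a sum tending to 0.\<close>

lemma jacobian_window_error:
  assumes J: "jacobian_sums M f n0 q A \<psi> XX YY J" and p: "p \<in> {1..q}" and \<alpha>: "0 < \<alpha>"
    and g: "g \<in> borel_measurable M" and bd: "\<And>x. \<bar>g x\<bar> \<le> B"
    and uC: "\<And>j. u j \<le> Cu * real (Suc j) powr (- \<alpha>)"
    and jac: "(\<lambda>j. \<Sum>i | \<epsilon> * real j < real i \<and> real i < inverse \<epsilon> * real j.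
             SUP x\<in>XX i p. ennreal \<bar>J j i p x - c j i p\<bar>) \<longlonglongrightarrow> 0"
    and \<epsilon>: "0 < \<epsilon>" "\<epsilon> < 1" and \<delta>: "0 < \<delta>"
  shows "eventually (\<lambda>j. (\<Sum>i | \<epsilon> * real j < real i \<and> real i < inverse \<epsilon> * real j. \<bar>D g p j i - avg g p i * b p (j + i)\<bar>)
         \<le> \<delta> * real (Suc j) powr (- \<alpha>)) sequentially"
proof -
  have B: "0 \<le> B" using bd[of undefined] by linarith
  have Cu: "0 \<le> Cu" using uC[of 0] u_nonneg[of 0] by simp
  define C where "C = 2 * B * Cu * \<epsilon> powr (- \<alpha>)"
  have C: "0 \<le> C" using B Cu by (simp add: C_def)
  define \<eta> where "\<eta> = \<delta> / (C + 1)"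
  have \<eta>: "0 < \<eta>" "C * \<eta> \<le> \<delta>" using \<delta> C by (auto simp: \<eta>_def field_simps)
  have "eventually (\<lambda>j. (\<Sum>i | \<epsilon> * real j < real i \<and> real i < inverse \<epsilon> * real j.
             SUP x\<in>XX i p. ennreal \<bar>J j i p x - c j i p\<bar>) < ennreal \<eta>) sequentially"
    using jac \<eta>(1) by (intro order_tendstoD(2)) auto
  \<comment> \<open>From here on the window lies above \<open>n0\<close>, where the decomposition is
    meaningful.\<close>
  moreover have "eventually (\<lambda>j. nat \<lceil>real n0 / \<epsilon>\<rceil> \<le> j \<and> 1 \<le> j) sequentially"
    by (intro eventually_conj eventually_ge_at_top)
  ultimately show ?thesis
  proof eventually_elim
    case (elim j)
    let ?I = "{i. \<epsilon> * real j < real i \<and> real i < inverse \<epsilon> * real j}"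
    let ?S = "\<lambda>i. SUP x\<in>XX i p. ennreal \<bar>J j i p x - c j i p\<bar>"
    have finI: "finite ?I"
    proof (rule finite_subset)
      show "?I \<subseteq> {..nat \<lceil>inverse \<epsilon> * real j\<rceil>}"
      proof
        fix i assume "i \<in> ?I"
        then have "real i < inverse \<epsilon> * real j" by blast
        then show "i \<in> {..nat \<lceil>inverse \<epsilon> * real j\<rceil>}" unfolding atMost_iff by linarith
      qed
    qed simp
    have "real n0 / \<epsilon> \<le> real j" using elim by linarith
    then have "real n0 \<le> \<epsilon> * real j" using \<epsilon> by (simp add: field_simps)
    then have n0i: "n0 \<le> i" if "i \<in> ?I" for i using that by force
    \<comment> \<open>A supremum could be infinite for small \<open>j\<close>; smallness of the
      whole sum excludes it, so real values may be used.\<close>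
    have Sfin: "?S i < \<infinity>" if "i \<in> ?I" for i
    proof -
      have "?S i \<le> (\<Sum>i\<in>?I. ?S i)" by (rule member_le_sum[OF that _ finI]) simp
      also have "\<dots> < ennreal \<eta>" using elim(1) .
      also have "\<dots> < \<infinity>" by simp
      finally show ?thesis .
    qed
    have piece: "\<bar>D g p j i - avg g p i * b p (j + i)\<bar> \<le> (C * real (Suc j) powr (- \<alpha>)) * enn2real (?S i)" if i: "i \<in> ?I" for i
    proof -
      have "t p i \<le> Cu * real (Suc i) powr (- \<alpha>)" using t_le_u[OF n0i[OF i] p] uC[of i] by linarith
      also have "\<dots> \<le> Cu * (\<epsilon> * real (Suc j)) powr (- \<alpha>)"
      proof (intro mult_left_mono powr_mono2')
        show "\<epsilon> * real (Suc j) \<le> real (Suc i)" using i \<epsilon> by (auto simp: algebra_simps)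
      qed (use \<epsilon> \<alpha> Cu in auto)
      also have "\<dots> = Cu * \<epsilon> powr (- \<alpha>) * real (Suc j) powr (- \<alpha>)" using \<epsilon> by (simp add: powr_mult)
      finally have "2 * B * t p i \<le> 2 * B * (Cu * \<epsilon> powr (- \<alpha>) * real (Suc j) powr (- \<alpha>))"
        using B by (intro mult_left_mono) auto
      then have tC: "2 * B * t p i \<le> C * real (Suc j) powr (- \<alpha>)" by (simp add: C_def mult_ac)
      have "\<bar>D g p j i - avg g p i * b p (j + i)\<bar> \<le> 2 * B * t p i * enn2real (?S i)"
        by (rule D_near_average[OF J conjunct2[OF elim(2)] n0i[OF i] p g bd less_imp_neq[OF Sfin[OF i]]])
      also have "\<dots> \<le> (C * real (Suc j) powr (- \<alpha>)) * enn2real (?S i)"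
        using tC by (intro mult_right_mono) auto
      finally show ?thesis .
    qed
    have "(\<Sum>i\<in>?I. \<bar>D g p j i - avg g p i * b p (j + i)\<bar>) \<le> (\<Sum>i\<in>?I. (C * real (Suc j) powr (- \<alpha>)) * enn2real (?S i))"
      by (intro sum_mono piece)
    also have "\<dots> = (C * real (Suc j) powr (- \<alpha>)) * (\<Sum>i\<in>?I. enn2real (?S i))"
      by (simp only: sum_distrib_left)
    also have "(\<Sum>i\<in>?I. enn2real (?S i)) = enn2real (\<Sum>i\<in>?I. ?S i)"
      using enn2real_sum[of ?I ?S, OF Sfin[unfolded infinity_ennreal_def]] unfolding comp_def by (rule sym)
    also have "(C * real (Suc j) powr (- \<alpha>)) * enn2real (\<Sum>i\<in>?I. ?S i) \<le> (C * real (Suc j) powr (- \<alpha>)) * \<eta>"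
    proof (intro mult_left_mono)
      show "enn2real (\<Sum>i\<in>?I. ?S i) \<le> \<eta>" using elim \<eta>(1) by (intro enn2real_leI) auto
    qed (use C in auto)
    also have "\<dots> = (C * \<eta>) * real (Suc j) powr (- \<alpha>)" by simp
    also have "\<dots> \<le> \<delta> * real (Suc j) powr (- \<alpha>)" using \<eta> by (intro mult_right_mono) auto
    finally show ?case .
  qed
qed

text \<open>The tail starting at \<open>Suc n\<close> equals \<open>t p n\<close>, which is why the
  normalisation uses \<open>Suc i\<close>.\<close>

lemma t_asymptotics:
  assumes p: "p \<in> {1..q}" and \<gamma>: "0 < \<gamma>"
    and tails: "(\<lambda>n. \<Sum>\<^sub>\<infinity>r\<in>{r \<in> A. \<psi> r = p}. \<Sum>\<^sub>\<infinity>j\<in>{n..}. measure M (YY j r))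
        \<sim>[sequentially] (\<lambda>n. \<gamma> * real n powr (- \<alpha>))"
  shows "(\<lambda>i. t p i * real (Suc i) powr \<alpha>) \<longlonglongrightarrow> \<gamma>"
proof -
  let ?T = "\<lambda>n. \<Sum>\<^sub>\<infinity>r\<in>{r \<in> A. \<psi> r = p}. \<Sum>\<^sub>\<infinity>j\<in>{n..}. measure M (YY j r)"
  have "(\<lambda>n. if ?T n = 0 \<and> \<gamma> * real n powr (- \<alpha>) = 0 then 1 else ?T n / (\<gamma> * real n powr (- \<alpha>))) \<longlonglongrightarrow> 1"
    using tails unfolding asymp_equiv_def .
  from LIMSEQ_Suc[OF this]
  have "(\<lambda>n. if ?T (Suc n) = 0 \<and> \<gamma> * real (Suc n) powr (- \<alpha>) = 0 then 1 else ?T (Suc n) / (\<gamma> * real (Suc n) powr (- \<alpha>))) \<longlonglongrightarrow> 1" .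
  moreover have "eventually (\<lambda>n. (if ?T (Suc n) = 0 \<and> \<gamma> * real (Suc n) powr (- \<alpha>) = 0 then 1 else ?T (Suc n) / (\<gamma> * real (Suc n) powr (- \<alpha>)))
      = (t p n * real (Suc n) powr \<alpha>) / \<gamma>) sequentially"
    using eventually_ge_at_top[of n0]
  proof eventually_elim
    case (elim n)
    have "?T (Suc n) = t p n" using tail_sum_eq[of "Suc n" p] elim p by simp
    moreover have "\<gamma> * real (Suc n) powr (- \<alpha>) \<noteq> 0" using \<gamma> by simp
    ultimately show ?case by (simp add: powr_minus divide_inverse)
  qed
  ultimately have "(\<lambda>n. (t p n * real (Suc n) powr \<alpha>) / \<gamma>) \<longlonglongrightarrow> 1"
    by (simp only: filterlim_cong[OF refl refl])
  from tendsto_mult_right[OF this, of \<gamma>] show ?thesis using \<gamma> by simp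
qed

end


context level_system
begin

section \<open>Decay of the return time tail and cancellation in the observable\<close>

lemma u_asymptotics:
  assumes lim: "\<And>p. p \<in> {1..q} \<Longrightarrow> (\<lambda>i. t p i * real (Suc i) powr \<alpha>) \<longlonglongrightarrow> \<gamma> p"
  shows "(\<lambda>j. u j * real (Suc j) powr \<alpha>) \<longlonglongrightarrow> (\<Sum>p\<in>{1..q}. \<gamma> p)"
proof -
  have "(\<lambda>j. \<Sum>p\<in>{1..q}. t p j * real (Suc j) powr \<alpha>) \<longlonglongrightarrow> (\<Sum>p\<in>{1..q}. \<gamma> p)"
    by (intro tendsto_sum lim)
  moreover have "eventually (\<lambda>j. (\<Sum>p\<in>{1..q}. t p j * real (Suc j) powr \<alpha>) = u j * real (Suc j) powr \<alpha>) sequentially"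
    using eventually_ge_at_top[of n0]
  proof eventually_elim
    case (elim j)
    show ?case unfolding u_eq_sum_t[OF elim] by (rule sum_distrib_right[symmetric])
  qed
  ultimately show ?thesis by (rule Lim_transform_eventually)
qed

lemma u_powr_bound:
  assumes "\<And>p. p \<in> {1..q} \<Longrightarrow> (\<lambda>i. t p i * real (Suc i) powr \<alpha>) \<longlonglongrightarrow> \<gamma> p"
  obtains C where "\<And>j. u j \<le> C * real (Suc j) powr (- \<alpha>)"
proof -
  have "Bseq (\<lambda>j. u j * real (Suc j) powr \<alpha>)"
    using convergent_imp_Bseq[OF convergentI[OF u_asymptotics[OF assms]]] .
  then obtain C where C: "\<And>j. norm (u j * real (Suc j) powr \<alpha>) \<le> C" unfolding Bseq_def by blast
  have "u j \<le> C * real (Suc j) powr (- \<alpha>)" for j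
  proof -
    have "u j * real (Suc j) powr \<alpha> \<le> C" using C[of j] by (simp del: of_nat_Suc)
    then have "u j \<le> C / real (Suc j) powr \<alpha>" by (simp add: pos_le_divide_eq del: of_nat_Suc)
    then show ?thesis by (simp add: powr_minus divide_inverse)
  qed
  then show ?thesis by (rule that)
qed

lemma X_level_disjoint: "disjoint_family_on (X_level M f Y) S"
  by (auto simp: disjoint_family_on_def X_level_def)

lemma measure_X_levels: "measure M (\<Union>i\<in>{1..n}. X_level M f Y i) = (\<Sum>i=1..n. u i)"
proof -
  have "measure M (\<Union>i\<in>{1..n}. X_level M f Y i) = (\<Sum>i=1..n. measure M (X_level M f Y i))"
    using fmeasurableD2[OF X_level_fmeasurable] fmeasurableD[OF X_level_fmeasurable]
    by (intro measure_finite_Union X_level_disjoint) auto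
  also have "\<dots> = (\<Sum>i=1..n. u i)"
  proof (rule sum.cong[OF refl])
    fix i assume "i \<in> {1..n}"
    then show "measure M (X_level M f Y i) = u i" using measure_X_level[of "i - 1"] by simp
  qed
  finally show ?thesis .
qed

lemma X_levels_fmeasurable: "(\<Union>i\<in>{1..n}. X_level M f Y i) \<in> fmeasurable M"
  by (intro fmeasurable.finite_UN X_level_fmeasurable) auto

text \<open>Average zero makes the integral over the first \<open>n\<close> levels small compared
  with their measure, and this measure is at most \<open>Cu * psum \<alpha> (Suc n)\<close>.
  Finitely many \<open>n\<close> are covered by \<open>C1\<close>; the levels below
  \<open>n0\<close>, absent from the sum over types, by \<open>C2\<close>.\<close>

lemma observable_partial_sums_small:
  assumes g [measurable]: "g \<in> borel_measurable M" and bd: "\<And>x. \<bar>g x\<bar> \<le> B"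
    and avg0: "(\<lambda>n. (LINT x:(\<Union>i\<in>{1..n}. X_level M f Y i)|M. g x)
            / measure M (\<Union>i\<in>{1..n}. X_level M f Y i)) \<longlonglongrightarrow> 0"
    and uC: "\<And>j. u j \<le> Cu * real (Suc j) powr (- \<alpha>)" and \<delta>: "0 < \<delta>"
  shows "\<exists>C. \<forall>N. \<bar>\<Sum>i<N. if n0 \<le> i then \<Sum>p\<in>{1..q}. avg g p i * t p i else 0\<bar> \<le> \<delta> * psum \<alpha> N + C"
proof -
  define X where "X i = (\<integral>x. indicator (X_level M f Y i) x * g x \<partial>M)" for i
  let ?V = "\<lambda>n. \<Union>i\<in>{1..n}. X_level M f Y i"
  define R where "R n = (LINT x:?V n|M. g x) / measure M (?V n)" for n
  have Cu: "0 \<le> Cu" using uC[of 0] u_nonneg[of 0] by simp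
  have row: "(\<Sum>p\<in>{1..q}. avg g p i * t p i) = X i" if i: "n0 \<le> i" for i
  proof -
    have "(\<Sum>p\<in>{1..q}. avg g p i * t p i) = (\<Sum>p\<in>{1..q}. \<integral>x. indicator (XX i p) x * g x \<partial>M)"
      by (intro sum.cong refl avg_times_t(1)[OF g bd i])
    also have "\<dots> = (\<integral>x. (\<Sum>p\<in>{1..q}. indicator (XX i p) x * g x) \<partial>M)"
      using i bd by (intro Bochner_Integration.integral_sum[symmetric] integrable_indicator_bounded(1)[where B = B] XX_fin) auto
    also have "\<dots> = X i"
      unfolding X_def X_level_eq[OF i] sum_distrib_right[symmetric]
      by (simp only: indicator_UN_disjoint[OF finite_atLeastAtMost XX_disjoint[OF i]])
    finally show ?thesis .
  qed
  have num: "(LINT x:?V n|M. g x) = (\<Sum>i=1..n. X i)" for n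
  proof -
    have "(LINT x:?V n|M. g x) = (\<integral>x. (\<Sum>i\<in>{1..n}. indicator (X_level M f Y i) x * g x) \<partial>M)"
      unfolding set_lebesgue_integral_def sum_distrib_right[symmetric] real_scaleR_def
      by (simp only: indicator_UN_disjoint[OF finite_atLeastAtMost X_level_disjoint])
    also have "\<dots> = (\<Sum>i=1..n. X i)"
      unfolding X_def using bd by (intro Bochner_Integration.integral_sum integrable_indicator_bounded(1)[where B = B] X_level_fmeasurable) auto
    finally show ?thesis .
  qed
  define \<eta> where "\<eta> = \<delta> / (Cu + 1)"
  have \<eta>: "0 < \<eta>" "\<eta> * Cu \<le> \<delta>" using \<delta> Cu by (auto simp: \<eta>_def field_simps)
  obtain n1 where n1: "\<And>n. n1 \<le> n \<Longrightarrow> \<bar>R n\<bar> < \<eta>"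
    using LIMSEQ_D[OF avg0 \<eta>(1)] by (auto simp: R_def)
  define C1 where "C1 = (\<Sum>n<n1. \<bar>\<Sum>i=1..n. X i\<bar>)"
  have bound: "\<bar>\<Sum>i=1..n. X i\<bar> \<le> \<delta> * psum \<alpha> (Suc n) + C1" for n
  proof (cases "n1 \<le> n")
    case True
    \<comment> \<open>When the measure is 0 the quotient is 0 by convention, but the integral
      vanishes as well.\<close>
    have "\<bar>\<Sum>i=1..n. X i\<bar> \<le> \<bar>R n\<bar> * measure M (?V n)"
    proof (cases "measure M (?V n) = 0")
      case True
      have "\<bar>\<integral>x. indicator (?V n) x * g x \<partial>M\<bar> \<le> B * measure M (?V n)"
        by (rule integrable_indicator_bounded(2)[OF X_levels_fmeasurable g bd])
      then show ?thesis using True num[of n] by (simp add: set_lebesgue_integral_def)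
    next
      case False
      then show ?thesis unfolding R_def num by (simp add: abs_divide)
    qed
    also have "\<dots> \<le> \<eta> * (Cu * psum \<alpha> (Suc n))"
    proof (intro mult_mono)
      have "(\<Sum>i=1..n. u i) \<le> (\<Sum>i<Suc n. u i)"
        by (intro sum_mono2) (auto simp: u_nonneg)
      also have "\<dots> \<le> (\<Sum>i<Suc n. Cu * real (Suc i) powr (- \<alpha>))" by (intro sum_mono uC)
      also have "\<dots> = Cu * psum \<alpha> (Suc n)" unfolding psum_def by (simp only: sum_distrib_left)
      finally show "measure M (?V n) \<le> Cu * psum \<alpha> (Suc n)" by (simp only: measure_X_levels)
    qed (use n1[OF True] \<eta> in auto)
    also have "\<dots> = (\<eta> * Cu) * psum \<alpha> (Suc n)" by simp
    also have "\<dots> \<le> \<delta> * psum \<alpha> (Suc n)" using \<eta> psum_nonneg by (intro mult_right_mono) auto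
    finally have "\<bar>\<Sum>i=1..n. X i\<bar> \<le> \<delta> * psum \<alpha> (Suc n)" .
    moreover have "0 \<le> C1" unfolding C1_def by (intro sum_nonneg) auto
    ultimately show ?thesis by linarith
  next
    case False
    then have "\<bar>\<Sum>i=1..n. X i\<bar> \<le> C1" unfolding C1_def by (intro member_le_sum[of n "{..<n1}" "\<lambda>n. \<bar>\<Sum>i=1..n. X i\<bar>"]) auto
    moreover have "0 \<le> \<delta> * psum \<alpha> (Suc n)" using \<delta> psum_nonneg by (intro mult_nonneg_nonneg) auto
    ultimately show ?thesis by linarith
  qed
  define C2 where "C2 = (\<Sum>i<n0. \<bar>X i\<bar>)"
  have "\<bar>\<Sum>i<N. if n0 \<le> i then \<Sum>p\<in>{1..q}. avg g p i * t p i else 0\<bar> \<le> \<delta> * psum \<alpha> N + (C1 + C2)" for N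
  proof (cases N)
    case 0
    have "0 \<le> C1" "0 \<le> C2" unfolding C1_def C2_def by (auto intro: sum_nonneg)
    then show ?thesis by (simp add: 0 psum_def)
  next
    case (Suc n)
    have "(\<Sum>i<N. if n0 \<le> i then \<Sum>p\<in>{1..q}. avg g p i * t p i else 0) = (\<Sum>i<N. if n0 \<le> i then X i else 0)"
      by (intro sum.cong refl if_cong row)
    also have "\<dots> = (\<Sum>i=1..n. if n0 \<le> i then X i else 0)"
      using n0 by (intro sum.mono_neutral_right) (auto simp: Suc)
    also have "\<dots> = (\<Sum>i=1..n. X i - (if i < n0 then X i else 0))"
      by (intro sum.cong) auto
    also have "\<dots> = (\<Sum>i=1..n. X i) - (\<Sum>i=1..n. if i < n0 then X i else 0)"
      by (rule sum_subtractf)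
    finally have eq: "(\<Sum>i<N. if n0 \<le> i then \<Sum>p\<in>{1..q}. avg g p i * t p i else 0) = \<dots>" .
    have "\<bar>\<Sum>i=1..n. if i < n0 then X i else 0\<bar> \<le> (\<Sum>i=1..n. \<bar>if i < n0 then X i else 0\<bar>)"
      by (rule sum_abs)
    also have "\<dots> = (\<Sum>i\<in>{1..n} \<inter> {i. i < n0}. \<bar>X i\<bar>)"
      by (subst sum.inter_restrict) (auto intro!: sum.cong)
    also have "\<dots> \<le> C2" unfolding C2_def by (intro sum_mono2) auto
    finally show ?thesis unfolding eq using bound[of n] unfolding Suc by linarith
  qed
  then show ?thesis by blast
qed

text \<open>At each last visit time \<open>k\<close> the integral is replaced by its renewal main
  term. The errors form a convolution with null coefficients, the main terms one with the sequence
  \<open>G g\<close>, whose partial sums are small.\<close>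

lemma mixing_from_Y:
  fixes L :: "('a \<Rightarrow> real) \<Rightarrow> ('a \<Rightarrow> real)" and c :: "nat \<Rightarrow> nat \<Rightarrow> nat \<Rightarrow> real" and g :: "'a \<Rightarrow> real"
  assumes L: "transfer_operator M f L" and J: "jacobian_sums M f n0 q A \<psi> XX YY J"
    and \<alpha>: "0 < \<alpha>" "\<alpha> \<le> 1" and K: "0 \<le> K"
    and lim: "\<And>p. p \<in> {1..q} \<Longrightarrow> (\<lambda>i. t p i * real (Suc i) powr \<alpha>) \<longlonglongrightarrow> \<gamma> p"
    and renewal: "(\<lambda>n. ereal (norming_seq \<alpha> n) *
        Linf_norm M (\<lambda>x. indicator Y x * ((L ^^ n) (indicator Y) x - K * inverse (norming_seq \<alpha> n))))
        \<longlonglongrightarrow> 0"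
    and jac: "\<And>p \<epsilon>. p \<in> {1..q} \<Longrightarrow> 0 < \<epsilon> \<Longrightarrow>
      (\<lambda>j. \<Sum>i\<in>{i. \<epsilon> * real j < real i \<and> real i < inverse \<epsilon> * real j}.
             SUP x\<in>XX i p. ennreal \<bar>J j i p x - c j i p\<bar>) \<longlonglongrightarrow> 0"
    and g: "g \<in> borel_measurable M" and bd: "\<And>x. \<bar>g x\<bar> \<le> B"
    and avg0: "(\<lambda>n. (LINT x:(\<Union>i\<in>{1..n}. X_level M f Y i)|M. g x)
            / measure M (\<Union>i\<in>{1..n}. X_level M f Y i)) \<longlonglongrightarrow> 0"
  shows "(\<lambda>n. \<integral>x. indicator Y x * g ((f ^^ n) x) \<partial>M) \<longlonglongrightarrow> 0"
proof -
  let ?w = "\<lambda>k. inverse (norming_seq \<alpha> k)"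
  have B: "0 \<le> B" using bd[of undefined] by linarith
  obtain Cu where uC: "\<And>j. u j \<le> Cu * real (Suc j) powr (- \<alpha>)" using u_powr_bound[OF lim] by blast
  have Gsmall: "\<exists>C. \<forall>N. \<bar>\<Sum>j<N. G g j\<bar> \<le> \<delta> * psum \<alpha> N + C" if \<delta>: "0 < \<delta>" for \<delta>
  proof (rule excursion_partial_sums_small[where t = t and b = b and s = "avg g" and D = "D g" and u = u
        and P = "{1..q}" and B = B and Cu = Cu and \<gamma> = \<gamma> and \<alpha> = \<alpha> and ?n0.0 = n0])
    show "eventually (\<lambda>j. (\<Sum>i | \<epsilon> * real j < real i \<and> real i < inverse \<epsilon> * real j. \<bar>D g p j i - avg g p i * b p (j + i)\<bar>)
         \<le> \<delta> * real (Suc j) powr (- \<alpha>)) sequentially"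
      if "p \<in> {1..q}" "0 < \<epsilon>" "\<epsilon> < 1" "0 < \<delta>" for p \<epsilon> \<delta>
      using that by (intro jacobian_window_error[OF J _ \<alpha>(1) g bd uC jac]) auto
    show "\<exists>C. \<forall>N. \<bar>\<Sum>i<N. if n0 \<le> i then \<Sum>p\<in>{1..q}. avg g p i * t p i else 0\<bar> \<le> \<delta> * psum \<alpha> N + C"
      if "0 < \<delta>" for \<delta>
      using that by (rule observable_partial_sums_small[OF g bd avg0 uC])
    show "\<bar>G g j - (\<Sum>i\<in>{n0..<N}. \<Sum>p\<in>{1..q}. D g p j i)\<bar> \<le> B * (u j - u (j + n0)) + B * u N"
      if "1 \<le> j" "n0 \<le> N" for j N
      using that by (rule G_decomposition[OF g bd])
    show "\<bar>avg g p i\<bar> \<le> B" if "p \<in> {1..q}" "n0 \<le> i" for p i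
      using that by (intro avg_times_t(2)[OF g bd])
    show "\<bar>D g p j i\<bar> \<le> B * b p (j + i)" if "p \<in> {1..q}" "n0 \<le> i" for p j i
      using that by (intro D_bound[OF g bd])
  qed (rule \<alpha> n0 finite_atLeastAtMost lim t_nonneg t_Suc b_nonneg u_nonneg u_antimono uC B \<delta>; assumption)+
  obtain e where e0: "e \<longlonglongrightarrow> 0" and e': "\<forall>g B k j. g \<in> borel_measurable M \<longrightarrow> (\<forall>x. \<bar>g x\<bar> \<le> B) \<longrightarrow>
      \<bar>(\<integral>x. indicator Y x * (indicator (U j) ((f ^^ k) x) * g ((f ^^ j) ((f ^^ k) x))) \<partial>M)
        - K * ?w k * G g j\<bar> \<le> B * (e k * ?w k * u j)"
    using renewal_error[OF L K renewal] by (elim exE conjE)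
  have e: "\<bar>(\<integral>x. indicator Y x * (indicator (U j) ((f ^^ k) x) * g ((f ^^ j) ((f ^^ k) x))) \<partial>M)
        - K * ?w k * G g j\<bar> \<le> B * (e k * ?w k * u j)" for k j
    using e' g bd by blast
  have Gb: "\<bar>G g j\<bar> \<le> (B * Cu) * real (Suc j) powr (- \<alpha>)" for j
  proof -
    have "\<bar>G g j\<bar> \<le> B * u j" by (rule G_bound[OF g bd])
    also have "\<dots> \<le> B * (Cu * real (Suc j) powr (- \<alpha>))" using B uC by (intro mult_left_mono) auto
    finally show ?thesis by (simp only: mult.assoc)
  qed
  have "(\<lambda>n. B * (\<Sum>k\<le>n. e k * ?w k * u (n - k)) + K * \<bar>\<Sum>k\<le>n. ?w k * G g (n - k)\<bar>) \<longlonglongrightarrow> B * 0 + K * \<bar>0\<bar>"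
    by (intro tendsto_add tendsto_mult tendsto_const tendsto_rabs
        convolution_null_coefficients[OF \<alpha> u_nonneg uC e0] convolution_small_partial_sums[OF \<alpha> Gb Gsmall])
  then have lim0: "(\<lambda>n. B * (\<Sum>k\<le>n. e k * ?w k * u (n - k)) + K * \<bar>\<Sum>k\<le>n. ?w k * G g (n - k)\<bar>) \<longlonglongrightarrow> 0" by simp
  have "norm (\<integral>x. indicator Y x * g ((f ^^ n) x) \<partial>M) \<le> B * (\<Sum>k\<le>n. e k * ?w k * u (n - k)) + K * \<bar>\<Sum>k\<le>n. ?w k * G g (n - k)\<bar>" for n
  proof -
    define Q where "Q k = (\<integral>x. indicator Y x * (indicator (U (n - k)) ((f ^^ k) x) * g ((f ^^ (n - k)) ((f ^^ k) x))) \<partial>M)" for k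
    have "(\<integral>x. indicator Y x * g ((f ^^ n) x) \<partial>M) = (\<Sum>k\<le>n. Q k)"
      unfolding Q_def by (rule last_visit_decomposition[OF g bd])
    also have "\<dots> = (\<Sum>k\<le>n. Q k - K * ?w k * G g (n - k)) + K * (\<Sum>k\<le>n. ?w k * G g (n - k))"
      by (simp add: sum_subtractf sum_distrib_left mult.assoc)
    finally have eq: "(\<integral>x. indicator Y x * g ((f ^^ n) x) \<partial>M) = \<dots>" .
    have "\<bar>\<Sum>k\<le>n. Q k - K * ?w k * G g (n - k)\<bar> \<le> (\<Sum>k\<le>n. \<bar>Q k - K * ?w k * G g (n - k)\<bar>)" by (rule sum_abs)
    also have "\<dots> \<le> (\<Sum>k\<le>n. B * (e k * ?w k * u (n - k)))"
      unfolding Q_def by (intro sum_mono e)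
    also have "\<dots> = B * (\<Sum>k\<le>n. e k * ?w k * u (n - k))" by (simp only: sum_distrib_left)
    finally have 1: "\<bar>\<Sum>k\<le>n. Q k - K * ?w k * G g (n - k)\<bar> \<le> B * (\<Sum>k\<le>n. e k * ?w k * u (n - k))" .
    have "\<bar>K * (\<Sum>k\<le>n. ?w k * G g (n - k))\<bar> = K * \<bar>\<Sum>k\<le>n. ?w k * G g (n - k)\<bar>" using K by (simp add: abs_mult)
    with 1 show ?thesis unfolding eq real_norm_def by linarith
  qed
  then show ?thesis by (intro Lim_null_comparison[OF _ lim0]) auto
qed

end

theorem theorem2p6:
  fixes M :: "'a measure" and f :: "'a \<Rightarrow> 'a" and Y :: "'a set"
    and n0 q :: nat and A :: "'r set" and \<psi> :: "'r \<Rightarrow> nat"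
    and XX :: "nat \<Rightarrow> nat \<Rightarrow> 'a set" and YY :: "nat \<Rightarrow> 'r \<Rightarrow> 'a set"
    and L :: "('a \<Rightarrow> real) \<Rightarrow> ('a \<Rightarrow> real)"
    and J :: "nat \<Rightarrow> nat \<Rightarrow> nat \<Rightarrow> 'a \<Rightarrow> real"
    and \<alpha> K :: real and \<gamma> :: "nat \<Rightarrow> real" and c :: "nat \<Rightarrow> nat \<Rightarrow> nat \<Rightarrow> real"
  assumes "sigma_finite_measure M" and "emeasure M (space M) = \<infinity>"
    and "measure_preserving_map M f" and "conservative_map M f" and "exact_map M f"
    and "Y \<in> sets M" and "0 < emeasure M Y" and "emeasure M Y < \<infinity>"
    and "level_decomposition M f Y n0 q A \<psi> XX YY"
    and "transfer_operator M f L"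
    and "jacobian_sums M f n0 q A \<psi> XX YY J"
    and "0 < \<alpha>" and "\<alpha> \<le> 1" and "\<And>p. p \<in> {1..q} \<Longrightarrow> 0 < \<gamma> p"
    and tails: "\<And>p. p \<in> {1..q} \<Longrightarrow>
      (\<lambda>n. \<Sum>\<^sub>\<infinity>r\<in>{r\<in>A. \<psi> r = p}. \<Sum>\<^sub>\<infinity>j\<in>{n..}. measure M (YY j r))
        \<sim>[sequentially] (\<lambda>n. \<gamma> p * real n powr (- \<alpha>))"
    and "0 \<le> K"
    and renewal: "(\<lambda>n. ereal (norming_seq \<alpha> n) *
        Linf_norm M (\<lambda>x. indicator Y x * ((L ^^ n) (indicator Y) x - K * inverse (norming_seq \<alpha> n))))
        \<longlonglongrightarrow> 0"
    and "\<And>j i p. 1 \<le> j \<Longrightarrow> n0 \<le> i \<Longrightarrow> p \<in> {1..q} \<Longrightarrow> 0 < c j i p"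
    and jacobians: "\<And>p \<epsilon>. p \<in> {1..q} \<Longrightarrow> 0 < \<epsilon> \<Longrightarrow>
      (\<lambda>j. \<Sum>i\<in>{i. \<epsilon> * real j < real i \<and> real i < inverse \<epsilon> * real j}.
             SUP x\<in>XX i p. ennreal \<bar>J j i p x - c j i p\<bar>)
        \<longlonglongrightarrow> 0"
  shows "fully_global_local_mixing M f Y"
proof -
  interpret S: level_system M f Y n0 q A \<psi> XX YY
    using assms by unfold_locales
  have lim: "(\<lambda>i. S.t p i * real (Suc i) powr \<alpha>) \<longlonglongrightarrow> \<gamma> p" if "p \<in> {1..q}" for p
    using that assms by (intro S.t_asymptotics tails) auto
  have finY: "Y \<in> fmeasurable M" using S.U_fmeasurable[of 0] by (simp add: S.U_0)
  have mY: "0 < measure M Y"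
    using assms by (simp add: measure_def enn2real_positive_iff)
  \<comment> \<open>Only where these measures are nonzero does subtracting the average from
    \<open>g\<close> shift the quotient by exactly that amount.\<close>
  have m_pos: "eventually (\<lambda>n. measure M (\<Union>i\<in>{1..n}. X_level M f Y i) \<noteq> 0) sequentially"
  proof -
    have "1 \<le> q" using assms(9) by (simp add: level_decomposition_def)
    then have "0 < (\<Sum>p\<in>{1..q}. \<gamma> p)" using assms(14) by (intro sum_pos) auto
    then have "eventually (\<lambda>j. 0 < S.u j * real (Suc j) powr \<alpha>) sequentially"
      using order_tendstoD(1)[OF S.u_asymptotics[OF lim]] by blast
    then show ?thesis
      using eventually_ge_at_top[of 1]
    proof eventually_elim
      case (elim n)
      then have "0 < S.u n" by (simp add: zero_less_mult_iff)
      also have "S.u n \<le> (\<Sum>i=1..n. S.u i)"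
        using elim by (intro member_le_sum) (auto simp: S.u_nonneg)
      finally show ?case by (simp only: S.measure_X_levels)
    qed
  qed
  show ?thesis
    unfolding fully_global_local_mixing_def
  proof (intro allI impI)
    fix v g :: "'a \<Rightarrow> real" and gbar :: real
    assume v: "integrable M v" and obs: "global_observable M f Y g gbar"
    let ?V = "\<lambda>n. \<Union>i\<in>{1..n}. X_level M f Y i"
    have g [measurable]: "g \<in> borel_measurable M" and gfin: "Linf_norm M g < \<infinity>"
      and ratio: "(\<lambda>n. (LINT x:?V n|M. g x) / measure M (?V n)) \<longlonglongrightarrow> gbar"
      using obs by (auto simp: global_observable_def Linf_space_def)
    obtain B where "Linf_norm M g \<le> ereal B"
      using gfin by (cases "Linf_norm M g") auto
    have AEB: "AE x in M. \<bar>g x\<bar> \<le> B"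
    proof -
      have "AE x in M. ereal \<bar>g x\<bar> \<le> Linf_norm M g" unfolding Linf_norm_def by (rule esssup_AE)
      then show ?thesis
      proof eventually_elim
        case (elim x)
        then have "ereal \<bar>g x\<bar> \<le> ereal B" using \<open>Linf_norm M g \<le> ereal B\<close> by (rule order_trans)
        then show ?case by simp
      qed
    qed
    \<comment> \<open>\<open>g\<close> is bounded almost everywhere, whereas the estimates ask for
      bounds everywhere, so \<open>g\<close> is clipped before its average is subtracted. The change
      is on a null set, and preimages of null sets under iterates are null.\<close>
    define g' where "g' x = max (- \<bar>B\<bar>) (min \<bar>B\<bar> (g x)) - gbar" for x
    have g' [measurable]: "g' \<in> borel_measurable M" unfolding g'_def by measurable
    have bd': "\<bar>g' x\<bar> \<le> \<bar>B\<bar> + \<bar>gbar\<bar>" for x unfolding g'_def by linarith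
    have AEg: "AE x in M. g x = g' x + gbar"
      using AEB by eventually_elim (auto simp: g'_def)
    have avg0: "(\<lambda>n. (LINT x:?V n|M. g' x) / measure M (?V n)) \<longlonglongrightarrow> 0"
    proof -
      have "(\<lambda>n. (LINT x:?V n|M. g x) / measure M (?V n) - gbar) \<longlonglongrightarrow> gbar - gbar"
        by (intro tendsto_diff ratio tendsto_const)
      moreover have "eventually (\<lambda>n. (LINT x:?V n|M. g x) / measure M (?V n) - gbar = (LINT x:?V n|M. g' x) / measure M (?V n)) sequentially"
        using m_pos
      proof eventually_elim
        case (elim n)
        define W where "W = ?V n"
        have Wf: "W \<in> fmeasurable M" unfolding W_def by (rule S.X_levels_fmeasurable)
        then have [measurable]: "W \<in> sets M" by auto
        have "(LINT x:W|M. g x) = (\<integral>x. indicator W x * g' x + indicator W x * gbar \<partial>M)"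
          unfolding set_lebesgue_integral_def
        proof (rule integral_cong_AE)
          show "AE x in M. indicator W x *\<^sub>R g x = indicator W x * g' x + indicator W x * gbar"
            using AEg by eventually_elim (simp add: distrib_left)
        qed measurable
        also have "\<dots> = (\<integral>x. indicator W x * g' x \<partial>M) + (\<integral>x. indicator W x * gbar \<partial>M)"
        proof (rule Bochner_Integration.integral_add)
          show "integrable M (\<lambda>x. indicator W x * g' x)"
            by (rule S.integrable_indicator_bounded(1)[OF Wf g' bd'])
          show "integrable M (\<lambda>x. indicator W x * gbar)"
            by (rule S.integrable_indicator_bounded(1)[OF Wf, where B = "\<bar>gbar\<bar>"]) auto
        qed
        also have "\<dots> = (LINT x:W|M. g' x) + gbar * measure M W"
          by (simp add: set_lebesgue_integral_def)
        finally have "(LINT x:?V n|M. g x) = (LINT x:?V n|M. g' x) + gbar * measure M (?V n)"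
          unfolding W_def .
        then show ?case using elim by (simp add: field_simps)
      qed
      ultimately show ?thesis by (simp add: Lim_transform_eventually)
    qed
    have YY0: "(\<lambda>n. \<integral>x. indicator Y x * g' ((f ^^ n) x) \<partial>M) \<longlonglongrightarrow> 0"
      by (rule S.mixing_from_Y[OF assms(10,11,12,13) \<open>0 \<le> K\<close> lim renewal jacobians g' bd' avg0])
    \<comment> \<open>The multiple of 1_Y with the same integral as \<open>v\<close>; the difference
      \<open>v0\<close> has mean 0, as exactness requires.\<close>
    define k where "k = (\<integral>x. v x \<partial>M) / measure M Y"
    define v0 where "v0 x = v x - k * indicator Y x" for x
    have iY: "integrable M (indicator Y :: 'a \<Rightarrow> real)"
      using finY by (simp add: integrable_indicator_iff fmeasurable_def)
    have iv0: "integrable M v0" unfolding v0_def using v iY by auto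
    have "(\<integral>x. v0 x \<partial>M) = (\<integral>x. v x \<partial>M) - k * measure M Y"
      unfolding v0_def using v iY by simp
    also have "\<dots> = 0" using mY by (simp add: k_def)
    finally have v00: "(\<integral>x. v0 x \<partial>M) = 0" .
    have "(\<lambda>n. \<integral>x. v0 x * g' ((f ^^ n) x) \<partial>M) \<longlonglongrightarrow> 0"
      by (rule exact_correlations_null[OF assms(1) _ S.f_measurable assms(5) iv0 v00 g' bd'])
        (use assms(2) in simp)
    then have "(\<lambda>n. (\<integral>x. v0 x * g' ((f ^^ n) x) \<partial>M) + k * (\<integral>x. indicator Y x * g' ((f ^^ n) x) \<partial>M) + gbar * (\<integral>x. v x \<partial>M))
        \<longlonglongrightarrow> 0 + k * 0 + gbar * (\<integral>x. v x \<partial>M)"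
      by (intro tendsto_add tendsto_mult tendsto_const YY0)
    moreover have "(\<integral>x. v x * g ((f ^^ n) x) \<partial>M)
        = (\<integral>x. v0 x * g' ((f ^^ n) x) \<partial>M) + k * (\<integral>x. indicator Y x * g' ((f ^^ n) x) \<partial>M) + gbar * (\<integral>x. v x \<partial>M)" for n
    proof -
      note [measurable] = S.fn_measurable[of n]
      have [measurable]: "v \<in> borel_measurable M" "v0 \<in> borel_measurable M" using v iv0 by auto
      have ig: "integrable M (\<lambda>x. h x * g' ((f ^^ n) x))" if h: "integrable M h" for h :: "'a \<Rightarrow> real"
      proof (rule Bochner_Integration.integrable_bound)
        show "integrable M (\<lambda>x. (\<bar>B\<bar> + \<bar>gbar\<bar>) * h x)" using h by simp
        show "(\<lambda>x. h x * g' ((f ^^ n) x)) \<in> borel_measurable M" using h by measurable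
        have "\<bar>h x\<bar> * \<bar>g' ((f ^^ n) x)\<bar> \<le> (\<bar>B\<bar> + \<bar>gbar\<bar>) * \<bar>h x\<bar>" for x
          using mult_left_mono[OF bd'[of "(f ^^ n) x"] abs_ge_zero[of "h x"]] by (simp only: mult.commute)
        then show "AE x in M. norm (h x * g' ((f ^^ n) x)) \<le> norm ((\<bar>B\<bar> + \<bar>gbar\<bar>) * h x)"
          by (intro AE_I2) (simp add: abs_mult)
      qed
      have "(\<integral>x. v x * g ((f ^^ n) x) \<partial>M) = (\<integral>x. v0 x * g' ((f ^^ n) x) + k * (indicator Y x * g' ((f ^^ n) x)) + gbar * v x \<partial>M)"
      proof (rule integral_cong_AE)
        show "AE x in M. v x * g ((f ^^ n) x) = v0 x * g' ((f ^^ n) x) + k * (indicator Y x * g' ((f ^^ n) x)) + gbar * v x"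
          using S.AE_fn[OF AEg, of n] by eventually_elim (simp add: v0_def algebra_simps)
      qed measurable
      also have "\<dots> = (\<integral>x. v0 x * g' ((f ^^ n) x) \<partial>M) + k * (\<integral>x. indicator Y x * g' ((f ^^ n) x) \<partial>M) + gbar * (\<integral>x. v x \<partial>M)"
        using ig[OF iv0] ig[OF iY] v by simp
      finally show ?thesis .
    qed
    ultimately show "(\<lambda>n. \<integral>x. v x * g ((f ^^ n) x) \<partial>M) \<longlonglongrightarrow> gbar * (\<integral>x. v x \<partial>M)"
      by simp
  qed
qed

end
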